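(* Let $k,\ell,m,n$ be integers with $\ell,n\ge 1$, $2\le k\le n$ and $0\le m\le k-1$. Let $I=I_{k,\ell,m,n}\subseteq \mathbf{C}[x_1,\dots,x_n]$ be the ideal of all polynomials vanishing on $X_{k,\ell,n}\cup Y_{m+1,n}$, and let $(\lambda^0,\lambda^1)$ be the pair of partitions attached to $(k,m,n)$ (see context). Then $I$ is generated by the set of Garnir polynomials $f_T$, for $T$ ranging over all standard Young tableaux on $(\lambda^0,\lambda^1)$. Moreover, if $\ell>1$ or $m=k-1$, this is a minimal generating set of $I$.
   Context: $X_{k,\ell,n}$ is the set of $(x_1,\dots,x_n)\in\mathbf{C}^n$ for which there is $S\subseteq\{1,\dots,n\}$ with $|S|=k$ and $x_i^\ell=x_j^\ell$ for all $i,j\in S$. $Y_{m+1,n}$ is the set of $(x_1,\dots,x_n)\in\mathbf{C}^n$ for which there is $S\subseteq\{1,\dots,n\}$ with $|S|=m+1$ and $x_i=0$ for all $i\in S$. The pair $(\lambda^0,\lambda^1)$: write $n=q(k-1)+r$ with $0\le r<k-1$ and consider the Young diagram (English convention) of the partition $((k-1)^q,r)$. If $m=k-1$, let $\lambda^0$ be this whole partition and $\lambda^1=\emptyset$. Otherwise let $\lambda^1$ be the partition whose diagram consists of all boxes in columns $m+1,m+2,\dots,k-1$ (all boxes weakly below and to the right of the $(m+1)$th box of the top row), and let $\lambda^0$ be the partition formed by the remaining boxes (columns $1,\dots,m$). A standard Young tableau on $(\lambda^0,\lambda^1)$ is a bijection $T$ from the set of all boxes of $\lambda^0$ and $\lambda^1$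 together onto $\{1,\dots,n\}$ which, within each $\lambda^i$, is increasing from left to right along rows and from top to bottom along columns. Its Garnir polynomial is $$f_T=\prod_{b\in\lambda^1}x_{T(b)}\ \prod_{(b,b')}\left(x_{T(b)}^\ell-x_{T(b')}^\ell\right),$$ where the second product is over all pairs of boxes $(b,b')$ such that $b$ and $b'$ lie in the same column of the same $\lambda^i$ ($i\in\{0,1\}$) with $b$ above $b'$. *)

theory Defs
  imports Complex_Main "HOL-Library.Poly_Mapping" "HOL-Library.FuncSet" "HOL-Algebra.Ideal"
begin

text \<open>Exponent vectors are finitely supported maps on all of \<open>nat\<close>; the variables of
  \<open>\<complex>[x_1, \<dots>, x_n]\<close> are those with index in \<open>{1..n}\<close>, enforced by the carrier
  of \<open>poly_ring\<close> below.\<close>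

type_synonym cpoly = "(nat \<Rightarrow>\<^sub>0 nat) \<Rightarrow>\<^sub>0 complex"

definition Var :: "nat \<Rightarrow> cpoly" where
  "Var i = Poly_Mapping.single (Poly_Mapping.single i 1) 1"

definition eval_poly :: "cpoly \<Rightarrow> (nat \<Rightarrow> complex) \<Rightarrow> complex" where
  "eval_poly p x =
    (\<Sum>a\<in>Poly_Mapping.keys p. Poly_Mapping.lookup p a *
      (\<Prod>i\<in>Poly_Mapping.keys a. x i ^ Poly_Mapping.lookup a i))"

definition poly_ring :: "nat \<Rightarrow> cpoly ring" where
  "poly_ring n =
    \<lparr> carrier = {p. \<forall>a\<in>Poly_Mapping.keys p. Poly_Mapping.keys a \<subseteq> {1..n}},
      mult = (*), one = 1, zero = 0, add = (+) \<rparr>"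

lemma cring_poly_ring: "cring (poly_ring n)"
proof (rule cringI)
  show "abelian_group (poly_ring n)"
  proof (rule abelian_groupI)
    fix p q assume "p \<in> carrier (poly_ring n)" "q \<in> carrier (poly_ring n)"
    then show "p \<oplus>\<^bsub>poly_ring n\<^esub> q \<in> carrier (poly_ring n)"
      using Poly_Mapping.keys_add[of p q] by (force simp: poly_ring_def)
  next
    fix p assume "p \<in> carrier (poly_ring n)"
    then show "\<exists>q\<in>carrier (poly_ring n). q \<oplus>\<^bsub>poly_ring n\<^esub> p = \<zero>\<^bsub>poly_ring n\<^esub>"
      by (intro bexI[of _ "- p"]) (auto simp: poly_ring_def)
  qed (auto simp: poly_ring_def algebra_simps)
  show "Group.comm_monoid (poly_ring n)"
  proof (rule comm_monoidI)
    fix p q assume pq: "p \<in> carrier (poly_ring n)" "q \<in> carrier (poly_ring n)"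
    have "Poly_Mapping.keys c \<subseteq> {1..n}" if c: "c \<in> Poly_Mapping.keys (p * q)" for c
    proof -
      obtain a b where ab: "c = a + b" "a \<in> Poly_Mapping.keys p" "b \<in> Poly_Mapping.keys q"
        using c Poly_Mapping.keys_mult[of p q] by blast
      with pq have "Poly_Mapping.keys a \<union> Poly_Mapping.keys b \<subseteq> {1..n}"
        by (auto simp: poly_ring_def)
      then show ?thesis
        unfolding ab(1) using Poly_Mapping.keys_add[of a b] by blast
    qed
    then show "p \<otimes>\<^bsub>poly_ring n\<^esub> q \<in> carrier (poly_ring n)"
      by (simp add: poly_ring_def)
  qed (auto simp: poly_ring_def algebra_simps)
qed (auto simp: poly_ring_def algebra_simps)

text \<open>Points of \<open>\<complex>^n\<close> are extensional functions on \<open>{1..n}\<close>.\<close>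

definition X_set :: "nat \<Rightarrow> nat \<Rightarrow> nat \<Rightarrow> (nat \<Rightarrow> complex) set" where
  "X_set k l n =
    {x \<in> {1..n} \<rightarrow>\<^sub>E UNIV. \<exists>S. S \<subseteq> {1..n} \<and> card S = k \<and> (\<forall>i\<in>S. \<forall>j\<in>S. x i ^ l = x j ^ l)}"

text \<open>The first argument is the number of vanishing coordinates, so \<open>Y_{m+1,n}\<close> is
  \<open>Y_set (m + 1) n\<close>.\<close>

definition Y_set :: "nat \<Rightarrow> nat \<Rightarrow> (nat \<Rightarrow> complex) set" where
  "Y_set j n = {x \<in> {1..n} \<rightarrow>\<^sub>E UNIV. \<exists>S. S \<subseteq> {1..n} \<and> card S = j \<and> (\<forall>i\<in>S. x i = 0)}"

definition vanishing_ideal :: "nat \<Rightarrow> (nat \<Rightarrow> complex) set \<Rightarrow> cpoly set" where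
  "vanishing_ideal n Z = {p \<in> carrier (poly_ring n). \<forall>x\<in>Z. eval_poly p x = 0}"

definition I_ideal :: "nat \<Rightarrow> nat \<Rightarrow> nat \<Rightarrow> nat \<Rightarrow> cpoly set" where
  "I_ideal k l m n = vanishing_ideal n (X_set k l n \<union> Y_set (m + 1) n)"

text \<open>A partition is the list of its row lengths; trailing zeros are allowed and do not affect
  the diagram. Boxes are (row, column), both numbered from 1, rows from top to bottom.\<close>

definition diagram :: "nat list \<Rightarrow> (nat \<times> nat) set" where
  "diagram \<mu> = {(i, j). 1 \<le> i \<and> i \<le> length \<mu> \<and> 1 \<le> j \<and> j \<le> \<mu> ! (i - 1)}"

definition whole_partition :: "nat \<Rightarrow> nat \<Rightarrow> nat list" where
  "whole_partition k n = replicate (n div (k - 1)) (k - 1) @ [n mod (k - 1)]"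

text \<open>The first \<open>m\<close> columns of the diagram, and the remaining columns shifted left by \<open>m\<close>
  (no boxes when \<open>m = k - 1\<close>); see the two diagram lemmas.\<close>

definition lambda0 :: "nat \<Rightarrow> nat \<Rightarrow> nat \<Rightarrow> nat list" where
  "lambda0 k m n = map (\<lambda>a. min a m) (whole_partition k n)"

definition lambda1 :: "nat \<Rightarrow> nat \<Rightarrow> nat \<Rightarrow> nat list" where
  "lambda1 k m n = map (\<lambda>a. a - m) (whole_partition k n)"

lemma diagram_lambda0:
  "diagram (lambda0 k m n) = {(i, j) \<in> diagram (whole_partition k n). j \<le> m}"
  by (auto simp: diagram_def lambda0_def)

lemma diagram_lambda1:
  "(\<lambda>(i, j). (i, j + m)) ` diagram (lambda1 k m n) =
    {(i, j) \<in> diagram (whole_partition k n). m < j}"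
proof (intro equalityI subsetI)
  fix b assume "b \<in> {(i, j) \<in> diagram (whole_partition k n). m < j}"
  then show "b \<in> (\<lambda>(i, j). (i, j + m)) ` diagram (lambda1 k m n)"
    by (intro image_eqI[of _ _ "(fst b, snd b - m)"])
      (auto simp: diagram_def lambda1_def)
qed (auto simp: diagram_def lambda1_def)

text \<open>Boxes of a pair of partitions are tagged \<open>(e, i, j)\<close>: box \<open>(i, j)\<close> of the \<open>e\<close>-th
  component, \<open>e = 0, 1\<close>.\<close>

definition boxes :: "nat list \<times> nat list \<Rightarrow> (nat \<times> nat \<times> nat) set" where
  "boxes \<Lambda> = {0} \<times> diagram (fst \<Lambda>) \<union> {1} \<times> diagram (snd \<Lambda>)"

definition standard_tableaux :: "nat \<Rightarrow> nat list \<times> nat list \<Rightarrow> (nat \<times> nat \<times> nat \<Rightarrow> nat) set" where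
  "standard_tableaux n \<Lambda> =
    {T \<in> extensional (boxes \<Lambda>). bij_betw T (boxes \<Lambda>) {1..n} \<and>
      (\<forall>e i j j'. (e, i, j) \<in> boxes \<Lambda> \<and> (e, i, j') \<in> boxes \<Lambda> \<and> j < j' \<longrightarrow> T (e, i, j) < T (e, i, j')) \<and>
      (\<forall>e i i' j. (e, i, j) \<in> boxes \<Lambda> \<and> (e, i', j) \<in> boxes \<Lambda> \<and> i < i' \<longrightarrow> T (e, i, j) < T (e, i', j))}"

definition column_pairs ::
  "nat list \<times> nat list \<Rightarrow> ((nat \<times> nat \<times> nat) \<times> (nat \<times> nat \<times> nat)) set" where
  "column_pairs \<Lambda> =
    {((e, i, j), (e', i', j')). (e, i, j) \<in> boxes \<Lambda> \<and> (e', i', j') \<in> boxes \<Lambda> \<and>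
      e = e' \<and> j = j' \<and> i < i'}"

definition garnir_poly ::
  "nat \<Rightarrow> nat list \<times> nat list \<Rightarrow> (nat \<times> nat \<times> nat \<Rightarrow> nat) \<Rightarrow> cpoly" where
  "garnir_poly l \<Lambda> T =
    (\<Prod>b\<in>{1} \<times> diagram (snd \<Lambda>). Var (T b)) *
    (\<Prod>(b, b')\<in>column_pairs \<Lambda>. Var (T b) ^ l - Var (T b') ^ l)"

lemma finite_diagram: "finite (diagram \<mu>)"
proof (rule finite_subset)
  show "diagram \<mu> \<subseteq> {1..length \<mu>} \<times> {1..Max (set \<mu>)}"
    by (auto simp: diagram_def intro!: order_trans[OF _ Max_ge])
qed simp

lemma finite_column_pairs: "finite (column_pairs \<Lambda>)"
proof (rule finite_subset)
  show "column_pairs \<Lambda> \<subseteq> boxes \<Lambda> \<times> boxes \<Lambda>"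
    by (auto simp: column_pairs_def)
  show "finite (boxes \<Lambda> \<times> boxes \<Lambda>)"
    by (simp add: boxes_def finite_diagram)
qed

definition garnir_set :: "nat \<Rightarrow> nat \<Rightarrow> nat \<Rightarrow> nat \<Rightarrow> cpoly set" where
  "garnir_set k l m n =
    (let \<Lambda> = (lambda0 k m n, lambda1 k m n) in garnir_poly l \<Lambda> ` standard_tableaux n \<Lambda>)"

definition generates :: "('a, 'b) ring_scheme \<Rightarrow> 'a set \<Rightarrow> 'a set \<Rightarrow> bool" where
  "generates R I G \<longleftrightarrow> G \<subseteq> carrier R \<and> genideal R G = I"

definition minimal_generating_set :: "('a, 'b) ring_scheme \<Rightarrow> 'a set \<Rightarrow> 'a set \<Rightarrow> bool" where
  "minimal_generating_set R I G \<longleftrightarrow> generates R I G \<and> (\<forall>H. H \<subset> G \<longrightarrow> \<not> generates R I H)"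

end

theory Submission
  imports Defs "HOL-Computational_Algebra.Polynomial"
begin

text \<open>
  Put \<open>N = k - 1\<close>, \<open>c = k - 1 - m\<close> and \<open>y_i = x_i ^ l\<close>. Colour the indices \<open>1, \<dots>, n\<close> with
  \<open>0, \<dots>, N - 1\<close>. The \<^emph>\<open>colour polynomial\<close> of a colouring is the product of all \<open>x_i\<close> whose
  colour is below \<open>c\<close> and of all differences \<open>y_i - y_j\<close> with \<open>i < j\<close> of the same colour.
  Colours below \<open>c\<close> play the role of columns of \<open>\<lambda>\<^sup>1\<close>, the others of columns of \<open>\<lambda>\<^sup>0\<close>, and
  the Garnir polynomial of a tableau is the colour polynomial of its columns. By the pigeonhole
  principle every colour polynomial vanishes on \<open>X\<close> and on \<open>Y\<close> (lemma \<open>colour_poly_in_I\<close>).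
  Generation is proved by shrinking the set of colourings in three steps.

  \<^emph>\<open>Every colouring.\<close> Averaging over the \<open>l\<close>-th roots of unity in each variable
  (\<open>residue_part_in_I\<close>) reduces to an \<open>f\<close> in the ideal all of whose exponents have the same
  residues modulo \<open>l\<close>. If \<open>A\<close> is the set of indices with nonzero residue, then up to its
  monomial factor \<open>f\<close> is a polynomial \<open>F\<close> in the \<open>y_i\<close> which vanishes at the \<open>y\<close> with \<open>y_i \<noteq> 0\<close>
  on \<open>A\<close> that have more than \<open>N\<close> equal coordinates, where \<open>c\<close> extra coordinates \<open>0\<close> are
  thought to be adjoined to \<open>y\<close>. Order the variables with \<open>A\<close> first and let \<open>a\<close> be the
  lexicographically leading exponent of \<open>F\<close>. Colour the indices one by one, giving each the
  fullest colour whose class has at most \<open>a_i\<close> elements; at the end of \<open>A\<close> the \<open>c\<close> extra zeros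
  enter as one element each of the \<open>c\<close> fullest colours, and these become the colours below
  \<open>c\<close>. If this got stuck, then successive leading coefficients of \<open>F\<close> would vanish at all points
  whose multiset of coordinates is at least as concentrated, in the dominance order, as the row
  lengths of the diagram of colour classes; after the last variable this would say that the
  leading coefficient is zero. This is \<open>greedy_colouring_below_lead\<close>, and its one step is
  \<open>majorizes_add_box\<close>. So the leading exponent of \<open>f\<close> is divisible by that of a colour
  polynomial, and division yields \<open>I_subset_colour_ideal\<close>.

  \<^emph>\<open>Balanced colourings.\<close> Lagrange interpolation writes the product of two Vandermonde
  products over blocks \<open>A\<close> and \<open>B\<close> with \<open>card B < card A\<close> as a combination of those in which one
  element of \<open>A\<close> has moved to \<open>B\<close> (\<open>vandermonde_exchange\<close>). Moves of this kind lead from any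
  colouring to one whose class sizes are the column lengths of \<open>\<lambda>\<^sup>0\<close> and \<open>\<lambda>\<^sup>1\<close>
  (\<open>colour_ideal_subset_balanced\<close>).

  \<^emph>\<open>Standard tableaux.\<close> The same division, applied to the colour polynomials of balanced
  colourings with a given set \<open>A\<close> of indices of low colour, only meets exponents of the
  smallest possible degree. Then the inequalities between exponents and positions in the classes
  are equalities, so that the leading exponent records the row of each index, and sorting
  the rows yields a standard tableau whose Garnir polynomial has this leading exponent
  (\<open>exists_standard_tableau\<close>, \<open>balanced_colour_poly_in_garnir_ideal\<close>).

  \<^emph>\<open>Minimality.\<close> All Garnir polynomials are homogeneous of the same degree, so one of them lies in
  the ideal generated by others only if it is a linear combination of them. The leading
  exponent of \<open>x_i\<close> in the Garnir polynomial of \<open>T\<close> is \<open>l\<close> times the number of boxes above \<open>i\<close>,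
  plus one if \<open>i\<close> lies in \<open>\<lambda>\<^sup>1\<close>. If \<open>l > 1\<close>, or if \<open>\<lambda>\<^sup>1\<close> is empty, it determines the component and the
  row of each \<open>i\<close>, hence the standard tableau, so the leading exponents are distinct and the
  polynomials are linearly independent.
\<close>

abbreviation (input) keys :: "('a \<Rightarrow>\<^sub>0 'b::zero) \<Rightarrow> 'a set" where
  "keys \<equiv> Poly_Mapping.keys"

abbreviation (input) lookup :: "('a \<Rightarrow>\<^sub>0 'b::zero) \<Rightarrow> 'a \<Rightarrow> 'b" where
  "lookup \<equiv> Poly_Mapping.lookup"

abbreviation (input) single :: "'a \<Rightarrow> 'b::zero \<Rightarrow> 'a \<Rightarrow>\<^sub>0 'b" where
  "single \<equiv> Poly_Mapping.single"

section \<open>Majorization and row shapes\<close>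

lemma sum_le_sum_prefix:
  fixes f :: "nat \<Rightarrow> nat"
  assumes "antimono f" "finite J" "card J \<le> r"
  shows "sum f J \<le> sum f {..<r}"
proof -
  have "card (J - {..<r}) + card (J \<inter> {..<r}) = card J"
    by (metis assms(2) card_Diff_subset_Int card_mono finite_Int inf_le1 le_add_diff_inverse2)
  moreover have "card ({..<r} - J) + card (J \<inter> {..<r}) = r"
    by (metis Int_commute card_Diff_subset_Int card_lessThan card_mono finite_Int finite_lessThan
        inf_le1 le_add_diff_inverse2)
  ultimately have c: "card (J - {..<r}) \<le> card ({..<r} - J)" using assms(3) by linarith
  have "sum f (J - {..<r}) \<le> (\<Sum>j\<in>J - {..<r}. f r)"
    by (intro sum_mono) (use assms(1) in \<open>auto simp: antimono_def\<close>)
  also have "\<dots> \<le> (\<Sum>j\<in>{..<r} - J. f r)" using c by simp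
  also have "\<dots> \<le> sum f ({..<r} - J)"
    by (intro sum_mono) (use assms(1) in \<open>auto simp: antimono_def\<close>)
  finally have "sum f (J \<inter> {..<r}) + sum f (J - {..<r}) \<le> sum f (J \<inter> {..<r}) + sum f ({..<r} - J)"
    by simp
  moreover have "sum f J = sum f (J \<inter> {..<r}) + sum f (J - {..<r})"
    using sum.Int_Diff[OF assms(2)] by blast
  moreover have "sum f {..<r} = sum f (J \<inter> {..<r}) + sum f ({..<r} - J)"
    by (metis Int_commute finite_lessThan sum.Int_Diff)
  ultimately show ?thesis by linarith
qed

lemma sorted_enumeration:
  fixes \<nu> :: "'a \<Rightarrow> nat"
  assumes fin: "finite {v. \<nu> v \<noteq> 0}" and inf: "infinite U"
  shows "\<exists>e :: nat \<Rightarrow> 'a. inj e \<and> range e \<subseteq> U \<and> antimono (\<lambda>i. \<nu> (e i)) \<and>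
    (\<forall>v\<in>U. \<nu> v \<noteq> 0 \<longrightarrow> v \<in> range e)"
proof -
  let ?S = "{v \<in> U. \<nu> v \<noteq> 0}"
  have finS: "finite ?S" by (rule finite_subset[OF _ fin]) auto
  obtain ys where ys: "set ys = ?S" "distinct ys"
    using finite_distinct_list[OF finS] by blast
  define xs where "xs = rev (sort_key \<nu> ys)"
  have xs: "set xs = ?S" "distinct xs" using ys by (auto simp: xs_def)
  have srt: "\<nu> (xs ! j) \<le> \<nu> (xs ! i)" if "i \<le> j" "j < length xs" for i j
  proof -
    have s: "sorted (map \<nu> (sort_key \<nu> ys))" by simp
    let ?zs = "sort_key \<nu> ys"
    have "\<nu> (?zs ! (length ?zs - Suc j)) \<le> \<nu> (?zs ! (length ?zs - Suc i))"
      using sorted_nth_mono[OF s, of "length ?zs - Suc j" "length ?zs - Suc i"] that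
      by (auto simp: xs_def)
    then show ?thesis using that by (simp add: xs_def rev_nth)
  qed
  have "infinite (U - ?S)" using inf finS by simp
  then obtain g :: "nat \<Rightarrow> 'a" where g: "inj g" "range g \<subseteq> U - ?S"
    using infinite_countable_subset by blast
  define e where "e i = (if i < length xs then xs ! i else g (i - length xs))" for i
  have gz: "\<nu> (g i) = 0" "g i \<in> U" "g i \<notin> set xs" for i
    using g(2) xs(1) by (auto simp: subset_iff)
  show ?thesis
  proof (intro exI conjI ballI impI)
    show "inj e"
    proof (rule injI)
      fix i j assume eq: "e i = e j"
      have mem: "i < length xs \<Longrightarrow> e i \<in> set xs" "\<not> i < length xs \<Longrightarrow> e i \<notin> set xs" for i
        using gz(3) by (auto simp: e_def)
      show "i = j"
      proof (cases "i < length xs")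
        case True
        then have "j < length xs" using mem eq by metis
        then show ?thesis using True eq xs(2) by (simp add: e_def nth_eq_iff_index_eq)
      next
        case False
        then have "\<not> j < length xs" using mem eq by metis
        then show ?thesis using False eq g(1) by (simp add: e_def inj_eq)
      qed
    qed
    show "range e \<subseteq> U" using gz(2) xs(1) by (auto simp: e_def dest: nth_mem)
    show "antimono (\<lambda>i. \<nu> (e i))" using srt gz(1) by (auto simp: antimono_def e_def)
    show "v \<in> range e" if "v \<in> U" "\<nu> v \<noteq> 0" for v
    proof -
      have "v \<in> set xs" using that xs by auto
      then obtain i where "i < length xs" "xs ! i = v" by (metis in_set_conv_nth)
      then have "e i = v" by (simp add: e_def)
      then show ?thesis by blast
    qed
  qed
qed

text \<open>The dominance order between a multiset, given by its multiplicities \<open>\<nu>\<close> on the values in \<open>U\<close>, and a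
partition with rows \<open>\<mu>\<close>: the \<open>r\<close> largest multiplicities sum to at least the first \<open>r\<close> rows. Stating
this with sets of at most \<open>r\<close> values avoids sorting \<open>\<nu>\<close>.\<close>

definition majorizes :: "'a set \<Rightarrow> ('a \<Rightarrow> nat) \<Rightarrow> (nat \<Rightarrow> nat) \<Rightarrow> bool" where
  "majorizes U \<nu> \<mu> \<longleftrightarrow>
    (\<forall>r. \<exists>S\<subseteq>U. finite S \<and> card S \<le> r \<and> (\<Sum>i<r. \<mu> i) \<le> (\<Sum>v\<in>S. \<nu> v))"

lemma majorizes_prefix:
  assumes "majorizes U \<nu> \<mu>" "inj e" "antimono (\<lambda>i. \<nu> (e i))"
    "\<And>v. v \<in> U \<Longrightarrow> \<nu> v \<noteq> 0 \<Longrightarrow> v \<in> range e"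
  shows "(\<Sum>i<r. \<mu> i) \<le> (\<Sum>i<r. \<nu> (e i))"
proof -
  obtain S where S: "S \<subseteq> U" "finite S" "card S \<le> r" "(\<Sum>i<r. \<mu> i) \<le> sum \<nu> S"
    using assms(1) unfolding majorizes_def by blast
  let ?J = "e -` S"
  have fin: "finite ?J" using assms(2) S(2) by (rule finite_vimageI[rotated])
  have im: "e ` ?J \<subseteq> S" by auto
  have "card ?J = card (e ` ?J)" using assms(2) by (metis card_image inj_on_subset subset_UNIV)
  also have "\<dots> \<le> card S" using im S(2) by (rule card_mono[rotated])
  finally have c: "card ?J \<le> r" using S(3) by simp
  have "sum \<nu> S = sum \<nu> (e ` ?J)"
    by (rule sum.mono_neutral_right) (use S assms(4) in \<open>auto simp: image_iff\<close>)
  also have "\<dots> = (\<Sum>i\<in>?J. \<nu> (e i))"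
    using assms(2) by (subst sum.reindex) (auto simp: inj_on_def)
  also have "\<dots> \<le> (\<Sum>i<r. \<nu> (e i))" using sum_le_sum_prefix[OF assms(3) fin c] .
  finally show ?thesis using S(4) by simp
qed

text \<open>Adding a box in row \<open>a\<close>, pushed up to the first row of the same length so that the rows stay
weakly decreasing.\<close>

definition add_box :: "(nat \<Rightarrow> nat) \<Rightarrow> nat \<Rightarrow> (nat \<Rightarrow> nat)" where
  "add_box \<mu> a = \<mu>((LEAST i. \<mu> i = \<mu> a) := Suc (\<mu> a))"

lemma add_box_row:
  assumes "antimono \<mu>"
  shows "\<exists>s\<le>a. (\<forall>i. s \<le> i \<and> i \<le> a \<longrightarrow> \<mu> i = \<mu> a) \<and> (\<forall>i<s. \<mu> a < \<mu> i) \<and>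
    add_box \<mu> a = \<mu>(s := Suc (\<mu> a))"
proof -
  define s where "s = (LEAST i. \<mu> i = \<mu> a)"
  have s: "\<mu> s = \<mu> a" "s \<le> a" unfolding s_def by (auto intro: LeastI Least_le)
  show ?thesis
  proof (intro exI conjI allI impI; (elim conjE)?)
    show "s \<le> a" by fact
    show "\<mu> i = \<mu> a" if "s \<le> i" "i \<le> a" for i
      using assms that s by (metis antimonoD order_antisym)
    show "\<mu> a < \<mu> i" if "i < s" for i
    proof -
      have "\<mu> i \<noteq> \<mu> a" using that not_less_Least unfolding s_def by blast
      moreover have "\<mu> a \<le> \<mu> i" using assms that s by (simp add: antimonoD)
      ultimately show ?thesis by simp
    qed
    show "add_box \<mu> a = \<mu>(s := Suc (\<mu> a))" by (simp add: add_box_def s_def)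
  qed
qed

lemma sum_fun_upd_Suc:
  fixes \<mu> :: "nat \<Rightarrow> nat"
  assumes "x = Suc (\<mu> s)"
  shows "(\<Sum>i<r. (\<mu>(s := x)) i) = (\<Sum>i<r. \<mu> i) + (if s < r then 1 else 0)"
  using assms by (induction r) (auto simp: less_Suc_eq)

text \<open>The combinatorial heart of the elimination: if \<open>\<nu>\<close> dominates \<open>\<mu>\<close>, then there are \<open>a + 1\<close> values at which
the multiplicity can be raised so that \<open>\<nu>\<close> dominates the enlarged shape. The \<open>a + 1\<close> most frequent
values do. Let the new box be in row \<open>s\<close>; the difference of the partial sums of \<open>\<nu>\<close> and \<open>\<mu>\<close> is
nonnegative, and it is concave between \<open>s\<close> and \<open>a + 1\<close>, where \<open>\<mu>\<close> is constant. Raising the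
\<open>i\<close>-th value (counting from \<open>0\<close>) can only fail at a partial sum \<open>r\<close> with \<open>s < r \<le> i\<close> at which the
difference is zero. If the \<open>i\<close>-th value is as frequent as the one of index \<open>r - 1\<close>, it can replace that one
among the first \<open>r\<close>; if it is less frequent, then concavity makes the difference negative at \<open>a + 1\<close>.\<close>

lemma majorizes_add_box:
  fixes \<nu> :: "'a \<Rightarrow> nat"
  assumes dom: "majorizes U \<nu> \<mu>" and fin: "finite {v. \<nu> v \<noteq> 0}" and inf: "infinite U"
    and anti: "antimono \<mu>"
  obtains W where "W \<subseteq> U" "finite W" "card W = Suc a"
    "\<And>v. v \<in> W \<Longrightarrow> majorizes U (\<nu>(v := Suc (\<nu> v))) (add_box \<mu> a)"
proof -
  obtain e :: "nat \<Rightarrow> 'a" where e: "inj e" "range e \<subseteq> U" "antimono (\<lambda>i. \<nu> (e i))"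
    "\<And>v. v \<in> U \<Longrightarrow> \<nu> v \<noteq> 0 \<Longrightarrow> v \<in> range e"
    using sorted_enumeration[OF fin inf] by auto
  have le: "(\<Sum>i<r. \<mu> i) \<le> (\<Sum>i<r. \<nu> (e i))" for r
    using majorizes_prefix[OF dom e(1,3,4)] .
  obtain s where s: "s \<le> a" "\<And>i. s \<le> i \<Longrightarrow> i \<le> a \<Longrightarrow> \<mu> i = \<mu> a"
    "add_box \<mu> a = \<mu>(s := Suc (\<mu> a))"
    using add_box_row[OF anti, of a] by metis
  have einj: "inj_on e S" for S using e(1) by (metis inj_on_subset subset_UNIV)
  show ?thesis
  proof
    show "e ` {..a} \<subseteq> U" using e(2) by auto
    show "card (e ` {..a}) = Suc a" using card_image[OF einj[of "{..a}"]] by simp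
    show "finite (e ` {..a})" by simp
    fix v assume "v \<in> e ` {..a}"
    then obtain i where i: "i \<le> a" "v = e i" by auto
    show "majorizes U (\<nu>(v := Suc (\<nu> v))) (add_box \<mu> a)"
      unfolding majorizes_def
    proof
      fix r
      have tgt: "(\<Sum>j<r. add_box \<mu> a j) = (\<Sum>j<r. \<mu> j) + (if s < r then 1 else 0)"
        unfolding s(3) by (rule sum_fun_upd_Suc) (use s(1) s(2)[of s] in simp)
      have up: "(\<Sum>u\<in>e ` J. (\<nu>(v := Suc (\<nu> v))) u) = (\<Sum>j\<in>J. \<nu> (e j)) + (if i \<in> J then 1 else 0)"
        if "finite J" for J
      proof -
        have "(\<Sum>u\<in>e ` J. (\<nu>(v := Suc (\<nu> v))) u) = (\<Sum>j\<in>J. \<nu> (e j) + (if j = i then 1 else 0))"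
          unfolding i(2) sum.reindex[OF einj] by (intro sum.cong) (simp_all add: inj_eq[OF e(1)])
        also have "\<dots> = (\<Sum>j\<in>J. \<nu> (e j)) + (if i \<in> J then 1 else 0)"
          using that by (simp add: sum.distrib)
        finally show ?thesis .
      qed
      have goal: "\<exists>S\<subseteq>U. finite S \<and> card S \<le> r \<and>
          (\<Sum>i<r. add_box \<mu> a i) \<le> (\<Sum>u\<in>S. (\<nu>(v := Suc (\<nu> v))) u)"
        if "finite J" "card J \<le> r"
          "(\<Sum>j<r. \<mu> j) + (if s < r then 1 else 0) \<le> (\<Sum>j\<in>J. \<nu> (e j)) + (if i \<in> J then 1 else 0)" for J
      proof (intro exI conjI)
        show "e ` J \<subseteq> U" using e(2) by blast
        show "finite (e ` J)" using that(1) by simp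
        show "card (e ` J) \<le> r" using card_image[OF einj[of J]] that(2) by simp
        show "(\<Sum>i<r. add_box \<mu> a i) \<le> (\<Sum>u\<in>e ` J. (\<nu>(v := Suc (\<nu> v))) u)"
          unfolding tgt up[OF that(1)] by (rule that(3))
      qed
      consider "r \<le> s \<or> i < r" | "s < r" "r \<le> i" "\<nu> (e (r - 1)) = \<nu> (e i)"
        | "s < r" "r \<le> i" "\<nu> (e (r - 1)) \<noteq> \<nu> (e i)" by linarith
      then show "\<exists>S\<subseteq>U. finite S \<and> card S \<le> r \<and>
          (\<Sum>i<r. add_box \<mu> a i) \<le> (\<Sum>u\<in>S. (\<nu>(v := Suc (\<nu> v))) u)"
      proof cases
        case 1
        then have "s < r \<longrightarrow> i < r" by linarith
        then show ?thesis using le[of r] by (intro goal[of "{..<r}"]) simp_all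
      next
        case 2
        obtain r' where r': "r = Suc r'" using 2 by (cases r) auto
        have i': "i \<notin> {..<r'}" using 2 r' by simp
        have "(\<Sum>j<r. \<nu> (e j)) = (\<Sum>j\<in>insert i {..<r'}. \<nu> (e j))"
          using 2(3) i' r' by simp
        then show ?thesis using le[of r] 2 i' r' by (intro goal[of "insert i {..<r'}"]) simp_all
      next
        case 3
        have lt: "\<nu> (e i) < \<nu> (e (r - 1))"
          using 3 antimonoD[OF e(3), of "r - 1" i] by linarith
        have "(\<Sum>j<r. \<mu> j) \<noteq> (\<Sum>j<r. \<nu> (e j))"
        proof
          assume eq: "(\<Sum>j<r. \<mu> j) = (\<Sum>j<r. \<nu> (e j))"
          have split: "(\<Sum>j<q. f j) = (\<Sum>j<p. f j) + (\<Sum>j\<in>{p..<q}. f j)" if "p \<le> q"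
            for f :: "nat \<Rightarrow> nat" and p q
            using sum.union_disjoint[of "{..<p}" "{p..<q}" f] that
            by (simp add: ivl_disj_un(8) ivl_disj_int)
          \<comment> \<open>between \<open>s\<close> and \<open>r\<close> the multiplicities sum to at most the rows, so the smallest one is at most the row length\<close>
          have "(\<Sum>j\<in>{s..<r}. \<nu> (e (r - 1))) \<le> (\<Sum>j\<in>{s..<r}. \<nu> (e j))"
            by (intro sum_mono) (auto intro!: antimonoD[OF e(3)])
          also have "\<dots> \<le> (\<Sum>j\<in>{s..<r}. \<mu> j)"
            using le[of s] eq split[of s r \<mu>] split[of s r "\<lambda>j. \<nu> (e j)"] 3 by linarith
          also have "\<dots> = (\<Sum>j\<in>{s..<r}. \<mu> a)"
            by (rule sum.cong[OF refl], rule s(2)) (use 3 i in auto)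
          finally have kap: "\<nu> (e (r - 1)) \<le> \<mu> a" using 3 by simp
          have "(\<Sum>j\<in>{r..<Suc a}. \<nu> (e j)) < (\<Sum>j\<in>{r..<Suc a}. \<mu> a)"
          proof (rule sum_strict_mono_ex1)
            show "\<forall>j\<in>{r..<Suc a}. \<nu> (e j) \<le> \<mu> a"
            proof
              fix j assume "j \<in> {r..<Suc a}"
              then have "\<nu> (e j) \<le> \<nu> (e (r - 1))" by (intro antimonoD[OF e(3)]) auto
              then show "\<nu> (e j) \<le> \<mu> a" using kap by simp
            qed
            show "\<exists>j\<in>{r..<Suc a}. \<nu> (e j) < \<mu> a" using 3 i lt kap by (intro bexI[of _ i]) auto
          qed simp
          also have "\<dots> = (\<Sum>j\<in>{r..<Suc a}. \<mu> j)"
            by (rule sum.cong[OF refl], rule s(2)[symmetric]) (use 3 in auto)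
          finally show False
            using le[of "Suc a"] eq split[of r "Suc a" \<mu>] split[of r "Suc a" "\<lambda>j. \<nu> (e j)"] 3 i
            by simp
        qed
        then show ?thesis using le[of r] 3 by (intro goal[of "{..<r}"]) simp_all
      qed
    qed
  qed
qed

text \<open>Inserting a row of length \<open>c\<close> at its place among the weakly decreasing rows \<open>\<mu>\<close>, as a median.\<close>

definition insert_row :: "nat \<Rightarrow> (nat \<Rightarrow> nat) \<Rightarrow> (nat \<Rightarrow> nat)" where
  "insert_row c \<mu> i = max (\<mu> i) (if i = 0 then c else min c (\<mu> (i - 1)))"

lemma sum_insert_row:
  assumes "antimono \<mu>"
  shows "(\<Sum>i<Suc r. insert_row c \<mu> i) = max (\<Sum>i<Suc r. \<mu> i) ((\<Sum>i<r. \<mu> i) + c)"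
proof (induction r)
  case (Suc r)
  have "\<mu> (Suc r) \<le> \<mu> r" using assms by (simp add: antimonoD)
  then show ?case using Suc by (auto simp: insert_row_def max_def min_def split: if_splits)
qed (auto simp: insert_row_def)

text \<open>The first \<open>r\<close> rows after insertion are either the first \<open>r\<close> old rows, or \<open>r - 1\<close> old rows and the new
one; in the second case the value \<open>z\<close> is added to the chosen values.\<close>

lemma majorizes_insert_row:
  assumes "majorizes U \<nu> \<mu>" "antimono \<mu>" "z \<notin> U"
  shows "majorizes UNIV (\<nu>(z := \<nu> z + c)) (insert_row c \<mu>)"
  unfolding majorizes_def
proof
  fix r
  show "\<exists>S\<subseteq>UNIV. finite S \<and> card S \<le> r \<and> (\<Sum>i<r. insert_row c \<mu> i) \<le> (\<Sum>v\<in>S. (\<nu>(z := \<nu> z + c)) v)"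
  proof (cases r)
    case 0 then show ?thesis by (intro exI[of _ "{}"]) auto
  next
    case (Suc q)
    obtain S where S: "S \<subseteq> U" "finite S" "card S \<le> r" "(\<Sum>i<r. \<mu> i) \<le> sum \<nu> S"
      using assms(1) unfolding majorizes_def by blast
    obtain S' where S': "S' \<subseteq> U" "finite S'" "card S' \<le> q" "(\<Sum>i<q. \<mu> i) \<le> sum \<nu> S'"
      using assms(1) unfolding majorizes_def by blast
    have eq: "(\<Sum>v\<in>T. (\<nu>(z := \<nu> z + c)) v) = sum \<nu> T" if "T \<subseteq> U" for T
      using that assms(3) by (intro sum.cong) auto
    have z: "z \<notin> S'" using S'(1) assms(3) by auto
    show ?thesis
    proof (cases "(\<Sum>i<q. \<mu> i) + c \<le> (\<Sum>i<r. \<mu> i)")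
      case True
      then show ?thesis using S eq[OF S(1)] sum_insert_row[OF assms(2), where r = q and c = c] Suc
        by (intro exI[of _ S]) auto
    next
      case False
      then have "(\<Sum>i<r. insert_row c \<mu> i) = (\<Sum>i<q. \<mu> i) + c"
        using sum_insert_row[OF assms(2), where r = q and c = c] Suc by simp
      also have "\<dots> \<le> (\<Sum>v\<in>insert z S'. (\<nu>(z := \<nu> z + c)) v)"
        using S' z eq[OF S'(1)] by simp
      finally show ?thesis using S' z Suc by (intro exI[of _ "insert z S'"]) auto
    qed
  qed
qed

text \<open>The row lengths of the diagram of colour classes before index \<open>q\<close> is coloured. Index \<open>q\<close> gets a box in
row \<open>a q\<close>, pushed up. The \<open>c\<close> virtual zeros enter as one row once the first \<open>t\<close> indices, which stand for
nonzero coordinates, have been treated.\<close>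

fun greedy_rows :: "nat \<Rightarrow> nat \<Rightarrow> (nat \<Rightarrow> nat) \<Rightarrow> nat \<Rightarrow> (nat \<Rightarrow> nat)" where
  "greedy_rows t c a 0 = (if t = 0 then insert_row c (\<lambda>_. 0) else (\<lambda>_. 0))"
| "greedy_rows t c a (Suc q) =
    (let \<mu> = add_box (greedy_rows t c a q) (a q) in if Suc q = t then insert_row c \<mu> else \<mu>)"

definition is_row_shape :: "(nat \<Rightarrow> nat) \<Rightarrow> bool" where
  "is_row_shape \<mu> \<longleftrightarrow> antimono \<mu> \<and> finite {i. \<mu> i \<noteq> 0}"

lemma is_row_shape_add_box:
  assumes "is_row_shape \<mu>"
  shows "is_row_shape (add_box \<mu> a)"
proof -
  obtain s where s: "s \<le> a" "\<And>i. s \<le> i \<Longrightarrow> i \<le> a \<Longrightarrow> \<mu> i = \<mu> a" "\<And>i. i < s \<Longrightarrow> \<mu> a < \<mu> i"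
    "add_box \<mu> a = \<mu>(s := Suc (\<mu> a))"
    using add_box_row[of \<mu> a] assms unfolding is_row_shape_def by blast
  have "antimono (add_box \<mu> a)"
    unfolding s(4) antimono_def
  proof (intro allI impI)
    fix x y :: nat assume "x \<le> y"
    have "\<mu> y \<le> \<mu> x" using assms \<open>x \<le> y\<close> by (auto simp: is_row_shape_def antimonoD)
    then show "(\<mu>(s := Suc (\<mu> a))) y \<le> (\<mu>(s := Suc (\<mu> a))) x"
      using s(3)[of x] s(2)[of s] s(1) \<open>x \<le> y\<close> by auto
  qed
  moreover have "finite {i. add_box \<mu> a i \<noteq> 0}"
    by (rule finite_subset[of _ "insert s {i. \<mu> i \<noteq> 0}"])
       (use assms in \<open>auto simp: s(4) is_row_shape_def\<close>)
  ultimately show ?thesis by (simp add: is_row_shape_def)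
qed

lemma is_row_shape_insert_row:
  assumes "is_row_shape \<mu>"
  shows "is_row_shape (insert_row c \<mu>)"
proof -
  have m: "\<mu> j \<le> \<mu> i" if "i \<le> j" for i j using assms that by (simp add: is_row_shape_def antimonoD)
  have "antimono (insert_row c \<mu>)"
  proof (rule antimonoI)
    fix x y :: nat assume xy: "x \<le> y"
    then have "\<mu> y \<le> \<mu> x" "\<mu> (y - 1) \<le> \<mu> (x - 1)" "x < y \<Longrightarrow> \<mu> (y - 1) \<le> \<mu> x"
      by (auto intro: m)
    then show "insert_row c \<mu> y \<le> insert_row c \<mu> x"
      using xy by (cases "x = y") (auto simp: insert_row_def)
  qed
  moreover have "finite {i. insert_row c \<mu> i \<noteq> 0}"
  proof (rule finite_subset)
    show "{i. insert_row c \<mu> i \<noteq> 0} \<subseteq> {0} \<union> {i. \<mu> i \<noteq> 0} \<union> Suc ` {i. \<mu> i \<noteq> 0}"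
    proof
      fix x assume "x \<in> {i. insert_row c \<mu> i \<noteq> 0}"
      then show "x \<in> {0} \<union> {i. \<mu> i \<noteq> 0} \<union> Suc ` {i. \<mu> i \<noteq> 0}"
        by (cases x) (auto simp: insert_row_def max_def min_def split: if_splits)
    qed
  qed (use assms in \<open>auto simp: is_row_shape_def\<close>)
  ultimately show ?thesis by (simp add: is_row_shape_def)
qed

lemma is_row_shape_greedy_rows: "is_row_shape (greedy_rows t c a q)"
proof (induction q)
  case 0
  have "is_row_shape (\<lambda>_. 0)" by (simp add: is_row_shape_def antimono_def)
  then show ?case by (simp add: is_row_shape_insert_row)
qed (simp add: Let_def is_row_shape_add_box is_row_shape_insert_row)

lemma column_finite: "is_row_shape \<mu> \<Longrightarrow> finite {i. w < \<mu> i}"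
  unfolding is_row_shape_def by (elim conjE, erule rev_finite_subset) auto

lemma column_add_box:
  assumes "is_row_shape \<mu>"
  shows "card {i. w < add_box \<mu> a i} = card {i. w < \<mu> i} + (if w = \<mu> a then 1 else 0)"
proof -
  obtain s where s: "s \<le> a" "\<And>i. s \<le> i \<Longrightarrow> i \<le> a \<Longrightarrow> \<mu> i = \<mu> a" "\<And>i. i < s \<Longrightarrow> \<mu> a < \<mu> i"
    "add_box \<mu> a = \<mu>(s := Suc (\<mu> a))"
    using add_box_row[of \<mu> a] assms unfolding is_row_shape_def by blast
  have "\<mu> s = \<mu> a" using s(1) s(2)[of s] by simp
  then have "{i. w < add_box \<mu> a i} = (if w = \<mu> a then insert s {i. w < \<mu> i} else {i. w < \<mu> i})"
    unfolding s(4) by auto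
  then show ?thesis using column_finite[OF assms] \<open>\<mu> s = \<mu> a\<close> by simp
qed

lemma column_insert_row:
  assumes "is_row_shape \<mu>"
  shows "card {i. w < insert_row c \<mu> i} = card {i. w < \<mu> i} + (if w < c then 1 else 0)"
proof (cases "w < c")
  case True
  have m: "w < \<mu> (i - 1)" if "w < \<mu> i" for i
  proof -
    have "\<mu> i \<le> \<mu> (i - 1)" using assms by (simp add: is_row_shape_def antimonoD)
    then show ?thesis using that by simp
  qed
  have "{i. w < insert_row c \<mu> i} = insert 0 (Suc ` {i. w < \<mu> i})"
  proof (intro Set.set_eqI iffI)
    fix i assume "i \<in> {i. w < insert_row c \<mu> i}"
    then show "i \<in> insert 0 (Suc ` {i. w < \<mu> i})"
      using m[of i] by (cases i) (auto simp: insert_row_def less_max_iff_disj)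
  next
    fix i assume "i \<in> insert 0 (Suc ` {i. w < \<mu> i})"
    then show "i \<in> {i. w < insert_row c \<mu> i}"
      using True by (auto simp: insert_row_def less_max_iff_disj)
  qed
  then show ?thesis using True column_finite[OF assms] by (simp add: card_image card_insert_if)
next
  case False
  have "{i. w < insert_row c \<mu> i} = {i. w < \<mu> i}"
    using False by (auto simp: insert_row_def less_max_iff_disj split: if_splits)
  then show ?thesis using False by simp
qed

text \<open>The columns of the growing diagram are the colour classes: an index is coloured by the column of its box,
and each of the first \<open>c\<close> columns holds one further box, a virtual zero, from stage \<open>t\<close> on.\<close>

lemma column_greedy_rows:
  "card {i. w < greedy_rows t c a q i} =
     card {p. p < q \<and> greedy_rows t c a p (a p) = w} + (if t \<le> q \<and> w < c then 1 else 0)"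
proof (induction q)
  case 0
  have "is_row_shape (\<lambda>_. 0)" by (simp add: is_row_shape_def antimono_def)
  then show ?case by (simp add: column_insert_row)
next
  case (Suc q)
  have "{p. p < Suc q \<and> greedy_rows t c a p (a p) = w} =
    {p. p < q \<and> greedy_rows t c a p (a p) = w} \<union> (if greedy_rows t c a q (a q) = w then {q} else {})"
    by (auto simp: less_Suc_eq)
  then have "card {p. p < Suc q \<and> greedy_rows t c a p (a p) = w} =
    card {p. p < q \<and> greedy_rows t c a p (a p) = w} + (if greedy_rows t c a q (a q) = w then 1 else 0)"
    by simp
  then show ?case using Suc
    by (auto simp: Let_def column_add_box column_insert_row is_row_shape_greedy_rows
        is_row_shape_add_box)
qed

lemma greedy_colour_rank:
  fixes a :: "nat \<Rightarrow> nat" and c t :: nat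
  defines "col \<equiv> \<lambda>p. greedy_rows t c a p (a p)"
  shows "card {p'. p' < p \<and> col p' = col p} + (if t \<le> p \<and> col p < c then 1 else 0) \<le> a p"
proof -
  let ?\<mu> = "greedy_rows t c a p"
  have "{i. col p < ?\<mu> i} \<subseteq> {..<a p}"
  proof
    fix i assume "i \<in> {i. col p < ?\<mu> i}"
    then have "?\<mu> (a p) < ?\<mu> i" by (simp add: col_def)
    moreover have "antimono ?\<mu>" using is_row_shape_greedy_rows by (simp add: is_row_shape_def)
    ultimately have "\<not> a p \<le> i" using antimonoD[of ?\<mu> "a p" i] by linarith
    then show "i \<in> {..<a p}" by simp
  qed
  then have "card {i. col p < ?\<mu> i} \<le> card {..<a p}"
    by (rule card_mono[rotated]) simp
  moreover have "card {i. col p < ?\<mu> i} =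
      card {p'. p' < p \<and> col p' = col p} + (if t \<le> p \<and> col p < c then 1 else 0)"
    unfolding col_def by (rule column_greedy_rows)
  ultimately show ?thesis by simp
qed

section \<open>Leading exponents of functions vanishing on crowded points\<close>

text \<open>The coefficient, as a function of the first \<open>q\<close> coordinates, of the powers which the lexicographically
leading term \<open>a\<close> has in the coordinates from \<open>q\<close> on. Coordinates with larger index are more significant.\<close>

definition lead_slice :: "'b set \<Rightarrow> ('b \<Rightarrow> complex) \<Rightarrow> ('b \<Rightarrow> nat \<Rightarrow> nat) \<Rightarrow> 'b \<Rightarrow> nat \<Rightarrow> nat
    \<Rightarrow> (nat \<Rightarrow> complex) \<Rightarrow> complex" where
  "lead_slice K coef e a n q y =
    (\<Sum>b | b \<in> K \<and> (\<forall>p. q \<le> p \<and> p < n \<longrightarrow> e b p = e a p). coef b * (\<Prod>p<q. y p ^ e b p))"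

text \<open>As a polynomial in coordinate \<open>q\<close>, the slice at \<open>q + 1\<close> has degree at most \<open>e a q\<close>, and the slice at \<open>q\<close> is its
coefficient in that degree; more than \<open>e a q\<close> zeros make it vanish.\<close>

lemma lead_slice_eq_0:
  assumes fin: "finite K" and q: "q < n"
    and lex: "\<And>b q. b \<in> K \<Longrightarrow> q < n \<Longrightarrow> (\<And>p. q < p \<Longrightarrow> p < n \<Longrightarrow> e b p = e a p) \<Longrightarrow> e b q \<le> e a q"
    and W: "finite W" "e a q < card W"
    and zero: "\<And>v. v \<in> W \<Longrightarrow> lead_slice K coef e a n (Suc q) (y(q := v)) = 0"
  shows "lead_slice K coef e a n q y = 0"
proof -
  let ?K = "{b \<in> K. \<forall>p. Suc q \<le> p \<and> p < n \<longrightarrow> e b p = e a p}"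
  define d where "d b = coef b * (\<Prod>p<q. y p ^ e b p)" for b
  define P where "P = (\<Sum>b\<in>?K. monom (d b) (e b q))"
  have finK: "finite ?K" using fin by simp
  have pr: "(\<Prod>p<q. (y(q := v)) p ^ e b p) = (\<Prod>p<q. y p ^ e b p)" for v b
    by (intro prod.cong) auto
  have ev: "poly P v = lead_slice K coef e a n (Suc q) (y(q := v))" for v
    unfolding P_def lead_slice_def d_def
    by (simp add: poly_sum poly_monom pr mult.assoc)
  have deg: "degree P \<le> e a q"
    unfolding P_def
  proof (rule degree_sum_le[OF finK])
    fix b assume "b \<in> ?K"
    then have "e b q \<le> e a q" using lex[of b q] q by auto
    then show "degree (monom (d b) (e b q)) \<le> e a q"
      using degree_monom_le order_trans by blast
  qed
  have "P = 0"
  proof (rule ccontr)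
    assume "P \<noteq> 0"
    then have "card {v. poly P v = 0} \<le> degree P" by (rule card_poly_roots_bound)
    moreover have "card W \<le> card {v. poly P v = 0}"
      by (rule card_mono) (use poly_roots_finite[OF \<open>P \<noteq> 0\<close>] zero ev in auto)
    ultimately show False using deg W by simp
  qed
  then have "0 = coeff P (e a q)" by simp
  also have "\<dots> = (\<Sum>b\<in>?K. if e b q = e a q then d b else 0)"
    unfolding P_def by (simp add: coeff_sum)
  also have "\<dots> = sum d {b \<in> ?K. e b q = e a q}"
    by (rule sum.inter_filter[OF finK, symmetric])
  also have "{b \<in> ?K. e b q = e a q} = {b \<in> K. \<forall>p. q \<le> p \<and> p < n \<longrightarrow> e b p = e a p}"
    using q by (auto simp: Suc_le_eq) (metis le_neq_implies_less)
  also have "sum d \<dots> = lead_slice K coef e a n q y" by (simp add: lead_slice_def d_def)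
  finally show ?thesis by simp
qed

text \<open>The number of coordinates equal to \<open>v\<close> among the first \<open>q\<close>, together with the \<open>c\<close> virtual zeros, which are
counted as soon as coordinates may vanish, that is from \<open>t\<close> on.\<close>

definition class_size :: "nat \<Rightarrow> nat \<Rightarrow> nat \<Rightarrow> (nat \<Rightarrow> complex) \<Rightarrow> complex \<Rightarrow> nat" where
  "class_size t c q y v = card {p. p < q \<and> y p = v} + (if t \<le> q \<and> v = 0 then c else 0)"

lemma finite_class_size: "finite {v. class_size t c q y v \<noteq> 0}"
proof (rule finite_subset)
  show "{v. class_size t c q y v \<noteq> 0} \<subseteq> insert 0 (y ` {..<q})"
    by (auto simp: class_size_def split: if_splits)
qed simp

lemma class_size_Suc:
  "class_size t c (Suc q) (y(q := w)) v =
    class_size t c q y v + (if w = v then 1 else 0) + (if Suc q = t \<and> v = 0 then c else 0)"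
proof -
  have "{p. p < Suc q \<and> (y(q := w)) p = v} = {p. p < q \<and> y p = v} \<union> (if w = v then {q} else {})"
    by (auto simp: less_Suc_eq)
  then show ?thesis by (auto simp: class_size_def)
qed

text \<open>Suppose the greedy colouring first runs out of its \<open>N\<close> colours at position \<open>p\<close>. Downwards from \<open>p\<close>, the
slices at \<open>q\<close> vanish at every point whose multiplicities dominate the greedy rows at \<open>q\<close>. At \<open>p\<close> the first
\<open>e a p + 1\<close> rows have at least \<open>N\<close> boxes, so a dominating point has \<open>e a p + 1\<close> values of multiplicity \<open>N\<close>,
unless it is already too crowded, and repeating any of these values makes it too crowded. Below \<open>p\<close>,
\<open>majorizes_add_box\<close> supplies the required number of values. At \<open>0\<close> the slice is the leading
coefficient, and no condition on the point remains.\<close>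

theorem greedy_colouring_below_lead:
  fixes e :: "'b \<Rightarrow> nat \<Rightarrow> nat" and coef :: "'b \<Rightarrow> complex"
  assumes fin: "finite K" and a: "a \<in> K" "coef a \<noteq> 0"
    and lex: "\<And>b q. b \<in> K \<Longrightarrow> q < n \<Longrightarrow> (\<And>p. q < p \<Longrightarrow> p < n \<Longrightarrow> e b p = e a p) \<Longrightarrow> e b q \<le> e a q"
    and inj: "\<And>b. b \<in> K \<Longrightarrow> (\<And>p. p < n \<Longrightarrow> e b p = e a p) \<Longrightarrow> b = a"
    and tn: "t \<le> n"
    and vanish: "\<And>y v. (\<And>p. p < t \<Longrightarrow> y p \<noteq> 0) \<Longrightarrow> N < class_size t c n y v \<Longrightarrow>
       (\<Sum>b\<in>K. coef b * (\<Prod>p<n. y p ^ e b p)) = 0"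
  obtains col where "\<And>p. p < n \<Longrightarrow> col p < N"
    "\<And>p. p < n \<Longrightarrow> card {p'. p' < p \<and> col p' = col p} + (if t \<le> p \<and> col p < c then 1 else 0) \<le> e a p"
proof -
  define R where "R = greedy_rows t c (e a)"
  define col where "col p = R p (e a p)" for p
  define G where "G = lead_slice K coef e a n"
  define adm where "adm q y \<longleftrightarrow> (\<forall>p. p < t \<and> p < q \<longrightarrow> y p \<noteq> (0::complex))" for q y
  define U where "U q = (if q < t then - {0} else (UNIV :: complex set))" for q
  have infU: "infinite (U q)" for q
    using infinite_UNIV_char_0[where 'a = complex] by (simp add: U_def Compl_eq_Diff_UNIV)
  have admS: "adm (Suc q) (y(q := v))" if "adm q y" "v \<in> U q" for q y v
    using that by (auto simp: adm_def U_def less_Suc_eq)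
  have Gstep: "G q y = 0"
    if "q < n" "finite W" "e a q < card W" "\<And>v. v \<in> W \<Longrightarrow> G (Suc q) (y(q := v)) = 0" for q y W
    unfolding G_def
    by (rule lead_slice_eq_0[where W = W]) (use fin that lex in \<open>auto simp: G_def\<close>)
  \<comment> \<open>a crowded point stays crowded under every extension, and there are infinitely many extensions\<close>
  have bad: "G q y = 0" if "q \<le> n" "adm q y" "N < class_size t c q y v" for q y v
    using that
  proof (induction q arbitrary: y rule: inc_induct)
    case base
    have "G n y = (\<Sum>b\<in>K. coef b * (\<Prod>p<n. y p ^ e b p))"
      unfolding G_def lead_slice_def by (intro sum.cong) auto
    then show ?case using vanish[of y v] base tn by (auto simp: adm_def)
  next
    case (step q)
    obtain W where W: "finite W" "card W = Suc (e a q)" "W \<subseteq> U q"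
      using infinite_arbitrarily_large[OF infU] by blast
    show ?case
    proof (rule Gstep[OF _ W(1)])
      fix w assume "w \<in> W"
      then have "w \<in> U q" using W(3) by blast
      then have "adm (Suc q) (y(q := w))" by (rule admS[OF step.prems(1)])
      moreover have "N < class_size t c (Suc q) (y(q := w)) v"
        by (rule less_le_trans[OF step.prems(2)]) (simp add: class_size_Suc)
      ultimately show "G (Suc q) (y(q := w)) = 0" by (rule step.IH)
    qed (use step W in auto)
  qed
  have "\<forall>p<n. col p < N"
  proof (rule ccontr)
    assume "\<not> (\<forall>p<n. col p < N)"
    then obtain p where p: "p < n" "N \<le> col p" by auto
    have main: "G q y = 0" if "q \<le> p" "adm q y" "majorizes (U q) (class_size t c q y) (R q)" for q y
      using that
    proof (induction q arbitrary: y rule: inc_induct)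
      case base
      show ?case
      proof (cases "\<exists>v. N < class_size t c p y v")
        case True
        then show ?thesis using bad[of p y] base p by auto
      next
        case False
        then have le: "class_size t c p y v \<le> N" for v by (simp add: not_less)
        obtain S where S: "S \<subseteq> U p" "finite S" "card S \<le> Suc (e a p)"
          "(\<Sum>i<Suc (e a p). R p i) \<le> (\<Sum>v\<in>S. class_size t c p y v)"
          using base(2) unfolding majorizes_def by blast
        have "Suc (e a p) * N = (\<Sum>i<Suc (e a p). N)" by simp
        also have "\<dots> \<le> (\<Sum>i<Suc (e a p). R p i)"
        proof (rule sum_mono)
          fix i assume "i \<in> {..<Suc (e a p)}"
          then have "R p (e a p) \<le> R p i"
            using is_row_shape_greedy_rows[of t c "e a" p]
            unfolding R_def is_row_shape_def by (auto intro: antimonoD)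
          then show "N \<le> R p i" using p(2) by (simp add: col_def)
        qed
        finally have ge: "Suc (e a p) * N \<le> (\<Sum>v\<in>S. class_size t c p y v)" using S(4) by simp
        show ?thesis
        \<comment> \<open>with no colours at all, every nonempty point is crowded\<close>
        proof (cases "N = 0")
          case True
          obtain W where W: "finite W" "card W = Suc (e a p)" "W \<subseteq> U p"
            using infinite_arbitrarily_large[OF infU] by blast
          show ?thesis
          proof (rule Gstep[OF p(1) W(1)])
            fix w assume "w \<in> W"
            then show "G (Suc p) (y(p := w)) = 0"
              using bad[of "Suc p" "y(p := w)" w] admS[OF base(1), of w] True W p
              by (auto simp: class_size_Suc)
          qed (use W in simp)
        next
          case False
          have full: "card S = Suc (e a p) \<and> (\<forall>v\<in>S. class_size t c p y v = N)"
          proof -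
            have sle: "(\<Sum>v\<in>S. class_size t c p y v) \<le> card S * N"
              using sum_bounded_above[of S "class_size t c p y" N] le by simp
            then have "Suc (e a p) * N \<le> card S * N" using ge by linarith
            then have cS: "card S = Suc (e a p)" using S(3) False by (metis le_antisym mult_le_cancel2 not_gr_zero)
            have "\<forall>v\<in>S. class_size t c p y v = N"
            proof (rule ccontr)
              assume "\<not> ?thesis"
              then have "\<exists>v\<in>S. class_size t c p y v < N" using le by (meson le_neq_implies_less)
              then have "(\<Sum>v\<in>S. class_size t c p y v) < (\<Sum>v\<in>S. N)"
                by (intro sum_strict_mono_ex1) (use S le in auto)
              then show False using ge cS by simp
            qed
            then show ?thesis using cS by blast
          qed
          show ?thesis
          proof (rule Gstep[OF p(1) S(2)])
            fix w assume "w \<in> S"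
            then show "G (Suc p) (y(p := w)) = 0"
              using bad[of "Suc p" "y(p := w)" w] admS[OF base(1), of w] full S p
              by (auto simp: class_size_Suc)
          qed (use full in simp)
        qed
      qed
    next
      case (step q)
      let ?\<nu> = "class_size t c q y"
      have sh: "is_row_shape (R q)" unfolding R_def by (rule is_row_shape_greedy_rows)
      then have anti: "antimono (R q)" by (simp add: is_row_shape_def)
      obtain W where W: "W \<subseteq> U q" "finite W" "card W = Suc (e a q)"
        "\<And>v. v \<in> W \<Longrightarrow> majorizes (U q) (?\<nu>(v := Suc (?\<nu> v))) (add_box (R q) (e a q))"
        using majorizes_add_box[OF step.prems(2) finite_class_size infU anti] by metis
      show ?case
      proof (rule Gstep[OF _ W(2)])
        show "q < n" using step p by simp
        show "e a q < card W" using W by simp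
        fix w assume w: "w \<in> W"
        have "majorizes (U (Suc q)) (class_size t c (Suc q) (y(q := w))) (R (Suc q))"
        proof (cases "Suc q = t")
          case True
          \<comment> \<open>the value \<open>0\<close> was not allowed before \<open>t\<close>, so the virtual zeros form a new row\<close>
          have "class_size t c (Suc q) (y(q := w)) =
            (?\<nu>(w := Suc (?\<nu> w)))(0 := (?\<nu>(w := Suc (?\<nu> w))) 0 + c)"
            using True by (auto simp: class_size_Suc fun_eq_iff)
          moreover have "majorizes UNIV \<dots> (insert_row c (add_box (R q) (e a q)))"
            by (rule majorizes_insert_row[OF W(4)[OF w]])
               (use True is_row_shape_add_box[OF sh] in \<open>auto simp: U_def is_row_shape_def\<close>)
          moreover have "R (Suc q) = insert_row c (add_box (R q) (e a q))" "U (Suc q) = UNIV"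
            using True[symmetric] by (simp_all add: R_def U_def Let_def)
          ultimately show ?thesis by simp
        next
          case False
          then have "class_size t c (Suc q) (y(q := w)) = ?\<nu>(w := Suc (?\<nu> w))"
            by (auto simp: class_size_Suc fun_eq_iff)
          moreover have "U (Suc q) = U q" using False by (auto simp: U_def)
          ultimately show ?thesis using W(4)[OF w] False by (simp add: R_def Let_def)
        qed
        then show "G (Suc q) (y(q := w)) = 0"
          using step.IH admS[OF step.prems(1)] w W(1) by blast
      qed
    qed
    have m0: "majorizes U0 \<nu> (\<lambda>_. 0)" for U0 and \<nu> :: "complex \<Rightarrow> nat"
      unfolding majorizes_def by (auto intro!: exI[of _ "{}"])
    have "majorizes (U 0) (class_size t c 0 y) (R 0)" for y
    proof (cases "t = 0")
      case True
      have "majorizes UNIV ((\<lambda>_::complex. 0)(0 := c)) (insert_row c (\<lambda>_. 0))"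
        using majorizes_insert_row[OF m0[of "{}" "\<lambda>_. 0"], of 0 c] by (simp add: antimono_def)
      moreover have "class_size t c 0 y = (\<lambda>_. 0)(0 := c)"
        using True by (auto simp: class_size_def fun_eq_iff)
      ultimately show ?thesis using True by (simp add: R_def U_def)
    next
      case False
      then show ?thesis using m0 by (simp add: R_def)
    qed
    then have "G 0 (\<lambda>_. 0) = 0" using main[of 0] by (simp add: adm_def)
    moreover have "{b \<in> K. \<forall>p. 0 \<le> p \<and> p < n \<longrightarrow> e b p = e a p} = {a}"
      using a(1) inj by auto
    ultimately show False using a(2) by (simp add: G_def lead_slice_def)
  qed
  then show ?thesis
    using that[of col] greedy_colour_rank[of _ t c "e a"] by (simp add: col_def R_def)
qed

section \<open>Polynomials: evaluation, leading exponents and ideals\<close>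

text \<open>Weighted degree. Weights that are powers of a large base make it a numerical substitute for the
lexicographic order of exponents of bounded degree, see \<open>lex_weight\<close> below.\<close>

definition wt :: "(nat \<Rightarrow> nat) \<Rightarrow> (nat \<Rightarrow>\<^sub>0 nat) \<Rightarrow> nat" where
  "wt W a = (\<Sum>i\<in>keys a. lookup a i * W i)"

abbreviation (input) total_degree :: "(nat \<Rightarrow>\<^sub>0 nat) \<Rightarrow> nat" where
  "total_degree \<equiv> wt (\<lambda>_. 1)"

lemma wt_superset:
  assumes "finite S" "keys a \<subseteq> S"
  shows "wt W a = (\<Sum>i\<in>S. lookup a i * W i)"
  unfolding wt_def using assms
  by (intro sum.mono_neutral_left) (auto simp: in_keys_iff)

lemma wt_add: "wt W (a + b) = wt W a + wt W b"
proof -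
  let ?S = "keys a \<union> keys b"
  have "keys (a + b) \<subseteq> ?S" by (rule Poly_Mapping.keys_add)
  then show ?thesis
    by (simp add: wt_superset[of ?S] lookup_add algebra_simps sum.distrib)
qed

lemma wt_single [simp]: "wt W (single i k) = k * W i"
  by (simp add: wt_superset[of "{i}"])

lemma wt_zero [simp]: "wt W 0 = 0"
  by (simp add: wt_def)

definition mono_val :: "(nat \<Rightarrow>\<^sub>0 nat) \<Rightarrow> (nat \<Rightarrow> complex) \<Rightarrow> complex" where
  "mono_val a x = (\<Prod>i\<in>keys a. x i ^ lookup a i)"

lemma mono_val_superset:
  assumes "finite S" "keys a \<subseteq> S"
  shows "mono_val a x = (\<Prod>i\<in>S. x i ^ lookup a i)"
  unfolding mono_val_def using assms
  by (intro prod.mono_neutral_left) (auto simp: in_keys_iff)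

lemma mono_val_add: "mono_val (a + b) x = mono_val a x * mono_val b x"
proof -
  let ?S = "keys a \<union> keys b"
  have "keys (a + b) \<subseteq> ?S" by (rule Poly_Mapping.keys_add)
  then show ?thesis
    by (simp add: mono_val_superset[of ?S] lookup_add power_add prod.distrib)
qed

lemma eval_poly_superset:
  assumes "finite S" "keys p \<subseteq> S"
  shows "eval_poly p x = (\<Sum>a\<in>S. lookup p a * mono_val a x)"
  unfolding eval_poly_def mono_val_def using assms
  by (intro sum.mono_neutral_left) (auto simp: in_keys_iff)

lemma eval_poly_keys: "eval_poly p x = (\<Sum>a\<in>keys p. lookup p a * mono_val a x)"
  by (rule eval_poly_superset) auto

lemma eval_poly_add: "eval_poly (p + q) x = eval_poly p x + eval_poly q x"
proof -
  let ?S = "keys p \<union> keys q"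
  have "keys (p + q) \<subseteq> ?S" by (rule Poly_Mapping.keys_add)
  then show ?thesis
    by (simp add: eval_poly_superset[of ?S] lookup_add algebra_simps sum.distrib)
qed

lemma eval_poly_zero [simp]: "eval_poly 0 x = 0"
  by (simp add: eval_poly_def)

lemma eval_poly_single: "eval_poly (single a c) x = c * mono_val a x"
  by (simp add: eval_poly_superset[of "{a}"])

lemma eval_poly_one [simp]: "eval_poly 1 x = 1"
  using eval_poly_single[of 0 1 x] by (simp add: mono_val_def)

lemma eval_poly_Var [simp]: "eval_poly (Var i) x = x i"
  unfolding Var_def eval_poly_single by (simp add: mono_val_superset[of "{i}"])

lemma eval_poly_uminus: "eval_poly (- p) x = - eval_poly p x"
  using eval_poly_add[of p "- p" x] by (simp add: eq_neg_iff_add_eq_0 add.commute)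

lemma eval_poly_diff: "eval_poly (p - q) x = eval_poly p x - eval_poly q x"
  using eval_poly_add[of p "- q" x] by (simp add: eval_poly_uminus)

lemma eval_poly_sum: "eval_poly (sum f A) x = (\<Sum>a\<in>A. eval_poly (f a) x)"
  by (induction A rule: infinite_finite_induct) (auto simp: eval_poly_add)

lemma poly_as_sum: "p = (\<Sum>a\<in>keys p. single a (lookup p a))"
  by (rule poly_mapping_eqI)
     (auto simp: lookup_sum lookup_single when_def in_keys_iff sum.delta')

lemma times_as_sum:
  fixes p q :: cpoly
  shows "p * q = (\<Sum>a\<in>keys p. \<Sum>b\<in>keys q.
    single (a + b) (lookup p a * lookup q b))"
  by (subst poly_as_sum[of p], subst poly_as_sum[of q]) (simp add: sum_product mult_single)

lemma eval_poly_mult: "eval_poly (p * q) x = eval_poly p x * eval_poly q x"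
  unfolding times_as_sum eval_poly_sum eval_poly_single eval_poly_keys[of p] eval_poly_keys[of q]
    sum_product
  by (simp add: mono_val_add mult_ac)

lemma eval_poly_prod: "eval_poly (prod f A) x = (\<Prod>a\<in>A. eval_poly (f a) x)"
  by (induction A rule: infinite_finite_induct) (auto simp: eval_poly_mult)

lemma eval_poly_power: "eval_poly (p ^ j) x = eval_poly p x ^ j"
  by (induction j) (auto simp: eval_poly_mult)

text \<open>The exponent \<open>a\<close> occurs in \<open>f\<close> and is the only one of maximal weight.\<close>

definition leads :: "(nat \<Rightarrow> nat) \<Rightarrow> cpoly \<Rightarrow> (nat \<Rightarrow>\<^sub>0 nat) \<Rightarrow> bool" where
  "leads W f a \<longleftrightarrow> a \<in> keys f \<and> (\<forall>b\<in>keys f. b \<noteq> a \<longrightarrow> wt W b < wt W a)"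

lemma leads_mult:
  assumes "leads W f a" "leads W g b"
  shows "leads W (f * g) (a + b)"
proof -
  have main: "u = a \<and> v = b \<or> wt W (u + v) < wt W (a + b)"
    if "u \<in> keys f" "v \<in> keys g" for u v
    using assms that unfolding leads_def wt_add
    by (metis add_less_le_mono add_le_less_mono less_imp_le order_refl)
  have "lookup (f * g) (a + b) =
    (\<Sum>u\<in>keys f. \<Sum>v\<in>keys g.
      if u = a \<and> v = b then lookup f a * lookup g b else 0)"
    unfolding times_as_sum lookup_sum lookup_single when_def
    by (intro sum.cong refl) (use main in fastforce)
  also have "\<dots> = (\<Sum>u\<in>keys f. if u = a then
      (\<Sum>v\<in>keys g. if v = b then lookup f a * lookup g b else 0) else 0)"
    by (intro sum.cong) auto
  also have "\<dots> = lookup f a * lookup g b"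
    using assms by (simp add: leads_def)
  also have "\<dots> \<noteq> 0" using assms by (auto simp: leads_def in_keys_iff)
  finally have "a + b \<in> keys (f * g)" by (simp add: in_keys_iff)
  moreover have "wt W z < wt W (a + b)" if z: "z \<in> keys (f * g)" "z \<noteq> a + b" for z
  proof -
    obtain u v where "z = u + v" "u \<in> keys f" "v \<in> keys g"
      using z(1) Poly_Mapping.keys_mult[of f g] by blast
    then show ?thesis using main z(2) by blast
  qed
  ultimately show ?thesis by (simp add: leads_def)
qed

lemma leads_one: "leads W 1 0"
  by (simp add: leads_def)

lemma leads_prod:
  assumes "\<And>i. i \<in> A \<Longrightarrow> leads W (f i) (e i)"
  shows "leads W (prod f A) (sum e A)"
  using assms
  by (induction A rule: infinite_finite_induct) (auto simp: leads_one leads_mult)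

lemma leads_single: "c \<noteq> 0 \<Longrightarrow> leads W (single a c) a"
  by (simp add: leads_def)

lemma Var_power: "Var i ^ j = single (single i j) 1"
  by (induction j) (auto simp: Var_def mult_single single_add[symmetric] single_one)

lemma keys_Var_power_diff:
  "keys (Var i ^ j - Var i' ^ j) \<subseteq> {single i j, single i' j}"
  unfolding Var_power using keys_diff by fastforce

lemma leads_Var_power_diff:
  assumes "W i' < W i" "0 < j"
  shows "leads W (Var i ^ j - Var i' ^ j) (single i j)"
    and "leads W (Var i' ^ j - Var i ^ j) (single i j)"
proof -
  have ne: "single i' j \<noteq> single i j"
  proof
    assume "single i' j = single i j"
    then have "wt W (single i' j) = wt W (single i j)" by simp
    then show False using assms by simp
  qed
  have "single i j \<in> keys (Var i ^ j - Var i' ^ j)"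
    "single i j \<in> keys (Var i' ^ j - Var i ^ j)"
    using ne by (auto simp: Var_power in_keys_iff lookup_minus lookup_single when_def)
  then show "leads W (Var i ^ j - Var i' ^ j) (single i j)"
    "leads W (Var i' ^ j - Var i ^ j) (single i j)"
    using keys_Var_power_diff[of i j i'] keys_Var_power_diff[of i' j i] assms
    by (fastforce simp: leads_def)+
qed

lemma keys_mult_grade:
  assumes "\<And>a. a \<in> keys f \<Longrightarrow> wt W a = d" "\<And>a. a \<in> keys g \<Longrightarrow> wt W a = d'"
    "a \<in> keys (f * g)"
  shows "wt W a = d + d'"
  using assms Poly_Mapping.keys_mult[of f g] by (auto simp: wt_add)

lemma keys_prod_grade:
  assumes "\<And>i a. i \<in> A \<Longrightarrow> a \<in> keys (f i) \<Longrightarrow> wt W a = d i"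
    "a \<in> keys (prod f A)"
  shows "wt W a = sum d A"
  using assms
proof (induction A arbitrary: a rule: infinite_finite_induct)
  case (insert i A)
  then show ?case
    using keys_mult_grade[of "f i" W "d i" "prod f A" "sum d A" a] by auto
qed auto

lemma keys_prod_subset:
  fixes P :: "(nat \<Rightarrow>\<^sub>0 nat) \<Rightarrow> bool"
  assumes "P 0" "\<And>a b. P a \<Longrightarrow> P b \<Longrightarrow> P (a + b)"
    "\<And>i a. i \<in> A \<Longrightarrow> a \<in> keys (f i) \<Longrightarrow> P a"
    "a \<in> keys (prod f A :: cpoly)"
  shows "P a"
  using assms(3,4)
proof (induction A arbitrary: a rule: infinite_finite_induct)
  case (insert i A)
  then have "a \<in> keys (f i * prod f A)" by simp
  then obtain u v where "a = u + v" "u \<in> keys (f i)" "v \<in> keys (prod f A)"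
    using Poly_Mapping.keys_mult by blast
  then show ?case using insert assms(2) by blast
qed (use assms(1) in auto)

lemma carrier_poly_ring:
  "p \<in> carrier (poly_ring n) \<longleftrightarrow> (\<forall>a\<in>keys p. keys a \<subseteq> {1..n})"
  by (simp add: poly_ring_def)

lemma poly_ring_simps [simp]:
  "p \<oplus>\<^bsub>poly_ring n\<^esub> q = p + q" "p \<otimes>\<^bsub>poly_ring n\<^esub> q = p * q"
  "\<zero>\<^bsub>poly_ring n\<^esub> = 0" "\<one>\<^bsub>poly_ring n\<^esub> = 1"
  by (simp_all add: poly_ring_def)

lemma poly_carrier_closed:
  "0 \<in> carrier (poly_ring n)" "1 \<in> carrier (poly_ring n)"
  "p \<in> carrier (poly_ring n) \<Longrightarrow> q \<in> carrier (poly_ring n) \<Longrightarrow> p + q \<in> carrier (poly_ring n)"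
  "p \<in> carrier (poly_ring n) \<Longrightarrow> q \<in> carrier (poly_ring n) \<Longrightarrow> p * q \<in> carrier (poly_ring n)"
  "p \<in> carrier (poly_ring n) \<Longrightarrow> - p \<in> carrier (poly_ring n)"
  "p \<in> carrier (poly_ring n) \<Longrightarrow> q \<in> carrier (poly_ring n) \<Longrightarrow> p - q \<in> carrier (poly_ring n)"
proof -
  interpret R: cring "poly_ring n" by (rule cring_poly_ring)
  show "0 \<in> carrier (poly_ring n)" using R.zero_closed by simp
  show "1 \<in> carrier (poly_ring n)" using R.one_closed by simp
  show add: "p + q \<in> carrier (poly_ring n)" if "p \<in> carrier (poly_ring n)" "q \<in> carrier (poly_ring n)" for p q
    using R.a_closed[OF that] by simp
  show "p * q \<in> carrier (poly_ring n)" if "p \<in> carrier (poly_ring n)" "q \<in> carrier (poly_ring n)"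
    using R.m_closed[OF that] by simp
  show um: "- p \<in> carrier (poly_ring n)" if "p \<in> carrier (poly_ring n)" for p
    using that by (simp add: carrier_poly_ring)
  show "p - q \<in> carrier (poly_ring n)" if "p \<in> carrier (poly_ring n)" "q \<in> carrier (poly_ring n)"
    using add[OF that(1) um[OF that(2)]] by simp
qed

lemma poly_carrier_prod:
  "(\<And>i. i \<in> A \<Longrightarrow> f i \<in> carrier (poly_ring n)) \<Longrightarrow> prod f A \<in> carrier (poly_ring n)"
  by (induction A rule: infinite_finite_induct) (auto simp: poly_carrier_closed)

lemma poly_carrier_power: "p \<in> carrier (poly_ring n) \<Longrightarrow> p ^ j \<in> carrier (poly_ring n)"
  by (induction j) (auto simp: poly_carrier_closed)

lemma poly_carrier_single:
  "keys a \<subseteq> {1..n} \<Longrightarrow> single a c \<in> carrier (poly_ring n)"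
  by (simp add: carrier_poly_ring)

lemma poly_carrier_Var: "i \<in> {1..n} \<Longrightarrow> Var i \<in> carrier (poly_ring n)"
  unfolding Var_def by (rule poly_carrier_single) simp

lemma poly_ideal_closed:
  assumes "ideal J (poly_ring n)"
  shows "J \<subseteq> carrier (poly_ring n)" "0 \<in> J" "p \<in> J \<Longrightarrow> q \<in> J \<Longrightarrow> p + q \<in> J"
    "p \<in> J \<Longrightarrow> r \<in> carrier (poly_ring n) \<Longrightarrow> r * p \<in> J"
proof -
  interpret ideal J "poly_ring n" by fact
  show "J \<subseteq> carrier (poly_ring n)" by (rule a_subset)
  show "0 \<in> J" using additive_subgroup.zero_closed[OF is_additive_subgroup] by simp
  show "p \<in> J \<Longrightarrow> q \<in> J \<Longrightarrow> p + q \<in> J"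
    using additive_subgroup.a_closed[OF is_additive_subgroup] by fastforce
  show "p \<in> J \<Longrightarrow> r \<in> carrier (poly_ring n) \<Longrightarrow> r * p \<in> J"
    using I_l_closed by simp
qed

lemma poly_ideal_sum:
  assumes "ideal J (poly_ring n)" "\<And>i. i \<in> A \<Longrightarrow> f i \<in> J"
  shows "sum f A \<in> J"
  using assms(2)
  by (induction A rule: infinite_finite_induct) (auto intro: poly_ideal_closed[OF assms(1)])

lemma poly_idealI:
  assumes "J \<subseteq> carrier (poly_ring n)" "0 \<in> J" "\<And>p q. p \<in> J \<Longrightarrow> q \<in> J \<Longrightarrow> p + q \<in> J"
    "\<And>p r. p \<in> J \<Longrightarrow> r \<in> carrier (poly_ring n) \<Longrightarrow> r * p \<in> J"
  shows "ideal J (poly_ring n)"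
proof -
  interpret R: cring "poly_ring n" by (rule cring_poly_ring)
  have m1: "- 1 \<in> carrier (poly_ring n)" using poly_carrier_closed(2,5) by blast
  show ?thesis
  proof (rule idealI[OF R.ring_axioms])
    show "subgroup J (add_monoid (poly_ring n))"
    proof (rule group.subgroupI[OF R.a_group])
      fix a assume a: "a \<in> J"
      have "- a \<in> J" using assms(4)[OF a m1] by simp
      moreover have "inv\<^bsub>add_monoid (poly_ring n)\<^esub> a = - a"
        using R.minus_equality[of "- a" a] a assms(1) poly_carrier_closed(5)
        by (auto simp: a_inv_def)
      ultimately show "inv\<^bsub>add_monoid (poly_ring n)\<^esub> a \<in> J" by simp
    qed (use assms in \<open>auto simp: poly_ring_def\<close>)
  qed (use assms in \<open>auto simp: mult.commute\<close>)
qed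

lemma vanishing_ideal_ideal: "ideal (vanishing_ideal n Z) (poly_ring n)"
  by (rule poly_idealI)
     (auto simp: vanishing_ideal_def poly_carrier_closed eval_poly_add eval_poly_mult)

section \<open>Colour polynomials\<close>

definition colour_pairs :: "nat \<Rightarrow> (nat \<Rightarrow> nat) \<Rightarrow> (nat \<times> nat) set" where
  "colour_pairs n col = {(i, j). i \<in> {1..n} \<and> j \<in> {1..n} \<and> i < j \<and> col i = col j}"

text \<open>The product of Vandermonde products in the \<open>l\<close>-th powers over the colour classes, times the
variables of colour below \<open>c\<close>. Garnir polynomials are the case of colouring by columns; arbitrary class
sizes are needed as intermediate objects.\<close>

definition colour_poly :: "nat \<Rightarrow> nat \<Rightarrow> nat \<Rightarrow> (nat \<Rightarrow> nat) \<Rightarrow> cpoly" where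
  "colour_poly l c n col =
    (\<Prod>i\<in>{i \<in> {1..n}. col i < c}. Var i) * (\<Prod>(i, j)\<in>colour_pairs n col. Var i ^ l - Var j ^ l)"

lemma finite_colour_pairs [simp]: "finite (colour_pairs n col)"
  by (rule finite_subset[of _ "{1..n} \<times> {1..n}"]) (auto simp: colour_pairs_def)

lemma colour_poly_carrier: "colour_poly l c n col \<in> carrier (poly_ring n)"
  unfolding colour_poly_def
proof (rule poly_carrier_closed(4); rule poly_carrier_prod)
  fix i assume "i \<in> {i \<in> {1..n}. col i < c}"
  then show "Var i \<in> carrier (poly_ring n)" by (intro poly_carrier_Var) simp
next
  fix z assume "z \<in> colour_pairs n col"
  then have "fst z \<in> {1..n}" "snd z \<in> {1..n}" by (auto simp: colour_pairs_def)
  then show "(case z of (i, j) \<Rightarrow> Var i ^ l - Var j ^ l) \<in> carrier (poly_ring n)"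
    unfolding case_prod_unfold by (intro poly_carrier_closed(6) poly_carrier_power poly_carrier_Var)
qed

lemma eval_colour_poly:
  "eval_poly (colour_poly l c n col) x =
    (\<Prod>i\<in>{i \<in> {1..n}. col i < c}. x i) * (\<Prod>(i, j)\<in>colour_pairs n col. x i ^ l - x j ^ l)"
  unfolding colour_poly_def
  by (simp add: eval_poly_mult eval_poly_prod case_prod_unfold eval_poly_diff eval_poly_power)

lemma eval_colour_poly_eq_0_pair:
  assumes "i \<in> {1..n}" "j \<in> {1..n}" "i \<noteq> j" "col i = col j" "x i ^ l = x j ^ l"
  shows "eval_poly (colour_poly l c n col) x = 0"
proof -
  have "(min i j, max i j) \<in> colour_pairs n col" using assms by (auto simp: colour_pairs_def min_def max_def)
  moreover have "x (min i j) ^ l - x (max i j) ^ l = 0" using assms by (auto simp: min_def max_def)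
  ultimately have "(\<Prod>(i, j)\<in>colour_pairs n col. x i ^ l - x j ^ l) = 0"
    by (intro prod_zero bexI[of _ "(min i j, max i j)"]) simp_all
  then show ?thesis by (simp add: eval_colour_poly)
qed

text \<open>Two of \<open>k\<close> coordinates with equal \<open>l\<close>-th power share one of the \<open>k - 1\<close> colours. Of \<open>m + 1\<close> vanishing
coordinates, one has colour below \<open>k - 1 - m\<close>, or two share one of the other \<open>m\<close> colours.\<close>

lemma colour_poly_in_I:
  assumes "0 < l" "m \<le> k - 1" "0 < k" "\<And>i. i \<in> {1..n} \<Longrightarrow> col i < k - 1"
  shows "colour_poly l (k - 1 - m) n col \<in> I_ideal k l m n"
proof -
  have pigeon: "\<exists>i\<in>S. \<exists>j\<in>S. i \<noteq> j \<and> col i = col j"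
    if "finite S" "card T < card S" "finite T" "col ` S \<subseteq> T" for S T
  proof -
    have "card (col ` S) < card S" using card_mono[OF that(3,4)] that(2) by simp
    then have "\<not> inj_on col S" by (rule pigeonhole)
    then show ?thesis by (auto simp: inj_on_def)
  qed
  have "eval_poly (colour_poly l (k - 1 - m) n col) x = 0" if x: "x \<in> X_set k l n" for x
  proof -
    obtain S where S: "S \<subseteq> {1..n}" "card S = k" "\<forall>i\<in>S. \<forall>j\<in>S. x i ^ l = x j ^ l"
      using x by (auto simp: X_set_def)
    have fS: "finite S" using S(1) finite_subset by blast
    have "col ` S \<subseteq> {..<k - 1}" using S(1) assms(4) by auto
    moreover have "card {..<k - 1} < card S" using S(2) assms(3) by simp
    ultimately obtain i j where "i \<in> S" "j \<in> S" "i \<noteq> j" "col i = col j"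
      using pigeon[OF fS, of "{..<k - 1}"] by blast
    then show ?thesis using S(1,3)
      by (intro eval_colour_poly_eq_0_pair[of i n j]) (blast+)
  qed
  moreover have "eval_poly (colour_poly l (k - 1 - m) n col) x = 0" if x: "x \<in> Y_set (m + 1) n" for x
  proof -
    obtain S where S: "S \<subseteq> {1..n}" "card S = m + 1" "\<forall>i\<in>S. x i = 0"
      using x by (auto simp: Y_set_def)
    have fS: "finite S" using S(1) finite_subset by blast
    show ?thesis
    proof (cases "\<exists>i\<in>S. col i < k - 1 - m")
      case True
      then obtain i where "i \<in> {i \<in> {1..n}. col i < k - 1 - m}" "x i = 0" using S(1,3) by blast
      then have "(\<Prod>i\<in>{i \<in> {1..n}. col i < k - 1 - m}. x i) = 0"
        by (intro prod_zero bexI[of _ i]) simp_all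
      then show ?thesis by (simp add: eval_colour_poly)
    next
      case False
      then have "col ` S \<subseteq> {k - 1 - m..<k - 1}" using S assms(4) by (auto simp: not_less)
      moreover have "card {k - 1 - m..<k - 1} < card S" using S assms by simp
      ultimately obtain i j where "i \<in> S" "j \<in> S" "i \<noteq> j" "col i = col j"
        using pigeon[OF fS, of "{k - 1 - m..<k - 1}"] by blast
      then show ?thesis using S(1,3) assms(1)
        by (intro eval_colour_poly_eq_0_pair[of i n j]) (simp_all add: subset_iff)
    qed
  qed
  ultimately show ?thesis
    by (auto simp: I_ideal_def vanishing_ideal_def colour_poly_carrier)
qed

text \<open>Of each difference the variable of larger weight is picked.\<close>

definition colour_lead :: "(nat \<Rightarrow> nat) \<Rightarrow> nat \<Rightarrow> nat \<Rightarrow> nat \<Rightarrow> (nat \<Rightarrow> nat) \<Rightarrow> (nat \<Rightarrow>\<^sub>0 nat)" where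
  "colour_lead W l c n col =
    (\<Sum>i\<in>{i \<in> {1..n}. col i < c}. single i 1) +
    (\<Sum>(i, j)\<in>colour_pairs n col. single (if W j < W i then i else j) l)"

lemma leads_colour_poly:
  assumes "inj_on W {1..n}" "0 < l"
  shows "leads W (colour_poly l c n col) (colour_lead W l c n col)"
  unfolding colour_poly_def colour_lead_def
proof (rule leads_mult; rule leads_prod)
  fix i show "leads W (Var i) (single i 1)" unfolding Var_def by (rule leads_single) simp
next
  fix z assume z: "z \<in> colour_pairs n col"
  obtain i j where ij: "z = (i, j)" by (cases z)
  have "W i \<noteq> W j" using inj_onD[OF assms(1), of i j] z ij by (auto simp: colour_pairs_def)
  then show "leads W (case z of (i, j) \<Rightarrow> Var i ^ l - Var j ^ l)
      (case z of (i, j) \<Rightarrow> single (if W j < W i then i else j) l)"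
    using leads_Var_power_diff[of W _ _ l] assms(2) ij by (auto simp: not_less)
qed

text \<open>The index \<open>i\<close> is the heavier one in exactly as many pairs as there are lighter indices in its class.\<close>

lemma lookup_colour_lead:
  assumes inj: "inj_on W {1..n}" and i: "i \<in> {1..n}"
  shows "lookup (colour_lead W l c n col) i =
    (if col i < c then 1 else 0) + l * card {j \<in> {1..n}. col j = col i \<and> W j < W i}"
proof -
  have "lookup (\<Sum>i\<in>{i \<in> {1..n}. col i < c}. single i 1) i =
    (\<Sum>j\<in>{i \<in> {1..n}. col i < c}. if j = i then 1 else 0)"
    by (simp add: lookup_sum lookup_single when_def)
  also have "\<dots> = (if col i < c then 1 else (0::nat))" using i by simp
  finally have 1: "lookup (\<Sum>i\<in>{i \<in> {1..n}. col i < c}. single i 1) i =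
    (if col i < c then 1 else (0::nat))" .
  let ?top = "\<lambda>(i, j). if W j < W i then i else (j::nat)"
  have "lookup
      (\<Sum>(i, j)\<in>colour_pairs n col. single (if W j < W i then i else j) l) i =
    (\<Sum>z\<in>colour_pairs n col. if ?top z = i then l else 0)"
    unfolding lookup_sum by (intro sum.cong) (auto simp: lookup_single when_def)
  also have "\<dots> = l * card {z \<in> colour_pairs n col. ?top z = i}"
    by (simp add: sum.inter_filter[symmetric])
  also have "card {z \<in> colour_pairs n col. ?top z = i} = card {j \<in> {1..n}. col j = col i \<and> W j < W i}"
  proof (rule bij_betw_same_card[symmetric])
    show "bij_betw (\<lambda>j. (min i j, max i j)) {j \<in> {1..n}. col j = col i \<and> W j < W i}
      {z \<in> colour_pairs n col. ?top z = i}"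
    proof (rule bij_betwI[where g = "\<lambda>(a, b). if a = i then b else a"])
      show "(\<lambda>j. (min i j, max i j)) \<in> {j \<in> {1..n}. col j = col i \<and> W j < W i} \<rightarrow>
        {z \<in> colour_pairs n col. ?top z = i}"
      proof
        fix j assume j: "j \<in> {j \<in> {1..n}. col j = col i \<and> W j < W i}"
        then have "j \<noteq> i" by auto
        then show "(min i j, max i j) \<in> {z \<in> colour_pairs n col. ?top z = i}"
          using i j by (cases "i < j") (auto simp: colour_pairs_def)
      qed
      show "(\<lambda>(a, b). if a = i then b else a) \<in> {z \<in> colour_pairs n col. ?top z = i} \<rightarrow>
        {j \<in> {1..n}. col j = col i \<and> W j < W i}"
      proof
        fix z assume z: "z \<in> {z \<in> colour_pairs n col. ?top z = i}"
        obtain a b where ab: "z = (a, b)" by (cases z)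
        have "W a \<noteq> W b" using inj_onD[OF inj, of a b] z ab by (auto simp: colour_pairs_def)
        then show "(\<lambda>(a, b). if a = i then b else a) z \<in> {j \<in> {1..n}. col j = col i \<and> W j < W i}"
          using z ab by (auto simp: colour_pairs_def split: if_splits)
      qed
    qed (auto simp: colour_pairs_def min_def max_def split: if_splits)
  qed
  finally show ?thesis unfolding colour_lead_def lookup_add using 1 by simp
qed

lemma keys_colour_poly_exponents:
  assumes "a \<in> keys (colour_poly l c n col)"
  shows "\<exists>d. lookup a i = (if i \<in> {1..n} \<and> col i < c then 1 else 0) + l * d"
proof -
  obtain u v where uv: "a = u + v"
    "u \<in> keys (\<Prod>i\<in>{i \<in> {1..n}. col i < c}. Var i)"
    "v \<in> keys (\<Prod>(i, j)\<in>colour_pairs n col. Var i ^ l - Var j ^ l)"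
    using assms Poly_Mapping.keys_mult unfolding colour_poly_def by blast
  have "l dvd lookup v i"
  proof (rule keys_prod_subset[where P = "\<lambda>v. l dvd lookup v i", OF _ _ _ uv(3)])
    fix z a assume "a \<in> keys (case z of (i, j) \<Rightarrow> Var i ^ l - Var j ^ l)"
    then show "l dvd lookup a i"
      using keys_Var_power_diff[of "fst z" l "snd z"]
      by (auto simp: case_prod_unfold lookup_single when_def)
  qed (auto simp: lookup_add)
  moreover have "u = (\<Sum>i\<in>{i \<in> {1..n}. col i < c}. single i 1)"
  proof -
    have "(\<Prod>i\<in>A. Var i) = single (\<Sum>i\<in>A. single i 1) 1" for A
      by (induction A rule: infinite_finite_induct) (auto simp: Var_def mult_single single_one)
    then show ?thesis using uv(2) by simp
  qed
  then have "lookup u i = (\<Sum>j\<in>{i \<in> {1..n}. col i < c}. if j = i then 1 else 0)"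
    by (simp add: lookup_sum lookup_single when_def)
  then have "lookup u i = (if i \<in> {1..n} \<and> col i < c then 1 else 0)" by simp
  ultimately show ?thesis
    unfolding uv(1) lookup_add by (elim dvdE) simp
qed

lemma keys_colour_poly_degree:
  assumes "a \<in> keys (colour_poly l c n col)"
  shows "total_degree a = card {i \<in> {1..n}. col i < c} + l * card (colour_pairs n col)"
proof -
  have 1: "total_degree a = (\<Sum>i\<in>{i \<in> {1..n}. col i < c}. 1)"
    if "a \<in> keys (\<Prod>i\<in>{i \<in> {1..n}. col i < c}. Var i)" for a
    by (rule keys_prod_grade[OF _ that]) (auto simp: Var_def)
  have 2: "total_degree a = (\<Sum>z\<in>colour_pairs n col. l)"
    if "a \<in> keys (\<Prod>(i, j)\<in>colour_pairs n col. Var i ^ l - Var j ^ l)" for a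
  proof (rule keys_prod_grade[OF _ that])
    fix z a assume "a \<in> keys (case z of (i, j) \<Rightarrow> Var i ^ l - Var j ^ l)"
    then show "total_degree a = l"
      using keys_Var_power_diff[of "fst z" l "snd z"] by (auto simp: case_prod_unfold)
  qed
  show ?thesis
    using keys_mult_grade[OF 1 2 assms[unfolded colour_poly_def]] by simp
qed

section \<open>Lexicographic weights and division\<close>

lemma digits_less:
  fixes f :: "nat \<Rightarrow> nat"
  assumes "\<And>p. p < q \<Longrightarrow> f p < M"
  shows "(\<Sum>p<q. f p * M ^ p) < M ^ q"
  using assms
proof (induction q)
  case (Suc q)
  have "(\<Sum>p<Suc q. f p * M ^ p) < M ^ q + f q * M ^ q" using Suc by simp
  also have "\<dots> = Suc (f q) * M ^ q" by simp
  also have "\<dots> \<le> M * M ^ q" using Suc.prems[of q] by (intro mult_right_mono) auto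
  finally show ?case by simp
qed simp

lemma digits_lex_less:
  fixes f g :: "nat \<Rightarrow> nat"
  assumes "\<And>p. p < q \<Longrightarrow> f p < M" "\<And>p. q < p \<Longrightarrow> p < n \<Longrightarrow> f p = g p" "f q < g q" "q < n"
  shows "(\<Sum>p<n. f p * M ^ p) < (\<Sum>p<n. g p * M ^ p)"
proof -
  have split: "(\<Sum>p<n. h p * M ^ p) =
      (\<Sum>p<q. h p * M ^ p) + h q * M ^ q + (\<Sum>p\<in>{q<..<n}. h p * M ^ p)" for h :: "nat \<Rightarrow> nat"
  proof -
    have "{..<n} = {..<q} \<union> {q} \<union> {q<..<n}" using assms(4) by auto
    then have "(\<Sum>p<n. h p * M ^ p) = (\<Sum>p\<in>{..<q} \<union> {q} \<union> {q<..<n}. h p * M ^ p)" by simp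
    also have "\<dots> = (\<Sum>p\<in>{..<q} \<union> {q}. h p * M ^ p) + (\<Sum>p\<in>{q<..<n}. h p * M ^ p)"
      by (rule sum.union_disjoint) auto
    also have "(\<Sum>p\<in>{..<q} \<union> {q}. h p * M ^ p) = (\<Sum>p<q. h p * M ^ p) + h q * M ^ q"
      by (subst sum.union_disjoint) auto
    finally show ?thesis .
  qed
  have "(\<Sum>p<q. f p * M ^ p) + f q * M ^ q < M ^ q + f q * M ^ q"
    using digits_less[of q f M] assms(1) by simp
  also have "\<dots> = Suc (f q) * M ^ q" by simp
  also have "\<dots> \<le> g q * M ^ q" using assms(3) by (intro mult_right_mono) auto
  finally have "(\<Sum>p<q. f p * M ^ p) + f q * M ^ q < (\<Sum>p<q. g p * M ^ p) + g q * M ^ q" by simp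
  moreover have "(\<Sum>p\<in>{q<..<n}. f p * M ^ p) = (\<Sum>p\<in>{q<..<n}. g p * M ^ p)"
    using assms(2) by (intro sum.cong) auto
  ultimately show ?thesis unfolding split by simp
qed

text \<open>The variable \<open>vs p\<close> has weight \<open>M ^ p\<close>, so that for exponents below \<open>M\<close> the weight is read off from
base-\<open>M\<close> digits, and comparing weights is comparing lexicographically with \<open>vs (n - 1)\<close> most
significant.\<close>

definition lex_weight :: "nat \<Rightarrow> (nat \<Rightarrow> nat) \<Rightarrow> nat \<Rightarrow> (nat \<Rightarrow> nat) \<Rightarrow> bool" where
  "lex_weight n vs M W \<longleftrightarrow> bij_betw vs {..<n} {1..n} \<and> 1 < M \<and> (\<forall>p<n. W (vs p) = M ^ p)"

lemma lex_weight_inj_on: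
  assumes "lex_weight n vs M W"
  shows "inj_on W {1..n}"
proof -
  have "inj_on W (vs ` {..<n})"
    using assms unfolding lex_weight_def inj_on_def by auto
  then show ?thesis using assms by (simp add: lex_weight_def bij_betw_def)
qed

lemma lex_weight_less_iff:
  assumes "lex_weight n vs M W" "p < n" "q < n"
  shows "W (vs p) < W (vs q) \<longleftrightarrow> p < q"
  using assms by (simp add: lex_weight_def)

lemma wt_lex_weight:
  assumes "lex_weight n vs M W" "keys a \<subseteq> {1..n}"
  shows "wt W a = (\<Sum>p<n. lookup a (vs p) * M ^ p)"
proof -
  have b: "bij_betw vs {..<n} {1..n}" using assms by (simp add: lex_weight_def)
  have "wt W a = (\<Sum>i\<in>{1..n}. lookup a i * W i)" by (rule wt_superset) (use assms in auto)
  also have "\<dots> = (\<Sum>p<n. lookup a (vs p) * W (vs p))"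
    by (rule sum.reindex_bij_betw[OF b, symmetric])
  finally show ?thesis using assms by (simp add: lex_weight_def)
qed

lemma lookup_le_degree: "lookup a i \<le> total_degree a"
proof (cases "i \<in> keys a")
  case True
  then show ?thesis unfolding wt_def by (simp add: member_le_sum)
qed (simp add: in_keys_iff)

lemma wt_less_if_lex:
  assumes "lex_weight n vs M W" "keys a \<subseteq> {1..n}" "keys b \<subseteq> {1..n}"
    "total_degree a < M" "q < n" "lookup a (vs q) < lookup b (vs q)"
    "\<And>p. q < p \<Longrightarrow> p < n \<Longrightarrow> lookup a (vs p) = lookup b (vs p)"
  shows "wt W a < wt W b"
  unfolding wt_lex_weight[OF assms(1,2)] wt_lex_weight[OF assms(1,3)]
  by (rule digits_lex_less[where q = q])
     (use assms le_less_trans[OF lookup_le_degree assms(4)] in auto)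

lemma wt_lex_weight_inj:
  assumes "lex_weight n vs M W" "keys a \<subseteq> {1..n}" "keys b \<subseteq> {1..n}"
    "total_degree a < M" "total_degree b < M" "wt W a = wt W b"
  shows "a = b"
proof (rule ccontr)
  assume "a \<noteq> b"
  then obtain i where i: "lookup a i \<noteq> lookup b i"
    by (meson poly_mapping_eqI)
  then have "i \<in> {1..n}" using assms(2,3) by (metis in_keys_iff subsetD)
  then obtain p where p: "p < n" "vs p = i"
    using assms(1) unfolding lex_weight_def bij_betw_def by (metis imageE lessThan_iff)
  define D where "D = {p. p < n \<and> lookup a (vs p) \<noteq> lookup b (vs p)}"
  have "finite D" "D \<noteq> {}" using p i by (auto simp: D_def)
  define q where "q = Max D"
  have "q \<in> D" using \<open>finite D\<close> \<open>D \<noteq> {}\<close> by (simp add: q_def)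
  have above: "lookup a (vs p) = lookup b (vs p)" if "q < p" "p < n" for p
  proof (rule ccontr)
    assume "lookup a (vs p) \<noteq> lookup b (vs p)"
    then have "p \<le> q" unfolding q_def using \<open>finite D\<close> that by (intro Max_ge) (auto simp: D_def)
    then show False using that by simp
  qed
  have "q < n" "lookup a (vs q) \<noteq> lookup b (vs q)" using \<open>q \<in> D\<close> by (auto simp: D_def)
  then show False
    using wt_less_if_lex[OF assms(1-4), of q] wt_less_if_lex[OF assms(1,3,2,5), of q] above assms(6)
    by (metis less_irrefl linorder_neqE_nat)
qed

text \<open>The variables of \<open>A\<close> come first, and the natural order is kept within \<open>A\<close> and within its complement. The
latter makes the order of variables agree with the order of tableau entries inside each column.\<close>

lemma exists_block_order:
  assumes "A \<subseteq> {1..n::nat}"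
  obtains vs where "bij_betw vs {..<n} {1..n}" "\<And>p. p < n \<Longrightarrow> vs p \<in> A \<longleftrightarrow> p < card A"
    "\<And>p q. p < q \<Longrightarrow> q < n \<Longrightarrow> (vs p \<in> A \<longleftrightarrow> vs q \<in> A) \<Longrightarrow> vs p < vs q"
proof -
  define B where "B = {1..n} - A"
  have fin: "finite A" "finite B" using assms finite_subset by (auto simp: B_def)
  define xs where "xs = sorted_list_of_set A @ sorted_list_of_set B"
  have xs: "distinct xs" "set xs = {1..n}" using fin assms by (auto simp: xs_def B_def)
  then have len: "length xs = n" using distinct_card[of xs] by simp
  have nA: "xs ! p \<in> A \<longleftrightarrow> p < card A" if "p < n" for p
  proof (cases "p < card A")
    case True
    then have "xs ! p = sorted_list_of_set A ! p" by (simp add: xs_def nth_append)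
    then show ?thesis using True fin by (metis length_sorted_list_of_set nth_mem set_sorted_list_of_set)
  next
    case False
    then have "xs ! p = sorted_list_of_set B ! (p - card A)" by (simp add: xs_def nth_append)
    moreover have "p - card A < card B"
      using that len False by (simp add: xs_def)
    ultimately have "xs ! p \<in> B" using fin by (metis length_sorted_list_of_set nth_mem set_sorted_list_of_set)
    then show ?thesis using False by (simp add: B_def)
  qed
  have lt: "sorted_list_of_set S ! p < sorted_list_of_set S ! q" if "p < q" "q < card S" for S :: "nat set" and p q
    using that sorted_wrt_nth_less[OF strict_sorted_list_of_set[of S], of p q] by simp
  have mono: "xs ! p < xs ! q" if "p < q" "q < n" "xs ! p \<in> A \<longleftrightarrow> xs ! q \<in> A" for p q
  proof (cases "q < card A")
    case True
    then show ?thesis using that lt[of p q A] by (simp add: xs_def nth_append)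
  next
    case False
    then have "\<not> p < card A" using nA that by simp
    moreover have "q - card A < card B" using that len False by (simp add: xs_def)
    ultimately show ?thesis
      using that False lt[of "p - card A" "q - card A" B] by (simp add: xs_def nth_append)
  qed
  show ?thesis
  proof (rule that[of "\<lambda>p. xs ! p"])
    show "bij_betw (\<lambda>p. xs ! p) {..<n} {1..n}"
      using xs len by (metis bij_betw_nth)
  qed (use nA mono in auto)
qed

lemma exists_lex_weight:
  assumes "bij_betw vs {..<n} {1..n}" "1 < M"
  obtains W where "lex_weight n vs M W"
proof
  show "lex_weight n vs M (\<lambda>i. M ^ inv_into {..<n} vs i)"
    using assms by (auto simp: lex_weight_def bij_betw_def)
qed

text \<open>Division with remainder in abstract form: if the leading term of every element of \<open>F\<close> can be cancelled
by an element of \<open>J\<close> without leaving \<open>F\<close>, then \<open>F\<close> is contained in \<open>J\<close>. It terminates because weights are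
natural numbers.\<close>

lemma lead_reduction:
  assumes step: "\<And>f a. f \<in> F \<Longrightarrow> a \<in> keys f \<Longrightarrow>
      (\<And>b. b \<in> keys f \<Longrightarrow> wt W b \<le> wt W a) \<Longrightarrow>
      \<exists>h\<in>J. f - h \<in> F \<and> (\<forall>b\<in>keys (f - h). wt W b < wt W a)"
    and J: "0 \<in> J" "\<And>p q. p \<in> J \<Longrightarrow> q \<in> J \<Longrightarrow> p + q \<in> J"
    and f: "(f::cpoly) \<in> F"
  shows "f \<in> J"
proof -
  have "f \<in> J" if "f \<in> F" "\<forall>b\<in>keys f. wt W b < d" for f d
    using that
  proof (induction d arbitrary: f)
    case 0
    then have "f = 0" by (metis all_not_in_conv keys_eq_empty not_less_zero)
    then show ?case using J by simp
  next
    case (Suc d)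
    show ?case
    proof (cases "f = 0")
      case False
      then have ne: "wt W ` keys f \<noteq> {}" by simp
      obtain a where a: "a \<in> keys f" "wt W a = Max (wt W ` keys f)"
        using Max_in[OF _ ne] by fastforce
      have "wt W b \<le> wt W a" if "b \<in> keys f" for b
        unfolding a(2) by (rule Max_ge) (use that in auto)
      then obtain h where h: "h \<in> J" "f - h \<in> F" "\<forall>b\<in>keys (f - h). wt W b < wt W a"
        using step[OF Suc.prems(1) a(1)] by blast
      have "wt W a \<le> d" using Suc.prems(2) a(1) by (meson less_Suc_eq_le)
      then have "f - h \<in> J" using h(2,3) by (intro Suc.IH) (auto intro: less_le_trans)
      then have "(f - h) + h \<in> J" using h J by blast
      then show ?thesis by simp
    qed (use J in simp)
  qed
  moreover have "\<forall>b\<in>keys f. wt W b < Suc (\<Sum>b\<in>keys f. wt W b)"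
    by (auto simp: less_Suc_eq_le intro!: member_le_sum)
  ultimately show ?thesis using f by blast
qed

lemma lookup_const_mult:
  "lookup (single 0 c * p :: cpoly) b = c * lookup p b"
  unfolding mult_map_scale_conv_mult[symmetric]
  by (simp add: Poly_Mapping.map.rep_eq when_def)

lemma leads_cancel:
  assumes "leads W f a" "leads W h a"
    "b \<in> keys (f - single 0 (lookup f a / lookup h a) * h)"
  shows "wt W b < wt W a"
proof -
  let ?c = "lookup f a / lookup h a"
  have nz: "lookup h a \<noteq> 0" using assms(2) by (auto simp: leads_def in_keys_iff)
  have b: "lookup f b - ?c * lookup h b \<noteq> 0"
    using assms(3) unfolding in_keys_iff lookup_minus lookup_const_mult .
  then have "b \<noteq> a" using nz by auto
  moreover have "b \<in> keys f \<or> b \<in> keys h" using b by (auto simp: in_keys_iff)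
  ultimately show ?thesis using assms(1,2) by (auto simp: leads_def)
qed

section \<open>Splitting by residues of exponents\<close>

lemma sum_roots_of_unity_power:
  assumes "0 < l"
  shows "(\<Sum>s<l. cis (2 * pi * real s / real l) ^ j) = (if l dvd j then of_nat l else 0)"
proof -
  define z where "z = cis (2 * pi * real j / real l)"
  have eq: "cis (2 * pi * real s / real l) ^ j = z ^ s" for s
    by (simp add: z_def DeMoivre mult_ac)
  show ?thesis
  proof (cases "l dvd j")
    case True
    then obtain d where "j = l * d" by auto
    then have "2 * pi * real j / real l = 2 * pi * real d" using assms by simp
    then have "z = cis (2 * pi * real d)" by (simp only: z_def)
    also have "\<dots> = 1" by (rule cis_multiple_2pi) simp
    finally have "z = 1" .
    then show ?thesis using True eq by simp
  next
    case False
    have zl: "z ^ l = 1" using assms by (simp add: z_def DeMoivre cis_multiple_2pi)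
    have "z \<noteq> 1"
    proof
      assume "z = 1"
      have "real j = real l * real (j div l) + real (j mod l)"
        by (simp flip: of_nat_mult of_nat_add)
      then have "2 * pi * real j / real l = 2 * pi * real (j div l) + 2 * pi * real (j mod l) / real l"
        using assms by (simp add: add_divide_distrib distrib_left)
      then have "z = cis (2 * pi * real (j div l)) * cis (2 * pi * real (j mod l) / real l)"
        by (simp only: z_def cis_mult)
      then have eq0: "cis (2 * pi * real (j mod l) / real l) = cis (2 * pi * real 0 / real l)"
        using \<open>z = 1\<close> by (simp add: cis_multiple_2pi)
      have inj0: "inj_on (\<lambda>k. cis (2 * pi * real k / real l)) {..<l}"
        using bij_betw_roots_unity[OF assms] by (simp only: bij_betw_def)
      have "j mod l = 0" by (rule inj_onD[OF inj0 eq0]) (use assms in simp_all)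
      then show False using False by auto
    qed
    then show ?thesis using False eq zl by (simp add: geometric_sum)
  qed
qed

definition residue_part :: "nat \<Rightarrow> nat \<Rightarrow> nat \<Rightarrow> cpoly \<Rightarrow> cpoly" where
  "residue_part l i r f = (\<Sum>a\<in>{a \<in> keys f. lookup a i mod l = r}.
     single a (lookup f a))"

lemma lookup_residue_part:
  "lookup (residue_part l i r f) a =
    (if lookup a i mod l = r then lookup f a else 0)"
  unfolding residue_part_def lookup_sum
  by (auto simp: lookup_single when_def in_keys_iff sum.delta')

lemma keys_residue_part:
  "keys (residue_part l i r f) = {a \<in> keys f. lookup a i mod l = r}"
  by (auto simp: in_keys_iff lookup_residue_part split: if_splits)

lemma sum_residue_parts:
  assumes "0 < l"
  shows "(\<Sum>r<l. residue_part l i r f) = f"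
  by (rule poly_mapping_eqI) (use assms in \<open>simp add: lookup_sum lookup_residue_part\<close>)

lemma mono_val_scale: "mono_val a (x(i := w * x i)) = w ^ lookup a i * mono_val a x"
proof -
  let ?S = "insert i (keys a)"
  have "mono_val a (x(i := w * x i)) =
    (\<Prod>j\<in>?S. (if j = i then w ^ lookup a i else 1) * x j ^ lookup a j)"
    by (subst mono_val_superset[of ?S]) (auto intro!: prod.cong simp: power_mult_distrib subset_insertI)
  also have "\<dots> = w ^ lookup a i * mono_val a x"
    by (subst mono_val_superset[of ?S a]) (auto simp: prod.distrib)
  finally show ?thesis .
qed

text \<open>The factor \<open>l - r\<close> in the exponent stands for \<open>- r\<close>: the average over the roots of unity \<open>w\<close> of
\<open>w ^ (l - r + e)\<close> is \<open>1\<close> if \<open>e mod l = r\<close> and \<open>0\<close> otherwise.\<close>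

lemma eval_residue_part:
  assumes "0 < l" "r < l"
  shows "of_nat l * eval_poly (residue_part l i r f) x =
    (\<Sum>s<l. cis (2 * pi * real s / real l) ^ (l - r) * eval_poly f (x(i := cis (2 * pi * real s / real l) * x i)))"
proof -
  let ?w = "\<lambda>s. cis (2 * pi * real s / real l)"
  have dv: "l dvd (l - r) + e \<longleftrightarrow> e mod l = r" for e
  proof -
    define u where "u = e mod l"
    have u: "u < l" using assms by (simp add: u_def)
    have "(l - r) + e = (l - r) + u + l * (e div l)" by (simp add: u_def)
    then have "l dvd (l - r) + e \<longleftrightarrow> l dvd (l - r) + u" by (metis dvd_add_left_iff dvd_triv_left)
    also have "\<dots> \<longleftrightarrow> u = r"
    proof
      assume "l dvd (l - r) + u"
      then obtain d where d: "(l - r) + u = l * d" by auto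
      have "d = 1"
      proof (rule ccontr)
        assume "d \<noteq> 1"
        then consider "d = 0" | "2 \<le> d" by linarith
        then show False
        proof cases
          case 2
          then have "l * 2 \<le> l * d" by (rule mult_le_mono2)
          then show False using d u assms by linarith
        qed (use d u assms in simp)
      qed
      then show "u = r" using d assms by simp
    qed (use assms in simp)
    finally show ?thesis by (simp add: u_def)
  qed
  have "(\<Sum>s<l. ?w s ^ (l - r) * eval_poly f (x(i := ?w s * x i))) =
    (\<Sum>a\<in>keys f. lookup f a * mono_val a x *
       (\<Sum>s<l. ?w s ^ ((l - r) + lookup a i)))"
    unfolding eval_poly_keys mono_val_scale sum_distrib_left
    by (subst sum.swap) (simp add: power_add mult_ac)
  also have "\<dots> = (\<Sum>a\<in>keys f.
      of_nat l * (lookup (residue_part l i r f) a * mono_val a x))"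
    unfolding sum_roots_of_unity_power[OF assms(1)] dv lookup_residue_part
    by (intro sum.cong) auto
  also have "\<dots> = of_nat l * eval_poly (residue_part l i r f) x"
    unfolding sum_distrib_left[symmetric]
    by (subst eval_poly_superset[of "keys f"]) (auto simp: keys_residue_part)
  finally show ?thesis by simp
qed

lemma I_ideal_ideal: "ideal (I_ideal k l m n) (poly_ring n)"
  unfolding I_ideal_def by (rule vanishing_ideal_ideal)

text \<open>Multiplying a coordinate by an \<open>l\<close>-th root of unity changes neither \<open>l\<close>-th powers nor zeros, so it
preserves \<open>X\<close> and \<open>Y\<close>.\<close>

lemma residue_part_in_I:
  assumes "0 < l" "r < l" "i \<in> {1..n}" "f \<in> I_ideal k l m n"
  shows "residue_part l i r f \<in> I_ideal k l m n"
proof -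
  let ?Z = "X_set k l n \<union> Y_set (m + 1) n"
  have stable: "x(i := w * x i) \<in> ?Z" if "x \<in> ?Z" "w ^ l = 1" for x w
  proof -
    have pw: "(x(i := w * x i)) j ^ l = x j ^ l" for j using that(2) by (simp add: power_mult_distrib)
    have ext: "x(i := w * x i) \<in> {1..n} \<rightarrow>\<^sub>E UNIV"
      using that(1) assms(3) by (auto simp: X_set_def Y_set_def PiE_def extensional_def)
    from that(1) show ?thesis
    proof
      assume "x \<in> X_set k l n"
      then show ?thesis using pw ext unfolding X_set_def by auto
    next
      assume "x \<in> Y_set (m + 1) n"
      then obtain S where "S \<subseteq> {1..n}" "card S = m + 1" "\<forall>i\<in>S. x i = 0" by (auto simp: Y_set_def)
      then have "x(i := w * x i) \<in> Y_set (m + 1) n"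
        using ext unfolding Y_set_def by (intro CollectI conjI exI[of _ S]) auto
      then show ?thesis by blast
    qed
  qed
  have "eval_poly (residue_part l i r f) x = 0" if "x \<in> ?Z" for x
  proof -
    have "eval_poly f (x(i := cis (2 * pi * real s / real l) * x i)) = 0" for s
      using stable[OF that, of "cis (2 * pi * real s / real l)"] assms(1,4)
      by (simp add: I_ideal_def vanishing_ideal_def DeMoivre cis_multiple_2pi)
    then have "of_nat l * eval_poly (residue_part l i r f) x = 0"
      unfolding eval_residue_part[OF assms(1,2)] by simp
    then show ?thesis using assms(1) by simp
  qed
  moreover have "residue_part l i r f \<in> carrier (poly_ring n)"
    using assms(4) by (auto simp: I_ideal_def vanishing_ideal_def carrier_poly_ring keys_residue_part)
  ultimately show ?thesis by (simp add: I_ideal_def vanishing_ideal_def)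
qed

lemma exists_root: "0 < l \<Longrightarrow> \<exists>x::complex. x ^ l = y"
proof (cases "y = 0")
  case False
  assume "0 < l"
  then have "card {z::complex. z ^ l = y} = l" using False by (intro card_nth_roots) auto
  then have "{z::complex. z ^ l = y} \<noteq> {}" using \<open>0 < l\<close> by (metis card.empty less_irrefl)
  then show ?thesis by blast
qed (auto intro: exI[of _ 0])

text \<open>The bridge from points \<open>x\<close> to points \<open>y\<close> with \<open>y_i = x_i ^ l\<close>. Every \<open>y\<close> lifts to some \<open>x\<close>, and a crowded \<open>y\<close>
lifts to a point of \<open>X\<close> if the repeated value is nonzero, and of \<open>Y\<close> if it is zero. The common monomial
factor of \<open>f\<close> with exponents \<open>\<rho>\<close> does not vanish there, because \<open>\<rho>\<close> is supported on the positions
before \<open>t\<close>. Here \<open>\<rho>\<close> need not be below \<open>l\<close>; this matters when \<open>l = 1\<close> and \<open>f\<close> is divisible by variables.\<close>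

lemma colouring_below_lead:
  assumes f: "f \<in> I_ideal k l m n" and l: "0 < l" and k: "0 < k" "m \<le> k - 1"
    and vs: "bij_betw vs {..<n} {1..n}" and t: "t \<le> n"
    and res: "\<And>b i. b \<in> keys f \<Longrightarrow> i \<in> {1..n} \<Longrightarrow> \<exists>d. lookup b i = \<rho> i + l * d"
    and A: "\<And>p. p < n \<Longrightarrow> t \<le> p \<Longrightarrow> \<rho> (vs p) = 0"
    and a: "a \<in> keys f"
    and lex: "\<And>b q. b \<in> keys f \<Longrightarrow> q < n \<Longrightarrow>
      (\<And>p. q < p \<Longrightarrow> p < n \<Longrightarrow> lookup b (vs p) = lookup a (vs p)) \<Longrightarrow>
      lookup b (vs q) \<le> lookup a (vs q)"
  shows "\<exists>col. \<forall>p<n. col p < k - 1 \<and>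
    card {p'. p' < p \<and> col p' = col p} + (if t \<le> p \<and> col p < k - 1 - m then 1 else 0)
       \<le> (lookup a (vs p) - \<rho> (vs p)) div l"
proof -
  let ?e = "\<lambda>b p. (lookup b (vs p) - \<rho> (vs p)) div l"
  have carr: "keys b \<subseteq> {1..n}" if "b \<in> keys f" for b
    using f that by (auto simp: I_ideal_def vanishing_ideal_def carrier_poly_ring)
  have vsin: "vs p \<in> {1..n}" if "p < n" for p using vs that by (auto simp: bij_betw_def)
  have split: "lookup b (vs p) = \<rho> (vs p) + l * ?e b p"
    if "b \<in> keys f" "p < n" for b p
    using res[OF that(1) vsin[OF that(2)]] l by auto
  have eqI: "lookup b (vs p) = lookup a (vs p)"
    if "b \<in> keys f" "p < n" "?e b p = ?e a p" for b p
    using split[OF that(1,2)] split[OF a that(2)] that(3) by simp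
  show ?thesis
  proof (rule greedy_colouring_below_lead[of "keys f" a "lookup f" n ?e t "k - 1" "k - 1 - m"])
    show "lookup f a \<noteq> 0" using a by (simp add: in_keys_iff)
    show "?e b q \<le> ?e a q" if "b \<in> keys f" "q < n"
      "\<And>p. q < p \<Longrightarrow> p < n \<Longrightarrow> ?e b p = ?e a p" for b q
      using lex[OF that(1,2)] eqI[OF that(1)] that(3) by (intro div_le_mono diff_le_mono) blast
    show "b = a" if "b \<in> keys f" "\<And>p. p < n \<Longrightarrow> ?e b p = ?e a p" for b
    proof (rule poly_mapping_eqI)
      fix i
      show "lookup b i = lookup a i"
      proof (cases "i \<in> {1..n}")
        case True
        then obtain p where "p < n" "vs p = i" using vs unfolding bij_betw_def by (metis imageE lessThan_iff)
        then show ?thesis using eqI that by blast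
      next
        case False
        then show ?thesis using carr[OF that(1)] carr[OF a] by (metis in_keys_iff subsetD)
      qed
    qed
    show "(\<Sum>b\<in>keys f. lookup f b * (\<Prod>p<n. y p ^ ?e b p)) = 0"
      if y: "\<And>p. p < t \<Longrightarrow> y p \<noteq> 0" "k - 1 < class_size t (k - 1 - m) n y v" for y v
    proof -
      define pos where "pos = inv_into {..<n} vs"
      define x where "x = (\<lambda>i\<in>{1..n}. SOME z. z ^ l = y (pos i))"
      have pos: "pos (vs p) = p" if "p < n" for p
        using vs that by (simp add: pos_def bij_betw_def)
      have x: "x (vs p) ^ l = y p" if "p < n" for p
        using someI_ex[OF exists_root[OF l, of "y (pos (vs p))"]] vsin[OF that] pos[OF that]
        by (simp add: x_def)
      have ext: "x \<in> {1..n} \<rightarrow>\<^sub>E UNIV" by (simp add: x_def)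
      have injvs: "inj_on vs {p. p < n \<and> y p = v}" for v
        using vs unfolding bij_betw_def by (auto intro: inj_on_subset)
      have Z: "x \<in> X_set k l n \<union> Y_set (m + 1) n"
      proof (cases "v = 0")
        case False
        then have "k \<le> card {p. p < n \<and> y p = v}"
          using y(2) k by (simp add: class_size_def)
        then have "k \<le> card (vs ` {p. p < n \<and> y p = v})" by (simp only: card_image[OF injvs])
        then obtain S where S: "S \<subseteq> vs ` {p. p < n \<and> y p = v}" "card S = k"
          by (rule obtain_subset_with_card_n) blast
        have "x \<in> X_set k l n"
          unfolding X_set_def
        proof (intro CollectI conjI exI ballI)
          show "S \<subseteq> {1..n}" using S(1) vsin by auto
          fix i j assume "i \<in> S" "j \<in> S"
          then obtain p q where "p < n" "i = vs p" "y p = v" "q < n" "j = vs q" "y q = v"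
            using S(1) by blast
          then show "x i ^ l = x j ^ l" using x by simp
        qed (use S ext in auto)
        then show ?thesis by blast
      next
        case True
        then have "m + 1 \<le> card {p. p < n \<and> y p = v}"
          using y(2) k t by (simp add: class_size_def)
        then have "m + 1 \<le> card (vs ` {p. p < n \<and> y p = v})" by (simp only: card_image[OF injvs])
        then obtain S where S: "S \<subseteq> vs ` {p. p < n \<and> y p = v}" "card S = m + 1"
          by (rule obtain_subset_with_card_n) blast
        have "x \<in> Y_set (m + 1) n"
          unfolding Y_set_def
        proof (intro CollectI conjI exI ballI)
          show "S \<subseteq> {1..n}" using S(1) vsin by auto
          fix i assume "i \<in> S"
          then obtain p where "p < n" "vs p = i" "y p = 0" using S(1) True by blast
          then have "x i ^ l = 0" using x[of p] by simp
          then show "x i = 0" by simp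
        qed (use S ext in auto)
        then show ?thesis by blast
      qed
      have "0 = eval_poly f x" using f Z by (simp add: I_ideal_def vanishing_ideal_def)
      also have "\<dots> = (\<Sum>b\<in>keys f. (\<Prod>p<n. x (vs p) ^ \<rho> (vs p)) *
          (lookup f b * (\<Prod>p<n. y p ^ ?e b p)))"
        unfolding eval_poly_keys
      proof (rule sum.cong[OF refl])
        fix b assume b: "b \<in> keys f"
        have "mono_val b x = (\<Prod>i\<in>{1..n}. x i ^ lookup b i)"
          by (rule mono_val_superset) (use carr[OF b] in auto)
        also have "\<dots> = (\<Prod>p<n. x (vs p) ^ lookup b (vs p))"
          by (rule prod.reindex_bij_betw[OF vs, symmetric])
        also have "\<dots> = (\<Prod>p<n. x (vs p) ^ \<rho> (vs p) * y p ^ ?e b p)"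
        proof (rule prod.cong[OF refl])
          fix p assume "p \<in> {..<n}"
          then have "x (vs p) ^ lookup b (vs p) = x (vs p) ^ (\<rho> (vs p) + l * ?e b p)"
            and xl: "x (vs p) ^ l = y p"
            using split[OF b, of p] x by auto
          then show "x (vs p) ^ lookup b (vs p) = x (vs p) ^ \<rho> (vs p) * y p ^ ?e b p"
            by (simp only: power_add power_mult xl)
        qed
        finally have "mono_val b x = (\<Prod>p<n. x (vs p) ^ \<rho> (vs p)) * (\<Prod>p<n. y p ^ ?e b p)"
          by (simp only: prod.distrib)
        then show "lookup f b * mono_val b x = (\<Prod>p<n. x (vs p) ^ \<rho> (vs p)) *
          (lookup f b * (\<Prod>p<n. y p ^ ?e b p))" by (simp only: mult_ac)
      qed
      also have "\<dots> = (\<Prod>p<n. x (vs p) ^ \<rho> (vs p)) *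
          (\<Sum>b\<in>keys f. lookup f b * (\<Prod>p<n. y p ^ ?e b p))"
        by (simp only: sum_distrib_left)
      finally have zero: "(\<Prod>p<n. x (vs p) ^ \<rho> (vs p)) *
          (\<Sum>b\<in>keys f. lookup f b * (\<Prod>p<n. y p ^ ?e b p)) = 0" by simp
      have nz: "(\<Prod>p<n. x (vs p) ^ \<rho> (vs p)) \<noteq> 0"
      proof -
        have "x (vs p) ^ \<rho> (vs p) \<noteq> 0" if "p < n" for p
        proof (cases "p < t")
          case True
          then have "x (vs p) ^ l \<noteq> 0" using x[OF that] y(1) by simp
          then show ?thesis using l by auto
        next
          case False
          then show ?thesis using A[OF that] by simp
        qed
        then show ?thesis by simp
      qed
      show ?thesis using mult_eq_0_iff[THEN iffD1, OF zero] nz by blast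
    qed
    show ?thesis if "\<And>p. p < n \<Longrightarrow> col p < k - 1"
      "\<And>p. p < n \<Longrightarrow> card {p'. p' < p \<and> col p' = col p} + (if t \<le> p \<and> col p < k - 1 - m then 1 else 0)
        \<le> ?e a p" for col
      using that by blast
  qed (use a t in simp_all)
qed

section \<open>The ideal lies in the ideal of all colour polynomials\<close>

lemma I_carrier_keys:
  "f \<in> I_ideal k l m n \<Longrightarrow> b \<in> keys f \<Longrightarrow> keys b \<subseteq> {1..n}"
  by (auto simp: I_ideal_def vanishing_ideal_def carrier_poly_ring)

text \<open>The previous lemma in terms of variables and weights instead of positions.\<close>

lemma colouring_below_lex_lead:
  assumes f: "f \<in> I_ideal k l m n" and l: "0 < l" and k: "0 < k" "m \<le> k - 1"
    and A: "A \<subseteq> {1..n}" "\<And>p. p < n \<Longrightarrow> vs p \<in> A \<longleftrightarrow> p < card A"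
    and W: "lex_weight n vs M W"
    and deg: "\<And>b. b \<in> keys f \<Longrightarrow> total_degree b < M"
    and res: "\<And>b i. b \<in> keys f \<Longrightarrow> i \<in> {1..n} \<Longrightarrow> \<exists>d. lookup b i = \<rho> i + l * d"
    and \<rho>: "\<And>i. i \<in> {1..n} \<Longrightarrow> i \<notin> A \<Longrightarrow> \<rho> i = 0"
    and a: "a \<in> keys f"
    and mx: "\<And>b. b \<in> keys f \<Longrightarrow> wt W b \<le> wt W a"
  shows "\<exists>col. \<forall>i\<in>{1..n}. col i < k - 1 \<and>
    card {j \<in> {1..n}. col j = col i \<and> W j < W i} + (if i \<notin> A \<and> col i < k - 1 - m then 1 else 0)
      \<le> (lookup a i - \<rho> i) div l"
proof -
  have vs: "bij_betw vs {..<n} {1..n}" using W by (simp add: lex_weight_def)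
  have vsin: "vs p \<in> {1..n}" if "p < n" for p using vs that by (auto simp: bij_betw_def)
  have tn: "card A \<le> n" using card_mono[OF _ A(1)] by simp
  have "\<exists>col. \<forall>p<n. col p < k - 1 \<and>
    card {p'. p' < p \<and> col p' = col p} + (if card A \<le> p \<and> col p < k - 1 - m then 1 else 0)
       \<le> (lookup a (vs p) - \<rho> (vs p)) div l"
  proof (rule colouring_below_lead[OF f l k vs tn res _ a])
    show "\<rho> (vs p) = 0" if "p < n" "card A \<le> p" for p
      using \<rho>[OF vsin[OF that(1)]] A(2)[OF that(1)] that(2) by simp
    show "lookup b (vs q) \<le> lookup a (vs q)"
      if b: "b \<in> keys f" "q < n"
        "\<And>p. q < p \<Longrightarrow> p < n \<Longrightarrow> lookup b (vs p) = lookup a (vs p)" for b q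
    proof (rule ccontr)
      assume "\<not> ?thesis"
      then have "wt W a < wt W b"
        by (intro wt_less_if_lex[OF W I_carrier_keys[OF f a] I_carrier_keys[OF f b(1)] deg[OF a] b(2)])
           (use b(3) in simp_all)
      then show False using mx[OF b(1)] by simp
    qed
  qed
  then obtain col where col: "\<And>p. p < n \<Longrightarrow> col p < k - 1"
    "\<And>p. p < n \<Longrightarrow> card {p'. p' < p \<and> col p' = col p} + (if card A \<le> p \<and> col p < k - 1 - m then 1 else 0)
       \<le> (lookup a (vs p) - \<rho> (vs p)) div l" by blast
  define pos where "pos = inv_into {..<n} vs"
  have pos: "pos (vs p) = p" if "p < n" for p
    using vs that by (simp add: pos_def bij_betw_def)
  show ?thesis
  proof (intro exI[of _ "\<lambda>i. col (pos i)"] ballI)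
    fix i assume "i \<in> {1..n}"
    then obtain p where p: "p < n" "i = vs p" using vs unfolding bij_betw_def by (metis imageE lessThan_iff)
    have "bij_betw vs {p'. p' < p \<and> col p' = col p} {j \<in> {1..n}. col (pos j) = col p \<and> W j < W i}"
    proof (rule bij_betw_imageI)
      show "inj_on vs {p'. p' < p \<and> col p' = col p}"
        using vs p unfolding bij_betw_def by (auto intro: inj_on_subset)
      show "vs ` {p'. p' < p \<and> col p' = col p} = {j \<in> {1..n}. col (pos j) = col p \<and> W j < W i}"
      proof (intro Set.set_eqI iffI)
        fix j assume "j \<in> vs ` {p'. p' < p \<and> col p' = col p}"
        then obtain p' where p': "p' < p" "col p' = col p" "j = vs p'" by blast
        then show "j \<in> {j \<in> {1..n}. col (pos j) = col p \<and> W j < W i}"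
          using vsin[of p'] pos[of p'] lex_weight_less_iff[OF W, of p' p] p by simp
      next
        fix j assume j: "j \<in> {j \<in> {1..n}. col (pos j) = col p \<and> W j < W i}"
        then obtain p' where p': "p' < n" "j = vs p'" using vs unfolding bij_betw_def by (metis (no_types, lifting) imageE lessThan_iff mem_Collect_eq)
        then have "p' < p" "col p' = col p" using j pos[of p'] lex_weight_less_iff[OF W, of p' p] p by auto
        then show "j \<in> vs ` {p'. p' < p \<and> col p' = col p}" using p' by blast
      qed
    qed
    then have "card {p'. p' < p \<and> col p' = col p} = card {j \<in> {1..n}. col (pos j) = col p \<and> W j < W i}"
      by (rule bij_betw_same_card)
    then show "col (pos i) < k - 1 \<and>
      card {j \<in> {1..n}. col (pos j) = col (pos i) \<and> W j < W i} +
        (if i \<notin> A \<and> col (pos i) < k - 1 - m then 1 else 0) \<le> (lookup a i - \<rho> i) div l"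
      using col[OF p(1)] A(2)[OF p(1)] p pos[OF p(1)] by (simp add: not_less)
  qed
qed

lemma leads_if_max:
  assumes W: "lex_weight n vs M W"
    and carr: "\<And>b. b \<in> keys f \<Longrightarrow> keys b \<subseteq> {1..n}"
    and deg: "\<And>b. b \<in> keys f \<Longrightarrow> total_degree b < M"
    and a: "a \<in> keys f"
    and mx: "\<And>b. b \<in> keys f \<Longrightarrow> wt W b \<le> wt W a"
  shows "leads W f a"
  unfolding leads_def
proof (intro conjI ballI impI a)
  fix b assume b: "b \<in> keys f" "b \<noteq> a"
  then have "wt W b \<noteq> wt W a"
    using wt_lex_weight_inj[OF W carr[OF b(1)] carr[OF a] deg[OF b(1)] deg[OF a]] by blast
  then show "wt W b < wt W a" using mx[OF b(1)] by simp
qed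

text \<open>The step of both divisions below. The description of the remaining exponents is what shows that degrees
and residues are inherited by \<open>f - h\<close>.\<close>

lemma division_step:
  assumes J: "ideal J (poly_ring n)" and I: "ideal I (poly_ring n)"
    and f: "f \<in> I" and g: "g \<in> I" "g \<in> J"
    and lead: "leads W f a" "leads W g b" and d: "d + b = a" "keys d \<subseteq> {1..n}"
  shows "\<exists>h\<in>J. f - h \<in> I \<and> (\<forall>u\<in>keys (f - h).
    wt W u < wt W a \<and> (u \<in> keys f \<or> (\<exists>v\<in>keys g. u = d + v)))"
proof -
  define g' where "g' = single d 1 * g"
  have lead': "leads W g' a"
    unfolding g'_def d(1)[symmetric] by (rule leads_mult[OF leads_single lead(2)]) simp
  let ?h = "single 0 (lookup f a / lookup g' a) * g'"
  have carr: "single d 1 \<in> carrier (poly_ring n)" "single 0 e \<in> carrier (poly_ring n)" for e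
    using d(2) by (auto intro!: poly_carrier_single)
  have mem: "?h \<in> K" if "ideal K (poly_ring n)" "g \<in> K" for K
    unfolding g'_def by (intro poly_ideal_closed(4)[OF that(1)] that(2) carr)
  show ?thesis
  proof (intro bexI[of _ ?h] conjI ballI)
    show "?h \<in> J" by (rule mem[OF J g(2)])
    have "- 1 * ?h \<in> I"
      by (rule poly_ideal_closed(4)[OF I mem[OF I g(1)]]) (intro poly_carrier_closed)
    then have "f + (- 1 * ?h) \<in> I" by (rule poly_ideal_closed(3)[OF I f])
    then show "f - ?h \<in> I" by simp
    fix u assume u: "u \<in> keys (f - ?h)"
    show "wt W u < wt W a" by (rule leads_cancel[OF lead(1) lead' u])
    have "u \<in> keys f \<or> u \<in> keys g'"
      using u by (auto simp: in_keys_iff lookup_minus lookup_const_mult)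
    then show "u \<in> keys f \<or> (\<exists>v\<in>keys g. u = d + v)"
      using Poly_Mapping.keys_mult[of "single d 1" g] by (auto simp: g'_def)
  qed
qed

text \<open>If all exponents of \<open>f\<close> have residues \<open>\<rho>\<close>, the greedy colouring gives a colour polynomial whose leading
exponent divides that of \<open>f\<close>: an index outside \<open>A\<close> of low colour has its rank raised by one in the
greedy bound, which pays for the extra factor \<open>x_i\<close>, whereas for an index in \<open>A\<close> the residue pays.\<close>

lemma I_residue_class_subset:
  assumes l: "0 < l" and k: "0 < k" "m \<le> k - 1"
    and J: "ideal J (poly_ring n)"
    and gens: "\<And>col. (\<And>i. i \<in> {1..n} \<Longrightarrow> col i < k - 1) \<Longrightarrow> colour_poly l (k - 1 - m) n col \<in> J"
    and f: "f \<in> I_ideal k l m n"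
    and res: "\<And>b i. b \<in> keys f \<Longrightarrow> i \<in> {1..n} \<Longrightarrow> lookup b i mod l = \<rho> i"
  shows "f \<in> J"
proof -
  let ?c = "k - 1 - m"
  define A where "A = {i \<in> {1..n}. \<rho> i \<noteq> 0}"
  have A: "A \<subseteq> {1..n}" by (auto simp: A_def)
  obtain vs where vs: "bij_betw vs {..<n} {1..n}" "\<And>p. p < n \<Longrightarrow> vs p \<in> A \<longleftrightarrow> p < card A"
    using exists_block_order[OF A] by metis
  define M where "M = 2 + (\<Sum>b\<in>keys f. total_degree b)"
  have degf: "total_degree b < M" if "b \<in> keys f" for b
  proof -
    have "total_degree b \<le> (\<Sum>b\<in>keys f. total_degree b)"
      using that by (intro member_le_sum) auto
    then show ?thesis by (simp add: M_def)
  qed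
  obtain W where W: "lex_weight n vs M W"
    using exists_lex_weight[OF vs(1), of M] by (auto simp: M_def)
  have Winj: "inj_on W {1..n}" using lex_weight_inj_on[OF W] .
  define F where "F = {f \<in> I_ideal k l m n. \<forall>b\<in>keys f.
    total_degree b < M \<and> (\<forall>i\<in>{1..n}. lookup b i mod l = \<rho> i)}"
  show ?thesis
  proof (rule lead_reduction[where F = F and J = J and W = W])
    show "f \<in> F" using f res degf by (auto simp: F_def)
    show "0 \<in> J" by (rule poly_ideal_closed(2)[OF J])
    show "p + q \<in> J" if "p \<in> J" "q \<in> J" for p q by (rule poly_ideal_closed(3)[OF J that])
    fix f a assume fF: "f \<in> F" and a: "a \<in> keys f"
      and mx: "\<And>b. b \<in> keys f \<Longrightarrow> wt W b \<le> wt W a"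
    have fI: "f \<in> I_ideal k l m n" and deg: "\<And>b. b \<in> keys f \<Longrightarrow> total_degree b < M"
      and res: "\<And>b i. b \<in> keys f \<Longrightarrow> i \<in> {1..n} \<Longrightarrow> lookup b i mod l = \<rho> i"
      using fF by (auto simp: F_def)
    have res': "\<exists>d. lookup b i = \<rho> i + l * d" if "b \<in> keys f" "i \<in> {1..n}" for b i
      using res[OF that] by (metis mod_mult_div_eq)
    have \<rho>: "\<rho> i = 0" if "i \<in> {1..n}" "i \<notin> A" for i using that by (simp add: A_def)
    obtain col where col: "\<And>i. i \<in> {1..n} \<Longrightarrow> col i < k - 1"
      "\<And>i. i \<in> {1..n} \<Longrightarrow> card {j \<in> {1..n}. col j = col i \<and> W j < W i} + (if i \<notin> A \<and> col i < ?c then 1 else 0)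
        \<le> (lookup a i - \<rho> i) div l"
      using colouring_below_lex_lead[OF fI l k A vs(2) W deg res' \<rho> a mx] by blast
    let ?g = "colour_poly l ?c n col" and ?b = "colour_lead W l ?c n col"
    have lead_g: "leads W ?g ?b" by (rule leads_colour_poly[OF Winj l])
    have bkey: "?b \<in> keys ?g" using lead_g by (simp add: leads_def)
    have gcarr: "keys u \<subseteq> {1..n}" if "u \<in> keys ?g" for u
      using colour_poly_carrier[of l ?c n col] that by (auto simp: carrier_poly_ring)
    have acarr: "keys a \<subseteq> {1..n}" by (rule I_carrier_keys[OF fI a])
    have le: "lookup ?b i \<le> lookup a i" for i
    proof (cases "i \<in> {1..n}")
      case False
      then have "i \<notin> keys ?b" using gcarr[OF bkey] by blast
      then show ?thesis by (simp add: in_keys_iff)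
    next
      case True
      let ?r = "card {j \<in> {1..n}. col j = col i \<and> W j < W i}"
      have lb: "lookup ?b i = (if col i < ?c then 1 else 0) + l * ?r"
        by (rule lookup_colour_lead[OF Winj True])
      have la: "lookup a i = \<rho> i + l * ((lookup a i - \<rho> i) div l)"
        using res'[OF a True] l by auto
      show ?thesis
      proof (cases "i \<in> A")
        case iA: True
        then have "1 \<le> \<rho> i" by (simp add: A_def)
        moreover have "l * ?r \<le> l * ((lookup a i - \<rho> i) div l)"
          using col(2)[OF True] by (intro mult_le_mono2) simp
        ultimately have "(if col i < ?c then 1 else 0) + l * ?r \<le> \<rho> i + l * ((lookup a i - \<rho> i) div l)"
          by (intro add_mono) simp_all
        then show ?thesis unfolding lb using la by simp
      next
        case iA: False
        have "(if col i < ?c then 1 else 0) + l * ?r \<le> l * (?r + (if col i < ?c then 1 else 0))"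
          using l by simp
        also have "\<dots> \<le> l * ((lookup a i - \<rho> i) div l)"
          using col(2)[OF True] iA by (intro mult_le_mono2) simp
        also have "\<dots> \<le> lookup a i" using la by linarith
        finally show ?thesis unfolding lb .
      qed
    qed
    define d where "d = a - ?b"
    have db: "d + ?b = a"
      by (rule poly_mapping_eqI) (use le in \<open>simp add: d_def lookup_add lookup_minus\<close>)
    have dcarr: "keys d \<subseteq> {1..n}"
      using acarr by (auto simp: d_def in_keys_iff lookup_minus)
    have lead_f: "leads W f a"
      by (rule leads_if_max[OF W I_carrier_keys[OF fI] deg a mx])
    have gI: "?g \<in> I_ideal k l m n" by (rule colour_poly_in_I[OF l k(2,1) col(1)])
    obtain h where h: "h \<in> J" "f - h \<in> I_ideal k l m n" and hk: "\<And>b. b \<in> keys (f - h) \<Longrightarrow>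
        wt W b < wt W a \<and> (b \<in> keys f \<or> (\<exists>u\<in>keys ?g. b = d + u))"
      using division_step[OF J I_ideal_ideal fI gI gens[OF col(1)] lead_f lead_g db dcarr] by blast
    have "total_degree b < M \<and> (\<forall>i\<in>{1..n}. lookup b i mod l = \<rho> i)"
      if bk: "b \<in> keys (f - h)" for b
    proof (cases "b \<in> keys f")
      case True
      then show ?thesis using deg res by blast
    next
      case False
      then obtain u where u: "u \<in> keys ?g" "b = d + u" using hk[OF bk] by blast
      have "total_degree u = total_degree ?b"
        using keys_colour_poly_degree[OF u(1)] keys_colour_poly_degree[OF bkey] by simp
      then have "total_degree b = total_degree a" unfolding u(2) db[symmetric] wt_add by simp
      moreover have "lookup b i mod l = \<rho> i" if "i \<in> {1..n}" for i
      proof -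
        have "lookup u i mod l = lookup ?b i mod l"
          using keys_colour_poly_exponents[OF u(1), of i] keys_colour_poly_exponents[OF bkey, of i]
          by (metis mod_mult_self2)
        then have "lookup b i mod l = lookup a i mod l"
          unfolding u(2) db[symmetric] lookup_add by (rule mod_add_cong[OF refl])
        then show ?thesis using res[OF a that] by simp
      qed
      ultimately show ?thesis using deg[OF a] by simp
    qed
    then have "f - h \<in> F" using h(2) by (simp add: F_def)
    then show "\<exists>h\<in>J. f - h \<in> F \<and> (\<forall>b\<in>keys (f - h). wt W b < wt W a)"
      using h(1) hk by blast
  qed
qed

text \<open>The residues are made constant for one variable after the other.\<close>

theorem I_subset_colour_ideal:
  assumes l: "0 < l" and k: "0 < k" "m \<le> k - 1"
    and J: "ideal J (poly_ring n)"
    and gens: "\<And>col. (\<And>i. i \<in> {1..n} \<Longrightarrow> col i < k - 1) \<Longrightarrow> colour_poly l (k - 1 - m) n col \<in> J"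
  shows "I_ideal k l m n \<subseteq> J"
proof -
  have "f \<in> J" if "finite S" "S \<subseteq> {1..n}" "f \<in> I_ideal k l m n"
    "\<forall>i\<in>{1..n} - S. \<exists>r. \<forall>b\<in>keys f. lookup b i mod l = r" for S f
    using that
  proof (induction S arbitrary: f rule: finite_induct)
    case empty
    then have "\<forall>i\<in>{1..n}. \<exists>r. \<forall>b\<in>keys f. lookup b i mod l = r" by simp
    then obtain \<rho> where "\<forall>i\<in>{1..n}. \<forall>b\<in>keys f. lookup b i mod l = \<rho> i"
      by (rule bchoice[THEN exE])
    then show ?case
      by (intro I_residue_class_subset[OF l k J gens empty(2), of \<rho>]) auto
  next
    case (insert i S)
    have i: "i \<in> {1..n}" using insert by blast
    have "residue_part l i r f \<in> J" if "r < l" for r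
    proof (rule insert.IH)
      show "residue_part l i r f \<in> I_ideal k l m n"
        by (rule residue_part_in_I[OF l that i insert.prems(2)])
      show "\<forall>j\<in>{1..n} - S. \<exists>s. \<forall>b\<in>keys (residue_part l i r f). lookup b j mod l = s"
      proof
        fix j assume j: "j \<in> {1..n} - S"
        show "\<exists>s. \<forall>b\<in>keys (residue_part l i r f). lookup b j mod l = s"
        proof (cases "j = i")
          case True
          then show ?thesis by (intro exI[of _ r]) (simp add: keys_residue_part)
        next
          case False
          then obtain s where "\<forall>b\<in>keys f. lookup b j mod l = s"
            using insert.prems(3) j by blast
          then show ?thesis by (intro exI[of _ s]) (simp add: keys_residue_part)
        qed
      qed
    qed (use insert in blast)
    then have "(\<Sum>r<l. residue_part l i r f) \<in> J"
      by (intro poly_ideal_sum[OF J]) simp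
    then show ?case using sum_residue_parts[OF l] by simp
  qed
  from this[of "{1..n}"] show ?thesis by auto
qed

section \<open>Exchange between two Vandermonde products\<close>

definition vandermonde :: "(nat \<Rightarrow> 'a::comm_ring_1) \<Rightarrow> nat set \<Rightarrow> 'a" where
  "vandermonde y A = (\<Prod>(i, j)\<in>{(i, j). i \<in> A \<and> j \<in> A \<and> i < j}. y i - y j)"

text \<open>The sign with which \<open>y a\<close> can be pulled to the front of the Vandermonde product of \<open>A\<close>.\<close>

definition remove_sign :: "nat set \<Rightarrow> nat \<Rightarrow> 'a::comm_ring_1" where
  "remove_sign A a = (- 1) ^ card {b \<in> A. b < a}"

lemma vandermonde_remove:
  assumes "finite A" "a \<in> A"
  shows "vandermonde y A = remove_sign A a * vandermonde y (A - {a}) * (\<Prod>b\<in>A - {a}. y a - y b)"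
proof -
  let ?lo = "{b \<in> A. b < a}" and ?hi = "{b \<in> A. a < b}"
  let ?P = "{(i, j). i \<in> A - {a} \<and> j \<in> A - {a} \<and> i < j}"
  have fin: "finite ?P" by (rule finite_subset[of _ "A \<times> A"]) (use assms in auto)
  have "{(i, j). i \<in> A \<and> j \<in> A \<and> i < j} = ?P \<union> ((\<lambda>b. (b, a)) ` ?lo \<union> (\<lambda>b. (a, b)) ` ?hi)"
    using assms(2) by auto
  then have "vandermonde y A = (\<Prod>(i, j)\<in>?P \<union> ((\<lambda>b. (b, a)) ` ?lo \<union> (\<lambda>b. (a, b)) ` ?hi). y i - y j)"
    by (simp add: vandermonde_def)
  also have "\<dots> = vandermonde y (A - {a}) * (\<Prod>(i, j)\<in>(\<lambda>b. (b, a)) ` ?lo \<union> (\<lambda>b. (a, b)) ` ?hi. y i - y j)"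
    unfolding vandermonde_def by (rule prod.union_disjoint[OF fin]) (use assms in auto)
  also have "(\<Prod>(i, j)\<in>(\<lambda>b. (b, a)) ` ?lo \<union> (\<lambda>b. (a, b)) ` ?hi. y i - y j) =
    (\<Prod>(i, j)\<in>(\<lambda>b. (b, a)) ` ?lo. y i - y j) * (\<Prod>(i, j)\<in>(\<lambda>b. (a, b)) ` ?hi. y i - y j)"
    by (rule prod.union_disjoint) (use assms in auto)
  also have "(\<Prod>(i, j)\<in>(\<lambda>b. (b, a)) ` ?lo. y i - y j) = (\<Prod>b\<in>?lo. - (y a - y b))"
    by (subst prod.reindex) (auto simp: inj_on_def)
  also have "\<dots> = remove_sign A a * (\<Prod>b\<in>?lo. y a - y b)"
    unfolding remove_sign_def by (rule prod_uminus)
  also have "(\<Prod>(i, j)\<in>(\<lambda>b. (a, b)) ` ?hi. y i - y j) = (\<Prod>b\<in>?hi. y a - y b)"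
    by (subst prod.reindex) (auto simp: inj_on_def)
  also have "remove_sign A a * (\<Prod>b\<in>?lo. y a - y b) * (\<Prod>b\<in>?hi. y a - y b) =
      remove_sign A a * (\<Prod>b\<in>?lo \<union> ?hi. y a - y b)"
    by (subst prod.union_disjoint) (use assms in \<open>auto simp: mult.assoc\<close>)
  also have "?lo \<union> ?hi = A - {a}" by auto
  finally show ?thesis by (simp only: mult_ac)
qed

lemma remove_sign_square: "remove_sign A a * remove_sign A a = 1"
  by (simp add: remove_sign_def flip: power_mult_distrib)

text \<open>Lagrange interpolation without denominators: both sides of the interpolation formula for \<open>h\<close> at the
points \<open>y a\<close>, multiplied by the Vandermonde product, are polynomials of degree below \<open>card A\<close> which agree at
all these points; compare the coefficients of degree \<open>card A - 1\<close>.\<close>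

lemma vandermonde_lagrange:
  fixes y :: "nat \<Rightarrow> 'a::idom"
  assumes A: "finite A" "A \<noteq> {}" and inj: "inj_on y A" and deg: "degree h < card A"
  shows "(\<Sum>a\<in>A. remove_sign A a * poly h (y a) * vandermonde y (A - {a})) =
    coeff h (card A - 1) * vandermonde y A"
proof -
  define L where "L a = (\<Prod>b\<in>A - {a}. [:- y b, 1:])" for a
  define P where "P = (\<Sum>a\<in>A. smult (remove_sign A a * poly h (y a) * vandermonde y (A - {a})) (L a))"
  have cA: "card (A - {a}) = card A - 1" if "a \<in> A" for a using A that by simp
  have degL: "degree (L a) = card A - 1" if "a \<in> A" for a
    unfolding L_def by (subst degree_prod_sum_eq) (use cA[OF that] in auto)
  have leadL: "coeff (L a) (card A - 1) = 1" if "a \<in> A" for a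
  proof -
    have "lead_coeff (L a) = 1" unfolding L_def lead_coeff_prod by simp
    then show ?thesis using degL[OF that] by simp
  qed
  have "degree P \<le> card A - 1"
    unfolding P_def
  proof (rule degree_sum_le[OF A(1)])
    fix a assume "a \<in> A"
    then show "degree (smult (remove_sign A a * poly h (y a) * vandermonde y (A - {a})) (L a)) \<le> card A - 1"
      using degree_smult_le[of _ "L a"] degL by metis
  qed
  moreover have "0 < card A" using A by (simp add: card_gt_0_iff)
  ultimately have degP: "degree P < card A" by linarith
  have eval: "poly P (y b) = poly (smult (vandermonde y A) h) (y b)" if b: "b \<in> A" for b
  proof -
    have "poly (L a) (y b) = (if a = b then (\<Prod>c\<in>A - {b}. y b - y c) else 0)" if "a \<in> A" for a
    proof (cases "a = b")
      case True
      then show ?thesis by (simp add: L_def poly_prod)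
    next
      case False
      have "(\<Prod>c\<in>A - {a}. y b - y c) = 0"
        by (rule prod_zero) (use A b False in \<open>auto intro!: bexI[of _ b]\<close>)
      then show ?thesis using False by (simp add: L_def poly_prod)
    qed
    then have "poly P (y b) = (\<Sum>a\<in>A. if a = b then remove_sign A b * poly h (y b) * vandermonde y (A - {b}) *
        (\<Prod>c\<in>A - {b}. y b - y c) else 0)"
      unfolding P_def poly_sum poly_smult by (intro sum.cong) auto
    also have "\<dots> = poly h (y b) * (remove_sign A b * vandermonde y (A - {b}) * (\<Prod>c\<in>A - {b}. y b - y c))"
      using A(1) b by (simp add: mult_ac)
    also have "\<dots> = poly h (y b) * vandermonde y A"
      using vandermonde_remove[OF A(1) b, of y] by simp
    finally show ?thesis by (simp add: mult.commute)
  qed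
  have cy: "card (y ` A) = card A" by (rule card_image[OF inj])
  have "P = smult (vandermonde y A) h"
  proof (rule poly_eqI_degree[of "y ` A"])
    show "poly P x = poly (smult (vandermonde y A) h) x" if "x \<in> y ` A" for x using eval that by auto
    show "degree (smult (vandermonde y A) h) < card (y ` A)"
      using degree_smult_le[of "vandermonde y A" h] deg cy by simp
  qed (use degP cy in simp)
  then have "coeff P (card A - 1) = coeff (smult (vandermonde y A) h) (card A - 1)" by simp
  moreover have "coeff P (card A - 1) = (\<Sum>a\<in>A. remove_sign A a * poly h (y a) * vandermonde y (A - {a}))"
    unfolding P_def coeff_sum coeff_smult by (rule sum.cong[OF refl]) (simp only: leadL mult_1_right)
  ultimately show ?thesis by (simp add: mult.commute)
qed

text \<open>Interpolate the monic polynomial \<open>X ^ e * (\<Prod>b\<in>B. X - y b)\<close>, whose degree is \<open>card A - 1\<close>. The value of the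
product at \<open>y a\<close> turns the Vandermonde product of \<open>B\<close> into that of \<open>insert a B\<close>.\<close>

lemma vandermonde_exchange:
  fixes y :: "nat \<Rightarrow> 'a::idom"
  assumes A: "finite A" and B: "finite B" "A \<inter> B = {}" and inj: "inj_on y A" and e: "card A = Suc (card B + e)"
  shows "vandermonde y A * vandermonde y B =
    (\<Sum>a\<in>A. remove_sign A a * remove_sign (insert a B) a * y a ^ e *
       (vandermonde y (A - {a}) * vandermonde y (insert a B)))"
proof -
  define h where "h = (\<Prod>b\<in>B. [:- y b, 1:]) * monom 1 e"
  have ne: "A \<noteq> {}" using e by auto
  have degB: "degree (\<Prod>b\<in>B. [:- y b, 1:]) = card B"
    by (subst degree_prod_sum_eq) auto
  have degM: "degree (monom (1::'a) e) = e" by (rule degree_monom_eq) simp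
  have lead: "lead_coeff h = 1"
    unfolding h_def lead_coeff_mult lead_coeff_prod by (simp add: degM)
  have "(\<Prod>b\<in>B. [:- y b, 1:]) \<noteq> 0" using B(1) by simp
  then have "degree h = card B + e"
    unfolding h_def by (subst degree_mult_eq) (simp_all only: degB degM monom_eq_0_iff one_neq_zero not_False_eq_True)
  then have degh: "degree h = card A - 1" using e by simp
  have "vandermonde y A = (\<Sum>a\<in>A. remove_sign A a * poly h (y a) * vandermonde y (A - {a}))"
    using vandermonde_lagrange[OF A ne inj, of h] degh lead e by simp
  then have "vandermonde y A * vandermonde y B =
      (\<Sum>a\<in>A. remove_sign A a * poly h (y a) * vandermonde y (A - {a})) * vandermonde y B" by simp
  also have "\<dots> = (\<Sum>a\<in>A. remove_sign A a * remove_sign (insert a B) a * y a ^ e *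
       (vandermonde y (A - {a}) * vandermonde y (insert a B)))"
    unfolding sum_distrib_right
  proof (rule sum.cong[OF refl])
    fix a assume a: "a \<in> A"
    then have aB: "insert a B - {a} = B" using B(2) by auto
    have ph: "poly h (y a) = (\<Prod>b\<in>B. y a - y b) * y a ^ e"
      by (simp add: h_def poly_prod poly_monom)
    have "vandermonde y (insert a B) = remove_sign (insert a B) a * vandermonde y B * (\<Prod>b\<in>B. y a - y b)"
      using vandermonde_remove[of "insert a B" a y] B(1) aB by simp
    then have "remove_sign (insert a B) a * vandermonde y (insert a B) =
        (remove_sign (insert a B) a * remove_sign (insert a B) a) * (vandermonde y B * (\<Prod>b\<in>B. y a - y b))"
      by (simp only: mult_ac)
    also have "\<dots> = vandermonde y B * (\<Prod>b\<in>B. y a - y b)"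
      by (simp only: remove_sign_square mult_1)
    finally have ins: "remove_sign (insert a B) a * vandermonde y (insert a B) = vandermonde y B * (\<Prod>b\<in>B. y a - y b)" .
    have "remove_sign A a * poly h (y a) * vandermonde y (A - {a}) * vandermonde y B =
      remove_sign A a * y a ^ e * vandermonde y (A - {a}) * (vandermonde y B * (\<Prod>b\<in>B. y a - y b))"
      unfolding ph by (simp only: mult_ac)
    also have "\<dots> = remove_sign A a * y a ^ e * vandermonde y (A - {a}) *
        (remove_sign (insert a B) a * vandermonde y (insert a B))"
      unfolding ins ..
    also have "\<dots> = remove_sign A a * remove_sign (insert a B) a * y a ^ e *
       (vandermonde y (A - {a}) * vandermonde y (insert a B))" by (simp only: mult_ac)
    finally show "remove_sign A a * poly h (y a) * vandermonde y (A - {a}) * vandermonde y B =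
      remove_sign A a * remove_sign (insert a B) a * y a ^ e *
       (vandermonde y (A - {a}) * vandermonde y (insert a B))" .
  qed
  finally show ?thesis .
qed

definition colour_class :: "nat \<Rightarrow> (nat \<Rightarrow> nat) \<Rightarrow> nat \<Rightarrow> nat set" where
  "colour_class n col w = {i \<in> {1..n}. col i = w}"

lemma finite_colour_class [simp]: "finite (colour_class n col w)"
  by (simp add: colour_class_def)

lemma colour_poly_two_classes:
  assumes "u \<noteq> v"
  shows "colour_poly l c n col = (\<Prod>i\<in>{i \<in> {1..n}. col i < c}. Var i) *
    (vandermonde (\<lambda>i. Var i ^ l) (colour_class n col u) * vandermonde (\<lambda>i. Var i ^ l) (colour_class n col v) *
     (\<Prod>(i, j)\<in>{(i, j) \<in> colour_pairs n col. col i \<noteq> u \<and> col i \<noteq> v}. Var i ^ l - Var j ^ l))"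
proof -
  let ?U = "\<lambda>w. {(i, j). i \<in> colour_class n col w \<and> j \<in> colour_class n col w \<and> i < j}"
  let ?R = "{(i, j) \<in> colour_pairs n col. col i \<noteq> u \<and> col i \<noteq> v}"
  have fU: "finite (?U w)" for w by (rule finite_subset[of _ "{1..n} \<times> {1..n}"]) (auto simp: colour_class_def)
  have fR: "finite ?R" by (rule finite_subset[OF _ finite_colour_pairs[of n col]]) auto
  have "colour_pairs n col = ?U u \<union> ?U v \<union> ?R"
    by (auto simp: colour_pairs_def colour_class_def)
  then have "(\<Prod>(i, j)\<in>colour_pairs n col. Var i ^ l - Var j ^ l) = (\<Prod>(i, j)\<in>?U u \<union> ?U v \<union> ?R. Var i ^ l - Var j ^ l)"
    by simp
  also have "\<dots> = (\<Prod>(i, j)\<in>?U u \<union> ?U v. Var i ^ l - Var j ^ l) * (\<Prod>(i, j)\<in>?R. Var i ^ l - Var j ^ l)"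
    by (rule prod.union_disjoint) (use fU fR in \<open>auto simp: colour_class_def\<close>)
  also have "(\<Prod>(i, j)\<in>?U u \<union> ?U v. Var i ^ l - Var j ^ l) =
      (\<Prod>(i, j)\<in>?U u. Var i ^ l - Var j ^ l) * (\<Prod>(i, j)\<in>?U v. Var i ^ l - Var j ^ l)"
    by (rule prod.union_disjoint) (use fU assms in \<open>auto simp: colour_class_def\<close>)
  finally show ?thesis by (simp add: colour_poly_def vandermonde_def)
qed

lemma inj_Var_power: "0 < l \<Longrightarrow> inj_on (\<lambda>i. Var i ^ l) S"
proof (rule inj_onI)
  fix i j assume l: "0 < l" and "Var i ^ l = Var j ^ l"
  then have "single i l = single j l"
    unfolding Var_power by (metis keys_single singleton_inject zero_neq_one)
  then have "keys (single i l) = keys (single j l)" by simp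
  then show "i = j" using l by simp
qed

text \<open>The exchange identity for two colour classes. If the target colour \<open>v\<close> is low and \<open>u\<close> is not, each
summand must also supply the new factor \<open>x_a\<close>; it is taken out of \<open>y_a ^ e\<close>, which needs \<open>e \<ge> 1\<close> and
hence one more element in the class of \<open>u\<close>.\<close>

lemma colour_poly_recolour:
  assumes l: "0 < l" and uv: "u \<noteq> v"
    and size: "card (colour_class n col v) < card (colour_class n col u)"
    and size2: "v < c \<Longrightarrow> c \<le> u \<Longrightarrow> card (colour_class n col v) + 2 \<le> card (colour_class n col u)"
    and J: "ideal J (poly_ring n)"
    and mem: "\<And>a. a \<in> colour_class n col u \<Longrightarrow> colour_poly l c n (col(a := v)) \<in> J"
  shows "colour_poly l c n col \<in> J"
proof -
  let ?y = "\<lambda>i. Var i ^ l"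
  let ?A = "colour_class n col u" and ?B = "colour_class n col v"
  let ?X = "\<lambda>col. \<Prod>i\<in>{i \<in> {1..n}. col i < c}. Var i"
  let ?R = "\<lambda>col. \<Prod>(i, j)\<in>{(i, j) \<in> colour_pairs n col. col i \<noteq> u \<and> col i \<noteq> v}. Var i ^ l - Var j ^ l"
  obtain e where e: "card ?A = Suc (card ?B + e)" using size by (metis less_imp_Suc_add)
  define s :: "nat \<Rightarrow> cpoly" where "s a = remove_sign ?A a * remove_sign (insert a ?B) a" for a
  have AB: "?A \<inter> ?B = {}" using uv by (auto simp: colour_class_def)
  have sc: "s a \<in> carrier (poly_ring n)" for a
  proof -
    have "- 1 \<in> carrier (poly_ring n)" by (intro poly_carrier_closed(5) poly_carrier_closed(2))
    then show ?thesis unfolding s_def remove_sign_def by (intro poly_carrier_closed(4) poly_carrier_power)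
  qed
  have summand: "\<exists>r\<in>carrier (poly_ring n). ?X col * (s a * ?y a ^ e) *
      (vandermonde ?y (?A - {a}) * vandermonde ?y (insert a ?B) * ?R col) = r * colour_poly l c n (col(a := v))"
    if a: "a \<in> ?A" for a
  proof -
    let ?col = "col(a := v)"
    have an: "a \<in> {1..n}" "col a = u" using a by (auto simp: colour_class_def)
    have cls: "colour_class n ?col u = ?A - {a}" "colour_class n ?col v = insert a ?B"
      using an uv by (auto simp: colour_class_def)
    have "{(i, j) \<in> colour_pairs n ?col. ?col i \<noteq> u \<and> ?col i \<noteq> v} = {(i, j) \<in> colour_pairs n col. col i \<noteq> u \<and> col i \<noteq> v}"
      using an by (auto simp: colour_pairs_def split: if_splits)
    then have cp: "colour_poly l c n ?col =
        ?X ?col * (vandermonde ?y (?A - {a}) * vandermonde ?y (insert a ?B) * ?R col)"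
      using colour_poly_two_classes[OF uv, of l c n ?col] cls by simp
    have vc: "Var a \<in> carrier (poly_ring n)" by (rule poly_carrier_Var[OF an(1)])
    have "\<exists>r\<in>carrier (poly_ring n). ?X col * (s a * ?y a ^ e) = r * ?X ?col"
    proof -
      let ?S = "{i \<in> {1..n}. col i < c}" and ?S' = "{i \<in> {1..n}. ?col i < c}"
      consider (same) "u < c \<longleftrightarrow> v < c" | (out) "u < c" "\<not> v < c" | (into) "\<not> u < c" "v < c" by blast
      then show ?thesis
      proof cases
        case same
        then have "?S' = ?S" using an by (auto split: if_splits)
        then show ?thesis
          by (intro bexI[of _ "s a * ?y a ^ e"] poly_carrier_closed(4) sc poly_carrier_power vc) (simp add: mult.commute)
      next
        case out
        then have "?S = insert a ?S'" "a \<notin> ?S'" using an by (auto split: if_splits)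
        then have "?X col = Var a * ?X ?col" by simp
        then have "?X col * (s a * ?y a ^ e) = (s a * ?y a ^ e * Var a) * ?X ?col"
          by (simp only: mult_ac)
        then show ?thesis
          by (intro bexI[of _ "s a * ?y a ^ e * Var a"] poly_carrier_closed(4) sc poly_carrier_power vc)
      next
        case into
        then have "?S' = insert a ?S" "a \<notin> ?S" using an by (auto split: if_splits)
        then have X: "?X ?col = Var a * ?X col" by simp
        have "1 \<le> e" using size2 into e by simp
        then have "?y a ^ e = Var a * (Var a ^ (l - 1) * ?y a ^ (e - 1))"
          using l by (cases e; cases l) (simp_all add: mult_ac)
        then have "?X col * (s a * ?y a ^ e) = (s a * (Var a ^ (l - 1) * ?y a ^ (e - 1))) * ?X ?col"
          unfolding X by (simp only: mult_ac)
        then show ?thesis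
          by (intro bexI[of _ "s a * (Var a ^ (l - 1) * ?y a ^ (e - 1))"] poly_carrier_closed(4) sc poly_carrier_power vc)
      qed
    qed
    then obtain r where r: "r \<in> carrier (poly_ring n)" "?X col * (s a * ?y a ^ e) = r * ?X ?col" by blast
    show ?thesis
      by (rule bexI[OF _ r(1)]) (simp only: r(2) cp mult.assoc)
  qed
  have "colour_poly l c n col = ?X col * (vandermonde ?y ?A * vandermonde ?y ?B * ?R col)"
    by (rule colour_poly_two_classes[OF uv])
  also have "vandermonde ?y ?A * vandermonde ?y ?B =
      (\<Sum>a\<in>?A. remove_sign ?A a * remove_sign (insert a ?B) a * ?y a ^ e *
       (vandermonde ?y (?A - {a}) * vandermonde ?y (insert a ?B)))"
    by (rule vandermonde_exchange[OF _ _ AB inj_Var_power[OF l] e]) simp_all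
  also have "?X col * ((\<Sum>a\<in>?A. remove_sign ?A a * remove_sign (insert a ?B) a * ?y a ^ e *
       (vandermonde ?y (?A - {a}) * vandermonde ?y (insert a ?B))) * ?R col) =
    (\<Sum>a\<in>?A. ?X col * (s a * ?y a ^ e) *
      (vandermonde ?y (?A - {a}) * vandermonde ?y (insert a ?B) * ?R col))"
    unfolding s_def
    by (subst sum_distrib_right, subst sum_distrib_left) (rule sum.cong[OF refl], simp only: mult.assoc)
  also have "\<dots> \<in> J"
  proof (rule poly_ideal_sum[OF J])
    fix a assume a: "a \<in> ?A"
    obtain r where "r \<in> carrier (poly_ring n)" "?X col * (s a * ?y a ^ e) *
      (vandermonde ?y (?A - {a}) * vandermonde ?y (insert a ?B) * ?R col) = r * colour_poly l c n (col(a := v))"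
      using summand[OF a] by blast
    then show "?X col * (s a * ?y a ^ e) *
      (vandermonde ?y (?A - {a}) * vandermonde ?y (insert a ?B) * ?R col) \<in> J"
      by (simp only: poly_ideal_closed(4)[OF J mem[OF a]])
  qed
  finally show ?thesis .
qed

section \<open>Balanced colourings\<close>

text \<open>The class sizes of a colouring by the columns of \<open>\<lambda>\<^sup>1\<close> and \<open>\<lambda>\<^sup>0\<close>, up to permutation within each
component. Equivalently, no exchange lowers the imbalance defined next.\<close>

definition balanced :: "nat \<Rightarrow> nat \<Rightarrow> nat \<Rightarrow> (nat \<Rightarrow> nat) \<Rightarrow> bool" where
  "balanced N c n col \<longleftrightarrow> (\<forall>u<N. \<forall>v<N.
     card (colour_class n col u) \<le> Suc (card (colour_class n col v)) \<and>
     (u < c \<and> c \<le> v \<longrightarrow> card (colour_class n col u) \<le> card (colour_class n col v)))"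

text \<open>Up to a constant, the degree of the colour polynomial for \<open>l = 2\<close>. For \<open>l = 2\<close> an exchange
strictly lowers the degree whenever a colouring is not balanced, so this quantity serves as termination
measure for every \<open>l\<close>.\<close>

definition imbalance :: "nat \<Rightarrow> nat \<Rightarrow> nat \<Rightarrow> (nat \<Rightarrow> nat) \<Rightarrow> nat" where
  "imbalance N c n col = (\<Sum>w<N. card (colour_class n col w) * (card (colour_class n col w) + (if w < c then 1 else 0)))"

lemma recolour_imbalance:
  assumes u: "u < N" and v: "v < N"
    and ex: "Suc (card (colour_class n col v)) < card (colour_class n col u) \<or>
      u < c \<and> c \<le> v \<and> card (colour_class n col v) < card (colour_class n col u)"
    and a: "a \<in> colour_class n col u"
  shows "imbalance N c n (col(a := v)) < imbalance N c n col"
proof -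
  let ?s = "\<lambda>w. card (colour_class n col w)" and ?t = "\<lambda>w. card (colour_class n (col(a := v)) w)"
  let ?g = "\<lambda>w x. x * (x + (if w < c then 1 else (0::nat)))"
  have uv: "u \<noteq> v" using ex by auto
  have an: "a \<in> {1..n}" "col a = u" using a by (auto simp: colour_class_def)
  have cu: "colour_class n (col(a := v)) u = colour_class n col u - {a}"
    and cv: "colour_class n (col(a := v)) v = insert a (colour_class n col v)"
    using an uv by (auto simp: colour_class_def)
  have av: "a \<notin> colour_class n col v" using an uv by (auto simp: colour_class_def)
  have tu: "Suc (?t u) = ?s u" unfolding cu using card_Suc_Diff1[OF _ a] by simp
  have tv: "?t v = Suc (?s v)" unfolding cv using av by simp
  have tw: "?t w = ?s w" if "w \<noteq> u" "w \<noteq> v" for w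
  proof -
    have "colour_class n (col(a := v)) w = colour_class n col w"
      using an that by (auto simp: colour_class_def)
    then show ?thesis by simp
  qed
  have split: "(\<Sum>w<N. f w) = f u + f v + (\<Sum>w\<in>{..<N} - {u} - {v}. f w)" for f :: "nat \<Rightarrow> nat"
    using u v uv by (subst sum.remove[of _ u], simp, simp, subst sum.remove[of _ v]) auto
  have rest: "(\<Sum>w\<in>{..<N} - {u} - {v}. ?g w (?t w)) = (\<Sum>w\<in>{..<N} - {u} - {v}. ?g w (?s w))"
    by (rule sum.cong) (simp_all add: tw)
  obtain x where x: "?s u = Suc x" "?t u = x" using tu by metis
  have "?g u x + ?g v (Suc (?s v)) < ?g u (Suc x) + ?g v (?s v)"
    using ex x(1) by (auto simp: algebra_simps)
  then show ?thesis
    unfolding imbalance_def split rest using x tv by simp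
qed

lemma recolour_valid: "(\<And>i. i \<in> {1..n} \<Longrightarrow> col i < N) \<Longrightarrow> v < N \<Longrightarrow> i \<in> {1..n} \<Longrightarrow> (col(a := v)) i < N"
  by simp

lemma not_balanced_exchange:
  assumes "\<not> balanced N c n col"
  obtains u v where "u < N" "v < N" "Suc (card (colour_class n col v)) < card (colour_class n col u) \<or>
      u < c \<and> c \<le> v \<and> card (colour_class n col v) < card (colour_class n col u)"
  using assms unfolding balanced_def by (auto simp: not_le)

theorem colour_ideal_subset_balanced:
  assumes l: "0 < l" and J: "ideal J (poly_ring n)"
    and gens: "\<And>col. (\<And>i. i \<in> {1..n} \<Longrightarrow> col i < N) \<Longrightarrow> balanced N c n col \<Longrightarrow> colour_poly l c n col \<in> J"
    and col: "\<And>i. i \<in> {1..n} \<Longrightarrow> col i < N"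
  shows "colour_poly l c n col \<in> J"
  using col
proof (induction "imbalance N c n col" arbitrary: col rule: less_induct)
  case less
  show ?case
  proof (cases "balanced N c n col")
    case False
    then obtain u v where uv: "u < N" "v < N" and ex: "Suc (card (colour_class n col v)) < card (colour_class n col u) \<or>
      u < c \<and> c \<le> v \<and> card (colour_class n col v) < card (colour_class n col u)"
      by (rule not_balanced_exchange)
    show ?thesis
    proof (rule colour_poly_recolour[OF l _ _ _ J, of u v])
      fix a assume a: "a \<in> colour_class n col u"
      have val: "\<And>i. i \<in> {1..n} \<Longrightarrow> (col(a := v)) i < N" by (rule recolour_valid[OF less.prems uv(2)])
      show "colour_poly l c n (col(a := v)) \<in> J"
        by (rule less.hyps[OF recolour_imbalance[OF uv ex a] val])
    qed (use ex in auto)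
  qed (use gens less.prems in blast)
qed

text \<open>Together with the fact that all balanced colourings have the same imbalance, this shows that balanced
colourings are exactly those of minimal imbalance.\<close>

lemma exists_balanced_le:
  assumes "\<And>i. i \<in> {1..n} \<Longrightarrow> col i < N"
  shows "\<exists>col'. (\<forall>i\<in>{1..n}. col' i < N) \<and> balanced N c n col' \<and> imbalance N c n col' \<le> imbalance N c n col \<and>
    (\<not> balanced N c n col \<longrightarrow> imbalance N c n col' < imbalance N c n col)"
  using assms
proof (induction "imbalance N c n col" arbitrary: col rule: less_induct)
  case less
  show ?case
  proof (cases "balanced N c n col")
    case True
    then show ?thesis using less.prems by (intro exI[of _ col]) simp
  next
    case False
    then obtain u v where uv: "u < N" "v < N" and ex: "Suc (card (colour_class n col v)) < card (colour_class n col u) \<or>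
      u < c \<and> c \<le> v \<and> card (colour_class n col v) < card (colour_class n col u)"
      by (rule not_balanced_exchange)
    then have "card (colour_class n col u) \<noteq> 0" by auto
    then obtain a where a: "a \<in> colour_class n col u" by fastforce
    have lt: "imbalance N c n (col(a := v)) < imbalance N c n col" by (rule recolour_imbalance[OF uv ex a])
    have val: "\<And>i. i \<in> {1..n} \<Longrightarrow> (col(a := v)) i < N" by (rule recolour_valid[OF less.prems uv(2)])
    obtain col' where "\<forall>i\<in>{1..n}. col' i < N" "balanced N c n col'"
      "imbalance N c n col' \<le> imbalance N c n (col(a := v))"
      using less.hyps[OF lt val] by blast
    then show ?thesis using lt by (intro exI[of _ col']) simp
  qed
qed

section \<open>Tableaux as colourings\<close>

text \<open>Row lengths of the whole partition, numbered from \<open>0\<close> and continued by zero.\<close>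

definition whole_row :: "nat \<Rightarrow> nat \<Rightarrow> nat \<Rightarrow> nat" where
  "whole_row N n i = (if i < n div N then N else if i = n div N then n mod N else 0)"

text \<open>For sizes \<open>s\<close> as in a balanced colouring, \<open>n\<close> determines the common value \<open>n div N\<close> and the number
\<open>n mod N\<close> of classes with one more element, and the larger classes go to the high colours first. So
the conjugate of the sizes is the partition cut after column \<open>N - c\<close>.\<close>

lemma two_level_counts:
  fixes s :: "nat \<Rightarrow> nat"
  assumes N: "0 < N" and c: "c \<le> N" and sum: "(\<Sum>w<N. s w) = n"
    and near: "\<And>u v. u < N \<Longrightarrow> v < N \<Longrightarrow> s u \<le> Suc (s v)"
    and lowhigh: "\<And>u v. u < c \<Longrightarrow> c \<le> v \<Longrightarrow> v < N \<Longrightarrow> s u \<le> s v"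
  shows "card {w. w < N \<and> w < c \<and> i < s w} = whole_row N n i - (N - c)"
    and "card {w. w < N \<and> \<not> w < c \<and> i < s w} = min (whole_row N n i) (N - c)"
proof -
  define q where "q = Min (s ` {..<N})"
  have ne: "s ` {..<N} \<noteq> {}" using N by auto
  obtain w0 where w0: "w0 < N" "s w0 = q" using Min_in[OF _ ne] by (auto simp: q_def)
  have val: "s w = q \<or> s w = Suc q" if "w < N" for w
  proof -
    have "q \<le> s w" unfolding q_def by (rule Min_le) (use that in auto)
    moreover have "s w \<le> Suc q" using near[OF that w0(1)] w0(2) by simp
    ultimately show ?thesis by linarith
  qed
  define r where "r = card {w. w < N \<and> q < s w}"
  have "r < N"
  proof -
    have "{w. w < N \<and> q < s w} \<subset> {..<N}" using w0 by auto
    then have "r < card {..<N}" unfolding r_def by (rule psubset_card_mono[OF finite_lessThan])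
    then show ?thesis by simp
  qed
  have "n = (\<Sum>w<N. q + (if q < s w then 1 else 0))"
    unfolding sum[symmetric] by (rule sum.cong[OF refl]) (use val in fastforce)
  also have "\<dots> = N * q + card {w \<in> {..<N}. q < s w}"
    by (simp add: sum.distrib sum.inter_filter[symmetric])
  also have "{w \<in> {..<N}. q < s w} = {w. w < N \<and> q < s w}" by auto
  finally have n: "n = N * q + r" by (simp add: r_def)
  have qr: "n div N = q" "n mod N = r" using n \<open>r < N\<close> by auto
  let ?L = "{w. w < N \<and> w < c \<and> i < s w}" and ?U = "{w. w < N \<and> \<not> w < c \<and> i < s w}"
  have cL: "card {w. w < N \<and> w < c} = c"
  proof -
    have "{w. w < N \<and> w < c} = {..<c}" using c by auto
    then show ?thesis by simp
  qed
  have cU: "card {w. w < N \<and> \<not> w < c} = N - c"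
  proof -
    have "{w. w < N \<and> \<not> w < c} = {c..<N}" by auto
    then show ?thesis by simp
  qed
  consider "i < q" | "i = q" | "q < i" by linarith
  then have "card ?L = whole_row N n i - (N - c) \<and> card ?U = min (whole_row N n i) (N - c)"
  proof cases
    case 1
    then have "?L = {w. w < N \<and> w < c}" "?U = {w. w < N \<and> \<not> w < c}" using val by force+
    then show ?thesis using 1 cL cU c by (simp add: whole_row_def qr)
  next
    case 3
    then have "?L = {}" "?U = {}" using val by force+
    then show ?thesis using 3 by (simp add: whole_row_def qr)
  next
    case 2
    have fin: "finite ?L" "finite ?U" by auto
    have "{w. w < N \<and> q < s w} = ?L \<union> ?U" using 2 by auto
    then have r: "r = card ?L + card ?U" unfolding r_def by (simp add: card_Un_disjoint disjoint_iff fin)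
    show ?thesis
    proof (cases "?L = {}")
      case True
      have "card ?U \<le> card {w. w < N \<and> \<not> w < c}" by (rule card_mono) auto
      then have "card ?U \<le> N - c" using cU by simp
      moreover have "card ?L = 0" by (simp only: True card.empty)
      moreover have "whole_row N n i = r" using 2 by (simp add: whole_row_def qr)
      ultimately show ?thesis using r by arith
    next
      case False
      then obtain u where u: "u < c" "q < s u" using 2 by auto
      have "?U = {w. w < N \<and> \<not> w < c}"
        using lowhigh[OF u(1)] u(2) 2 by (auto simp: not_less intro: less_le_trans)
      then have "card ?U = N - c" using cU by simp
      then show ?thesis using r 2 by (simp add: whole_row_def qr)
    qed
  qed
  then show "card ?L = whole_row N n i - (N - c)" "card ?U = min (whole_row N n i) (N - c)" by auto
qed

definition row_length :: "nat \<Rightarrow> nat \<Rightarrow> nat \<Rightarrow> nat \<Rightarrow> nat \<Rightarrow> nat" where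
  "row_length k m n e i =
    (if e = 0 then min (whole_row (k - 1) n i) m else whole_row (k - 1) n i - m)"

lemma whole_partition_nth:
  "i < length (whole_partition k n) \<Longrightarrow> whole_partition k n ! i = whole_row (k - 1) n i"
  by (auto simp: whole_partition_def whole_row_def nth_append)

lemma mem_boxes:
  "(e, i, j) \<in> boxes (lambda0 k m n, lambda1 k m n) \<longleftrightarrow>
    (e = 0 \<or> e = 1) \<and> 1 \<le> i \<and> 1 \<le> j \<and> j \<le> row_length k m n e (i - 1)"
proof -
  have len: "i \<le> length (whole_partition k n)" if "1 \<le> j" "j \<le> row_length k m n e (i - 1)"
    using that by (auto simp: whole_partition_def row_length_def whole_row_def split: if_splits)
  show ?thesis
  proof (cases "1 \<le> i \<and> i \<le> length (whole_partition k n)")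
    case True
    then have "whole_partition k n ! (i - 1) = whole_row (k - 1) n (i - 1)"
      by (intro whole_partition_nth) linarith
    then show ?thesis using True
      by (auto simp: boxes_def diagram_def lambda0_def lambda1_def row_length_def)
  next
    case False
    then show ?thesis using len
      by (auto simp: boxes_def diagram_def lambda0_def lambda1_def)
  qed
qed

lemma row_length_antimono: "i \<le> i' \<Longrightarrow> row_length k m n e i' \<le> row_length k m n e i"
proof -
  assume "i \<le> i'"
  have "n mod (k - 1) \<le> k - 1 \<or> k - 1 = 0" by (metis less_imp_le mod_less_divisor neq0_conv)
  then have "whole_row (k - 1) n i' \<le> whole_row (k - 1) n i"
    using \<open>i \<le> i'\<close> by (auto simp: whole_row_def)
  then show ?thesis by (auto simp: row_length_def)
qed

lemma row_length_le:
  assumes "0 < k - 1" "m \<le> k - 1"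
  shows "row_length k m n 0 i \<le> m" "row_length k m n 1 i \<le> k - 1 - m"
proof -
  have "n mod (k - 1) < k - 1" using assms by simp
  then have "whole_row (k - 1) n i \<le> k - 1" by (auto simp: whole_row_def)
  then show "row_length k m n 0 i \<le> m" "row_length k m n 1 i \<le> k - 1 - m"
    by (auto simp: row_length_def)
qed

text \<open>Columns of \<open>\<lambda>\<^sup>1\<close> (tag \<open>1\<close>) get the colours below \<open>c\<close>, columns of \<open>\<lambda>\<^sup>0\<close> the colours from \<open>c\<close> on.\<close>

definition column_colour :: "nat \<Rightarrow> nat \<times> nat \<times> nat \<Rightarrow> nat" where
  "column_colour c b = (case b of (e, i, j) \<Rightarrow> (j - 1) + (if e = 0 then c else 0))"

definition tableau_colouring :: "nat \<Rightarrow> nat list \<times> nat list \<Rightarrow> (nat \<times> nat \<times> nat \<Rightarrow> nat) \<Rightarrow> nat \<Rightarrow> nat" where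
  "tableau_colouring c \<Lambda> T x = column_colour c (inv_into (boxes \<Lambda>) T x)"

lemma tableau_colouring_box:
  assumes "bij_betw T (boxes \<Lambda>) {1..n}" "b \<in> boxes \<Lambda>"
  shows "tableau_colouring c \<Lambda> T (T b) = column_colour c b"
  using assms by (simp add: tableau_colouring_def bij_betw_def)

lemma column_colour_less:
  assumes "0 < k - 1" "m \<le> k - 1" "(e, i, j) \<in> boxes (lambda0 k m n, lambda1 k m n)"
  shows "column_colour (k - 1 - m) (e, i, j) < k - 1"
    and "column_colour (k - 1 - m) (e, i, j) < k - 1 - m \<longleftrightarrow> e = 1"
  using assms(3) row_length_le[OF assms(1,2), of n "i - 1"] assms(1,2)
  by (auto simp: mem_boxes column_colour_def)

lemma column_colour_eq:
  assumes "0 < k - 1" "m \<le> k - 1" "(e, i, j) \<in> boxes (lambda0 k m n, lambda1 k m n)"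
    "(e', i', j') \<in> boxes (lambda0 k m n, lambda1 k m n)"
  shows "column_colour (k - 1 - m) (e, i, j) = column_colour (k - 1 - m) (e', i', j') \<longleftrightarrow> e = e' \<and> j = j'"
proof
  assume eq: "column_colour (k - 1 - m) (e, i, j) = column_colour (k - 1 - m) (e', i', j')"
  then have "e = 1 \<longleftrightarrow> e' = 1"
    using column_colour_less(2)[OF assms(1-3)] column_colour_less(2)[OF assms(1,2,4)] by simp
  moreover have "e = 0 \<or> e = 1" "e' = 0 \<or> e' = 1" "1 \<le> j" "1 \<le> j'"
    using assms(3,4) by (auto simp: mem_boxes)
  ultimately show "e = e' \<and> j = j'" using eq by (auto simp: column_colour_def split: if_splits)
qed (auto simp: column_colour_def)

lemma garnir_poly_eq_colour_poly:
  assumes k: "0 < k - 1" "m \<le> k - 1"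
    and \<Lambda>: "\<Lambda> = (lambda0 k m n, lambda1 k m n)" and T: "T \<in> standard_tableaux n \<Lambda>"
  shows "garnir_poly l \<Lambda> T = colour_poly l (k - 1 - m) n (tableau_colouring (k - 1 - m) \<Lambda> T)"
proof -
  let ?c = "k - 1 - m"
  let ?col = "tableau_colouring ?c \<Lambda> T"
  have bij: "bij_betw T (boxes \<Lambda>) {1..n}" using T by (simp add: standard_tableaux_def)
  have inj: "inj_on T (boxes \<Lambda>)" and im: "T ` boxes \<Lambda> = {1..n}" using bij by (auto simp: bij_betw_def)
  have colT: "?col (T b) = column_colour ?c b" if "b \<in> boxes \<Lambda>" for b
    by (rule tableau_colouring_box[OF bij that])
  have cl: "column_colour ?c (e, i, j) < ?c \<longleftrightarrow> e = 1" if "(e, i, j) \<in> boxes \<Lambda>" for e i j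
    using column_colour_less(2)[OF k] that unfolding \<Lambda> by blast
  have ce: "column_colour ?c (e, i, j) = column_colour ?c (e', i', j') \<longleftrightarrow> e = e' \<and> j = j'"
    if "(e, i, j) \<in> boxes \<Lambda>" "(e', i', j') \<in> boxes \<Lambda>" for e i j e' i' j'
    using column_colour_eq[OF k] that unfolding \<Lambda> by blast
  have sub1: "{1} \<times> diagram (snd \<Lambda>) \<subseteq> boxes \<Lambda>" by (auto simp: boxes_def)
  have "T ` ({1} \<times> diagram (snd \<Lambda>)) = {x \<in> {1..n}. ?col x < ?c}"
  proof (intro Set.set_eqI iffI)
    fix x assume "x \<in> T ` ({1} \<times> diagram (snd \<Lambda>))"
    then obtain i j where b: "(1, i, j) \<in> boxes \<Lambda>" "x = T (1, i, j)" using sub1 by auto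
    have "x \<in> {1..n}" using b im by blast
    then show "x \<in> {x \<in> {1..n}. ?col x < ?c}" using colT[OF b(1)] cl[OF b(1)] b(2) by simp
  next
    fix x assume x: "x \<in> {x \<in> {1..n}. ?col x < ?c}"
    then obtain e i j where b: "(e, i, j) \<in> boxes \<Lambda>" "x = T (e, i, j)" using im
      by (metis (no_types, lifting) imageE mem_Collect_eq prod_cases3)
    then have "e = 1" using colT[OF b(1)] cl[OF b(1)] x by simp
    then have "(e, i, j) \<in> {1} \<times> diagram (snd \<Lambda>)" using b(1) by (auto simp: boxes_def)
    then show "x \<in> T ` ({1} \<times> diagram (snd \<Lambda>))" using b(2) by blast
  qed
  then have p1: "(\<Prod>b\<in>{1} \<times> diagram (snd \<Lambda>). Var (T b)) = (\<Prod>x\<in>{x \<in> {1..n}. ?col x < ?c}. Var x)"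
    using prod.reindex[OF inj_on_subset[OF inj sub1], of Var] by (simp add: comp_def)
  have colinc: "T (e, i, j) < T (e, i', j) \<longleftrightarrow> i < i'"
    if b: "(e, i, j) \<in> boxes \<Lambda>" "(e, i', j) \<in> boxes \<Lambda>" for e i i' j
  proof -
    have inc: "T (e, i, j) < T (e, i', j)" if "(e, i, j) \<in> boxes \<Lambda>" "(e, i', j) \<in> boxes \<Lambda>" "i < i'" for i i'
      using T that unfolding standard_tableaux_def by blast
    show ?thesis using inc[OF b] inc[OF b(2,1)] by (metis less_asym less_irrefl linorder_neqE_nat)
  qed
  let ?f = "\<lambda>(b, b'). (T b, T b')"
  have cpb: "b \<in> boxes \<Lambda>" "b' \<in> boxes \<Lambda>" if "(b, b') \<in> column_pairs \<Lambda>" for b b'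
    using that by (auto simp: column_pairs_def)
  have injf: "inj_on ?f (column_pairs \<Lambda>)"
    by (rule inj_onI) (use cpb inj in \<open>auto dest: inj_onD\<close>)
  have "?f ` column_pairs \<Lambda> = colour_pairs n ?col"
  proof (intro Set.set_eqI iffI)
    fix z assume "z \<in> ?f ` column_pairs \<Lambda>"
    then obtain e i i' j where z: "z = (T (e, i, j), T (e, i', j))" "(e, i, j) \<in> boxes \<Lambda>" "(e, i', j) \<in> boxes \<Lambda>" "i < i'"
      by (auto simp: column_pairs_def)
    then show "z \<in> colour_pairs n ?col"
      using colinc[OF z(2,3)] colT[OF z(2)] colT[OF z(3)] im by (auto simp: colour_pairs_def column_colour_def)
  next
    fix z assume "z \<in> colour_pairs n ?col"
    then obtain x x' where z: "z = (x, x')" "x \<in> {1..n}" "x' \<in> {1..n}" "x < x'" "?col x = ?col x'"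
      by (auto simp: colour_pairs_def)
    obtain b b' where b: "b \<in> boxes \<Lambda>" "b' \<in> boxes \<Lambda>" "x = T b" "x' = T b'"
      using z(2,3) im by (metis imageE)
    obtain e i j where bb: "b = (e, i, j)" by (rule prod_cases3)
    obtain e' i' j' where bb': "b' = (e', i', j')" by (rule prod_cases3)
    have eq: "e = e' \<and> j = j'" using z(5) b bb bb' colT ce by simp
    then have "i < i'" using colinc[of e i j i'] z(4) b bb bb' by simp
    then have "(b, b') \<in> column_pairs \<Lambda>" using b eq bb bb' by (auto simp: column_pairs_def)
    then show "z \<in> ?f ` column_pairs \<Lambda>" using z(1) b by force
  qed
  then have "(\<Prod>(x, x')\<in>colour_pairs n ?col. Var x ^ l - Var x' ^ l) =
      (\<Prod>z\<in>column_pairs \<Lambda>. (case ?f z of (x, x') \<Rightarrow> Var x ^ l - Var x' ^ l))"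
    using prod.reindex[OF injf, of "\<lambda>(x, x'). Var x ^ l - Var x' ^ l"] by (simp add: comp_def)
  also have "\<dots> = (\<Prod>(b, b')\<in>column_pairs \<Lambda>. Var (T b) ^ l - Var (T b') ^ l)"
    by (rule prod.cong) auto
  finally show ?thesis unfolding garnir_poly_def colour_poly_def p1 by simp
qed

lemma tableau_colouring_valid:
  assumes k: "0 < k - 1" "m \<le> k - 1"
    and \<Lambda>: "\<Lambda> = (lambda0 k m n, lambda1 k m n)" and bij: "bij_betw T (boxes \<Lambda>) {1..n}" and x: "x \<in> {1..n}"
  shows "tableau_colouring (k - 1 - m) \<Lambda> T x < k - 1"
proof -
  obtain b where b: "b \<in> boxes \<Lambda>" "x = T b" using bij x unfolding bij_betw_def by (metis imageE)
  obtain e i j where bb: "b = (e, i, j)" by (rule prod_cases3)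
  show ?thesis
    using tableau_colouring_box[OF bij b(1)] column_colour_less(1)[OF k, of e i j n] b bb \<Lambda> by simp
qed

lemma tableau_colouring_rank:
  assumes k: "0 < k - 1" "m \<le> k - 1"
    and \<Lambda>: "\<Lambda> = (lambda0 k m n, lambda1 k m n)" and T: "T \<in> standard_tableaux n \<Lambda>"
    and b: "(e, i, j) \<in> boxes \<Lambda>"
  shows "card {y \<in> {1..n}. tableau_colouring (k - 1 - m) \<Lambda> T y = tableau_colouring (k - 1 - m) \<Lambda> T (T (e, i, j)) \<and>
    y < T (e, i, j)} = i - 1"
proof -
  let ?c = "k - 1 - m"
  let ?col = "tableau_colouring ?c \<Lambda> T"
  have bij: "bij_betw T (boxes \<Lambda>) {1..n}" using T by (simp add: standard_tableaux_def)
  have inj: "inj_on T (boxes \<Lambda>)" and im: "T ` boxes \<Lambda> = {1..n}" using bij by (auto simp: bij_betw_def)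
  have colT: "?col (T b) = column_colour ?c b" if "b \<in> boxes \<Lambda>" for b
    by (rule tableau_colouring_box[OF bij that])
  have inc: "T (e, i, j) < T (e, i', j)" if "(e, i, j) \<in> boxes \<Lambda>" "(e, i', j) \<in> boxes \<Lambda>" "i < i'" for i i'
    using T that unfolding standard_tableaux_def by blast
  have above: "(e, i', j) \<in> boxes \<Lambda>" if "i' \<in> {1..<i}" for i'
  proof -
    have "i' - 1 \<le> i - 1" using that by auto
    then have "row_length k m n e (i - 1) \<le> row_length k m n e (i' - 1)" by (rule row_length_antimono)
    then show ?thesis using b that unfolding \<Lambda> mem_boxes by auto
  qed
  have "{y \<in> {1..n}. ?col y = ?col (T (e, i, j)) \<and> y < T (e, i, j)} = (\<lambda>i'. T (e, i', j)) ` {1..<i}"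
  proof (intro Set.set_eqI iffI)
    fix y assume y: "y \<in> {y \<in> {1..n}. ?col y = ?col (T (e, i, j)) \<and> y < T (e, i, j)}"
    then obtain b' where b': "b' \<in> boxes \<Lambda>" "y = T b'" using im by blast
    obtain e' i' j' where bb': "b' = (e', i', j')" by (rule prod_cases3)
    have eq: "e' = e \<and> j' = j"
      using y b' bb' b colT[OF b] colT[OF b'(1)] column_colour_eq[OF k, of e' i' j' n e i j] unfolding \<Lambda> by simp
    have "1 \<le> i'" using b'(1) bb' unfolding \<Lambda> by (simp add: mem_boxes)
    moreover have "i' < i"
    proof (rule ccontr)
      assume "\<not> i' < i"
      then have "T (e, i, j) \<le> T (e, i', j)"
        using inc[OF b, of i'] b'(1) bb' eq by (cases "i = i'") auto
      then show False using y b' bb' eq by simp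
    qed
    ultimately show "y \<in> (\<lambda>i'. T (e, i', j)) ` {1..<i}" using b' bb' eq by auto
  next
    fix y assume "y \<in> (\<lambda>i'. T (e, i', j)) ` {1..<i}"
    then obtain i' where i': "i' \<in> {1..<i}" "y = T (e, i', j)" by blast
    then show "y \<in> {y \<in> {1..n}. ?col y = ?col (T (e, i, j)) \<and> y < T (e, i, j)}"
      using above[OF i'(1)] im inc[OF above[OF i'(1)] b] colT[OF b] colT[OF above[OF i'(1)]]
      by (auto simp: column_colour_def)
  qed
  moreover have "inj_on (\<lambda>i'. T (e, i', j)) {1..<i}"
    by (rule inj_onI) (use inj above in \<open>auto dest: inj_onD\<close>)
  ultimately show ?thesis by (simp add: card_image)
qed

section \<open>Standard tableaux from balanced colourings\<close>

lemma bij_betw_rank: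
  fixes C :: "nat set"
  assumes "finite C"
  shows "bij_betw (\<lambda>x. card {y \<in> C. y < x}) C {..<card C}"
proof -
  let ?r = "\<lambda>x. card {y \<in> C. y < x}"
  have mono: "?r x < ?r x'" if "x \<in> C" "x < x'" for x x'
  proof (rule psubset_card_mono)
    have "{y \<in> C. y < x} \<subseteq> {y \<in> C. y < x'}" using that(2) by auto
    moreover have "x \<in> {y \<in> C. y < x'}" "x \<notin> {y \<in> C. y < x}" using that by auto
    ultimately show "{y \<in> C. y < x} \<subset> {y \<in> C. y < x'}" by blast
  qed (use assms in simp)
  have inj: "inj_on ?r C"
  proof (rule inj_onI)
    fix x x' assume "x \<in> C" "x' \<in> C" "?r x = ?r x'"
    then show "x = x'" using mono[of x x'] mono[of x' x] by (cases x x' rule: linorder_cases) simp_all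
  qed
  have "?r x < card C" if "x \<in> C" for x
    by (rule psubset_card_mono) (use assms that in auto)
  then have "?r ` C \<subseteq> {..<card C}" by auto
  then have "?r ` C = {..<card C}"
    by (rule card_subset_eq[OF finite_lessThan]) (simp add: card_image[OF inj])
  then show ?thesis using inj by (simp add: bij_betw_def)
qed

lemma sorted_list_nth_less:
  fixes S :: "nat set"
  assumes "finite S" "j < card {z \<in> S. z < x}"
  shows "sorted_list_of_set S ! j < x"
proof (rule ccontr)
  let ?xs = "sorted_list_of_set S"
  assume ge: "\<not> ?xs ! j < x"
  have "{z \<in> S. z < x} \<subseteq> (\<lambda>t. ?xs ! t) ` {..<j}"
  proof
    fix z assume z: "z \<in> {z \<in> S. z < x}"
    then obtain t where t: "t < length ?xs" "?xs ! t = z"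
      using assms(1) by (metis (no_types, lifting) in_set_conv_nth mem_Collect_eq set_sorted_list_of_set)
    have "t < j"
    proof (rule ccontr)
      assume "\<not> t < j"
      then have "?xs ! j \<le> ?xs ! t" using t by (intro sorted_nth_mono) simp_all
      then show False using ge t z by simp
    qed
    then show "z \<in> (\<lambda>t. ?xs ! t) ` {..<j}" using t by blast
  qed
  then have "card {z \<in> S. z < x} \<le> card ((\<lambda>t. ?xs ! t) ` {..<j})" by (rule card_mono[rotated]) simp
  also have "\<dots> \<le> j" using card_image_le[of "{..<j}" "\<lambda>t. ?xs ! t"] by simp
  finally show False using assms(2) by simp
qed

text \<open>The first \<open>j + 1\<close> elements of \<open>S'\<close> have \<open>j + 1\<close> distinct images in \<open>S\<close>, all smaller than the \<open>j\<close>-th element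
of \<open>S'\<close>. This is why sorting the rows keeps columns increasing.\<close>

lemma sorted_list_nth_less_nth:
  fixes S S' :: "nat set"
  assumes fin: "finite S" "finite S'" and inj: "inj_on \<psi> S'" and im: "\<psi> ` S' \<subseteq> S"
    and less: "\<And>x. x \<in> S' \<Longrightarrow> \<psi> x < x" and j: "j < card S'"
  shows "sorted_list_of_set S ! j < sorted_list_of_set S' ! j"
proof (rule sorted_list_nth_less[OF fin(1)])
  let ?xs = "sorted_list_of_set S'"
  have len: "length ?xs = card S'" by simp
  have mem: "?xs ! t \<in> S'" if "t \<le> j" for t
    using that j fin(2) by (metis le_less_trans len nth_mem set_sorted_list_of_set)
  have "(\<lambda>t. \<psi> (?xs ! t)) ` {..j} \<subseteq> {z \<in> S. z < ?xs ! j}"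
  proof
    fix z assume "z \<in> (\<lambda>t. \<psi> (?xs ! t)) ` {..j}"
    then obtain t where t: "t \<le> j" "z = \<psi> (?xs ! t)" by blast
    have "?xs ! t \<le> ?xs ! j" using t j len by (intro sorted_nth_mono) simp_all
    then show "z \<in> {z \<in> S. z < ?xs ! j}" using less[OF mem[OF t(1)]] im mem[OF t(1)] t(2) by auto
  qed
  then have "card ((\<lambda>t. \<psi> (?xs ! t)) ` {..j}) \<le> card {z \<in> S. z < ?xs ! j}"
    by (rule card_mono[rotated]) (simp add: fin(1))
  moreover have "inj_on (\<lambda>t. \<psi> (?xs ! t)) {..j}"
  proof (rule inj_onI)
    fix t t' assume t: "t \<in> {..j}" "t' \<in> {..j}" "\<psi> (?xs ! t) = \<psi> (?xs ! t')"
    then have "?xs ! t = ?xs ! t'" using inj_onD[OF inj t(3)] mem by simp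
    moreover have "t < length ?xs" "t' < length ?xs" using t j len by auto
    ultimately show "t = t'" using nth_eq_iff_index_eq[of ?xs t t'] by simp
  qed
  ultimately show "j < card {z \<in> S. z < ?xs ! j}" by (simp add: card_image)
qed

definition class_rank :: "nat \<Rightarrow> (nat \<Rightarrow> nat) \<Rightarrow> nat \<Rightarrow> nat" where
  "class_rank n col x = card {y \<in> {1..n}. col y = col x \<and> y < x}"

lemma class_rank_class:
  "col x = w \<Longrightarrow> class_rank n col x = card {y \<in> colour_class n col w. y < x}"
  by (auto simp: class_rank_def colour_class_def intro!: arg_cong[where f = card])

lemma bij_betw_class_rank:
  "bij_betw (class_rank n col) (colour_class n col w) {..<card (colour_class n col w)}"
proof -
  have "bij_betw (\<lambda>x. card {y \<in> colour_class n col w. y < x}) (colour_class n col w) {..<card (colour_class n col w)}"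
    by (rule bij_betw_rank) simp
  then show ?thesis
    by (rule bij_betw_cong[THEN iffD1, rotated]) (simp add: class_rank_class colour_class_def)
qed

lemma class_rank_less:
  assumes "x \<in> {1..n}" "x < x'" "col x = col x'"
  shows "class_rank n col x < class_rank n col x'"
  unfolding class_rank_def by (rule psubset_card_mono) (use assms in auto)

lemma class_rank_inj:
  assumes "x \<in> {1..n}" "x' \<in> {1..n}" "col x = col x'" "class_rank n col x = class_rank n col x'"
  shows "x = x'"
  using class_rank_less[of x n x' col] class_rank_less[of x' n x col] assms
  by (metis less_irrefl linorder_neqE_nat)

text \<open>Each pair of equal colour is counted at its heavier element; this is the degree of the leading
exponent for \<open>l = 1\<close> and \<open>c = 0\<close>.\<close>

lemma sum_rank:
  fixes W :: "nat \<Rightarrow> nat"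
  assumes "inj_on W {1..n}"
  shows "(\<Sum>i\<in>{1..n}. card {j \<in> {1..n}. col j = col i \<and> W j < W i}) = card (colour_pairs n col)"
proof -
  let ?b = "colour_lead W 1 0 n col"
  have "leads W (colour_poly 1 0 n col) ?b" by (rule leads_colour_poly[OF assms]) simp
  then have b: "?b \<in> keys (colour_poly 1 0 n col)" by (simp add: leads_def)
  have "keys ?b \<subseteq> {1..n}"
    using colour_poly_carrier[of 1 0 n col] b unfolding carrier_poly_ring by blast
  then have "total_degree ?b = (\<Sum>i\<in>{1..n}. lookup ?b i * 1)"
    by (intro wt_superset) simp_all
  also have "\<dots> = (\<Sum>i\<in>{1..n}. card {j \<in> {1..n}. col j = col i \<and> W j < W i})"
    by (rule sum.cong) (simp_all add: lookup_colour_lead[OF assms])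
  finally show ?thesis using keys_colour_poly_degree[OF b] by simp
qed

lemma sum_class_rank: "(\<Sum>i\<in>{1..n}. class_rank n col i) = card (colour_pairs n col)"
  using sum_rank[of "\<lambda>x. x" n col] by (simp add: class_rank_def)

lemma imbalance_eq:
  assumes "\<And>i. i \<in> {1..n} \<Longrightarrow> col i < N"
  shows "imbalance N c n col = 2 * card (colour_pairs n col) + n + card {i \<in> {1..n}. col i < c}"
proof -
  let ?C = "colour_class n col"
  have group: "(\<Sum>w<N. \<Sum>i\<in>?C w. f i) = (\<Sum>i\<in>{1..n}. f i)" for f :: "nat \<Rightarrow> nat"
    unfolding colour_class_def by (rule sum.group) (use assms in auto)
  have sq: "card (?C w) * card (?C w) = (\<Sum>i\<in>?C w. 2 * class_rank n col i + 1)" for w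
  proof -
    have tri: "2 * (\<Sum>t<s. t) + s = s * s" for s :: nat by (induction s) auto
    have "(\<Sum>i\<in>?C w. class_rank n col i) = (\<Sum>t<card (?C w). t)"
      by (rule sum.reindex_bij_betw[OF bij_betw_class_rank])
    then have "(\<Sum>i\<in>?C w. 2 * class_rank n col i + 1) = 2 * (\<Sum>t<card (?C w). t) + card (?C w)"
      by (simp only: sum.distrib sum_distrib_left[symmetric] card_eq_sum)
    then show ?thesis using tri by simp
  qed
  have lo: "card (?C w) * (if w < c then 1 else 0) = (\<Sum>i\<in>?C w. if col i < c then 1 else 0)" for w
    by (simp add: colour_class_def)
  have "imbalance N c n col = (\<Sum>w<N. \<Sum>i\<in>?C w. (2 * class_rank n col i + 1) + (if col i < c then 1 else 0))"
    unfolding imbalance_def distrib_left sq lo sum.distrib ..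
  also have "\<dots> = (\<Sum>i\<in>{1..n}. (2 * class_rank n col i + 1) + (if col i < c then 1 else 0))"
    by (rule group)
  also have "\<dots> = 2 * (\<Sum>i\<in>{1..n}. class_rank n col i) + n + (\<Sum>i\<in>{1..n}. if col i < c then 1 else 0)"
    by (simp only: sum.distrib sum_distrib_left[symmetric] card_eq_sum[symmetric]) simp
  also have "(\<Sum>i\<in>{1..n}. if col i < c then 1 else 0) = card {i \<in> {1..n}. col i < c}"
    by (simp add: sum.inter_filter[symmetric])
  finally show ?thesis by (simp only: sum_class_rank)
qed

text \<open>The future row \<open>i\<close> (from \<open>0\<close>) of component \<open>e\<close> of the tableau.\<close>

definition rank_row :: "nat \<Rightarrow> nat \<Rightarrow> (nat \<Rightarrow> nat) \<Rightarrow> nat \<Rightarrow> nat \<Rightarrow> nat set" where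
  "rank_row c n col e i = {x \<in> {1..n}. (col x < c \<longleftrightarrow> e = 1) \<and> class_rank n col x = i}"

lemma finite_rank_row [simp]: "finite (rank_row c n col e i)"
  by (simp add: rank_row_def)

text \<open>Mapping an index to its colour identifies the row with the set of classes of more than \<open>i\<close> elements.\<close>

lemma card_rank_row:
  assumes k: "0 < k - 1" "m \<le> k - 1" and val: "\<And>i. i \<in> {1..n} \<Longrightarrow> col i < k - 1"
    and bal: "balanced (k - 1) (k - 1 - m) n col" and e: "e = 0 \<or> e = 1"
  shows "card (rank_row (k - 1 - m) n col e i) = row_length k m n e i"
proof -
  let ?c = "k - 1 - m" and ?s = "\<lambda>w. card (colour_class n col w)"
  have "bij_betw col (rank_row ?c n col e i) {w. w < k - 1 \<and> (w < ?c \<longleftrightarrow> e = 1) \<and> i < ?s w}"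
  proof (rule bij_betw_imageI)
    show "inj_on col (rank_row ?c n col e i)"
      by (rule inj_onI) (auto simp: rank_row_def intro: class_rank_inj)
    show "col ` rank_row ?c n col e i = {w. w < k - 1 \<and> (w < ?c \<longleftrightarrow> e = 1) \<and> i < ?s w}"
    proof (intro Set.set_eqI iffI)
      fix w assume "w \<in> col ` rank_row ?c n col e i"
      then obtain x where x: "x \<in> {1..n}" "col x < ?c \<longleftrightarrow> e = 1" "class_rank n col x = i" "w = col x"
        by (auto simp: rank_row_def)
      have "x \<in> colour_class n col w" using x by (simp add: colour_class_def)
      then have "class_rank n col x \<in> {..<?s w}" by (rule bij_betw_apply[OF bij_betw_class_rank])
      then show "w \<in> {w. w < k - 1 \<and> (w < ?c \<longleftrightarrow> e = 1) \<and> i < ?s w}" using x val by simp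
    next
      fix w assume w: "w \<in> {w. w < k - 1 \<and> (w < ?c \<longleftrightarrow> e = 1) \<and> i < ?s w}"
      then have "i \<in> class_rank n col ` colour_class n col w"
        using bij_betw_imp_surj_on[OF bij_betw_class_rank[of n col w]] by simp
      then obtain x where "x \<in> colour_class n col w" "class_rank n col x = i" by blast
      then have "x \<in> rank_row ?c n col e i" "col x = w" using w by (auto simp: rank_row_def colour_class_def)
      then show "w \<in> col ` rank_row ?c n col e i" by blast
    qed
  qed
  then have eq: "card (rank_row ?c n col e i) = card {w. w < k - 1 \<and> (w < ?c \<longleftrightarrow> e = 1) \<and> i < ?s w}"
    by (rule bij_betw_same_card)
  have sum: "(\<Sum>w<k - 1. ?s w) = n"
  proof -
    have "(\<Sum>w<k - 1. \<Sum>x\<in>colour_class n col w. 1) = (\<Sum>x\<in>{1..n}. 1::nat)"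
      unfolding colour_class_def by (rule sum.group) (use val in auto)
    then show ?thesis by simp
  qed
  have near: "?s u \<le> Suc (?s v)" if "u < k - 1" "v < k - 1" for u v
    using bal that unfolding balanced_def by blast
  have lowhigh: "?s u \<le> ?s v" if "u < ?c" "?c \<le> v" "v < k - 1" for u v
    using bal that unfolding balanced_def by auto
  note counts = two_level_counts[OF k(1) _ sum near lowhigh, of ?c i]
  have mm: "k - 1 - ?c = m" using k(2) by simp
  show ?thesis
    using counts e unfolding eq mm row_length_def by auto
qed

text \<open>The imbalance is determined by the sizes of the rank rows, which are the row lengths of \<open>\<lambda>\<^sup>0\<close> and
\<open>\<lambda>\<^sup>1\<close>.\<close>

lemma balanced_imbalance_eq:
  assumes k: "0 < k - 1" "m \<le> k - 1"
    and val: "\<And>i. i \<in> {1..n} \<Longrightarrow> col i < k - 1" "\<And>i. i \<in> {1..n} \<Longrightarrow> col' i < k - 1"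
    and bal: "balanced (k - 1) (k - 1 - m) n col" "balanced (k - 1) (k - 1 - m) n col'"
  shows "imbalance (k - 1) (k - 1 - m) n col = imbalance (k - 1) (k - 1 - m) n col'"
proof -
  let ?c = "k - 1 - m"
  have *: "card (colour_pairs n col) = (\<Sum>i<n. i * (row_length k m n 0 i + row_length k m n 1 i)) \<and>
    card {i \<in> {1..n}. col i < ?c} = (\<Sum>i<n. row_length k m n 1 i)"
    if val: "\<And>i. i \<in> {1..n} \<Longrightarrow> col i < k - 1" and bal: "balanced (k - 1) ?c n col" for col
  proof -
    have lt: "class_rank n col x < n" if "x \<in> {1..n}" for x
    proof -
      have "class_rank n col x \<le> card {1..<x}" unfolding class_rank_def by (rule card_mono) auto
      then show ?thesis using that by auto
    qed
    have R: "card (rank_row ?c n col e i) = row_length k m n e i" if "e = 0 \<or> e = 1" for e i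
      by (rule card_rank_row[OF k val bal that])
    have "card (colour_pairs n col) = (\<Sum>x\<in>{1..n}. class_rank n col x)" by (rule sum_class_rank[symmetric])
    also have "\<dots> = (\<Sum>i<n. \<Sum>x\<in>{x \<in> {1..n}. class_rank n col x = i}. class_rank n col x)"
      by (rule sum.group[symmetric]) (use lt in auto)
    also have "\<dots> = (\<Sum>i<n. i * (row_length k m n 0 i + row_length k m n 1 i))"
    proof (rule sum.cong[OF refl])
      fix i
      have "{x \<in> {1..n}. class_rank n col x = i} = rank_row ?c n col 0 i \<union> rank_row ?c n col 1 i"
        by (auto simp: rank_row_def)
      moreover have "rank_row ?c n col 0 i \<inter> rank_row ?c n col 1 i = {}" by (auto simp: rank_row_def)
      ultimately have "card {x \<in> {1..n}. class_rank n col x = i} = row_length k m n 0 i + row_length k m n 1 i"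
        by (simp only: card_Un_disjoint[OF finite_rank_row finite_rank_row] R simp_thms)
      then show "(\<Sum>x\<in>{x \<in> {1..n}. class_rank n col x = i}. class_rank n col x) =
        i * (row_length k m n 0 i + row_length k m n 1 i)" by simp
    qed
    finally have 1: "card (colour_pairs n col) = (\<Sum>i<n. i * (row_length k m n 0 i + row_length k m n 1 i))" .
    have "card {x \<in> {1..n}. col x < ?c} = (\<Sum>x\<in>{x \<in> {1..n}. col x < ?c}. 1)" by simp
    also have "\<dots> = (\<Sum>i<n. \<Sum>x\<in>{x \<in> {x \<in> {1..n}. col x < ?c}. class_rank n col x = i}. 1)"
      by (rule sum.group[symmetric]) (use lt in auto)
    also have "\<dots> = (\<Sum>i<n. row_length k m n 1 i)"
    proof (rule sum.cong[OF refl])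
      fix i
      have "{x \<in> {x \<in> {1..n}. col x < ?c}. class_rank n col x = i} = rank_row ?c n col 1 i"
        by (auto simp: rank_row_def)
      then show "(\<Sum>x\<in>{x \<in> {x \<in> {1..n}. col x < ?c}. class_rank n col x = i}. 1) = row_length k m n 1 i"
        using R[of 1 i] by simp
    qed
    finally show ?thesis using 1 by blast
  qed
  show ?thesis
    using imbalance_eq[of n col "k - 1" ?c, OF val(1)] imbalance_eq[of n col' "k - 1" ?c, OF val(2)]
      *[OF val(1) bal(1)] *[OF val(2) bal(2)] by presburger
qed

text \<open>Put the indices of rank \<open>i\<close> in their class into row \<open>i + 1\<close> of the component given by the colour, in
increasing order. An index of rank \<open>i + 1\<close> has a smaller index of rank \<open>i\<close> in its own class, so columns
increase as well. Entries may change their column, but not their component and row.\<close>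

lemma exists_standard_tableau:
  assumes k: "0 < k - 1" "m \<le> k - 1" and val: "\<And>i. i \<in> {1..n} \<Longrightarrow> col i < k - 1"
    and bal: "balanced (k - 1) (k - 1 - m) n col" and \<Lambda>: "\<Lambda> = (lambda0 k m n, lambda1 k m n)"
  shows "\<exists>T\<in>standard_tableaux n \<Lambda>. \<forall>x\<in>{1..n}.
    (tableau_colouring (k - 1 - m) \<Lambda> T x < k - 1 - m \<longleftrightarrow> col x < k - 1 - m) \<and>
    class_rank n (tableau_colouring (k - 1 - m) \<Lambda> T) x = class_rank n col x"
proof -
  let ?c = "k - 1 - m"
  define R where "R = rank_row ?c n col"
  have finR: "finite (R e i)" for e i by (simp add: R_def)
  have cR: "card (R e i) = row_length k m n e i" if "e = 0 \<or> e = 1" for e i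
    unfolding R_def by (rule card_rank_row[OF k val bal that])
  define T where "T = (\<lambda>(e, i, j)\<in>boxes \<Lambda>. sorted_list_of_set (R e (i - 1)) ! (j - 1))"
  have Tb: "T (e, i, j) = sorted_list_of_set (R e (i - 1)) ! (j - 1)" if "(e, i, j) \<in> boxes \<Lambda>" for e i j
    using that by (simp add: T_def)
  have idx: "j - 1 < card (R e (i - 1))" "e = 0 \<or> e = 1" "1 \<le> i" "1 \<le> j" if "(e, i, j) \<in> boxes \<Lambda>" for e i j
    using that cR[of e "i - 1"] unfolding \<Lambda> mem_boxes by auto
  have TR: "T (e, i, j) \<in> R e (i - 1)" if "(e, i, j) \<in> boxes \<Lambda>" for e i j
    using idx(1)[OF that] Tb[OF that] finR by (metis length_sorted_list_of_set nth_mem set_sorted_list_of_set)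
  have bij: "bij_betw T (boxes \<Lambda>) {1..n}"
  proof (rule bij_betw_imageI)
    show "inj_on T (boxes \<Lambda>)"
    proof (rule inj_onI)
      fix b b' assume b: "b \<in> boxes \<Lambda>" "b' \<in> boxes \<Lambda>" "T b = T b'"
      obtain e i j where bb: "b = (e, i, j)" by (rule prod_cases3)
      obtain e' i' j' where bb': "b' = (e', i', j')" by (rule prod_cases3)
      have m: "T b \<in> R e (i - 1)" "T b \<in> R e' (i' - 1)" using TR b bb bb' by metis+
      then have "e = e'" "i - 1 = i' - 1"
        using idx(2)[of e i j] idx(2)[of e' i' j'] b bb bb' by (auto simp: R_def rank_row_def)
      then have ei: "e = e'" "i = i'"
        using idx(3)[of e i j] idx(3)[of e' i' j'] b bb bb' by auto
      have "sorted_list_of_set (R e (i - 1)) ! (j - 1) = sorted_list_of_set (R e (i - 1)) ! (j' - 1)"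
        using b bb bb' ei Tb by simp
      moreover have "j - 1 < card (R e (i - 1))" "j' - 1 < card (R e (i - 1))" "1 \<le> j" "1 \<le> j'"
        using idx b bb bb' ei by blast+
      ultimately have "j = j'"
        using nth_eq_iff_index_eq[of "sorted_list_of_set (R e (i - 1))" "j - 1" "j' - 1"] by simp
      then show "b = b'" using bb bb' ei by simp
    qed
    show "T ` boxes \<Lambda> = {1..n}"
    proof (intro Set.set_eqI iffI)
      fix x assume "x \<in> T ` boxes \<Lambda>"
      then obtain b where b: "b \<in> boxes \<Lambda>" "x = T b" by blast
      obtain e i j where "b = (e, i, j)" by (rule prod_cases3)
      then show "x \<in> {1..n}" using TR[of e i j] b by (simp add: R_def rank_row_def)
    next
      fix x assume x: "x \<in> {1..n}"
      define e where "e = (if col x < ?c then 1 else 0::nat)"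
      define i where "i = class_rank n col x"
      have xR: "x \<in> R e i" using x by (simp add: R_def rank_row_def e_def i_def)
      then obtain t where t: "t < card (R e i)" "sorted_list_of_set (R e i) ! t = x"
        using finR by (metis in_set_conv_nth length_sorted_list_of_set set_sorted_list_of_set)
      have "(e, Suc i, Suc t) \<in> boxes \<Lambda>"
        using t(1) cR[of e i] unfolding \<Lambda> mem_boxes by (auto simp: e_def split: if_splits)
      then show "x \<in> T ` boxes \<Lambda>" using Tb t(2) by (intro image_eqI[of _ _ "(e, Suc i, Suc t)"]) simp_all
    qed
  qed
  have down: "T (e, Suc i, j) < T (e, Suc (Suc i), j)"
    if b: "(e, Suc i, j) \<in> boxes \<Lambda>" "(e, Suc (Suc i), j) \<in> boxes \<Lambda>" for e i j
  proof -
    have pre: "\<exists>y. y \<in> R e i \<and> y < x \<and> col y = col x" if "x \<in> R e (Suc i)" for x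
    proof -
      let ?C = "colour_class n col (col x)"
      have x: "x \<in> {1..n}" "class_rank n col x = Suc i" "col x < ?c \<longleftrightarrow> e = 1"
        using that by (auto simp: R_def rank_row_def)
      then have "x \<in> ?C" by (simp add: colour_class_def)
      then have "class_rank n col x \<in> {..<card ?C}" by (rule bij_betw_apply[OF bij_betw_class_rank])
      then have "i \<in> class_rank n col ` ?C"
        using x(2) bij_betw_imp_surj_on[OF bij_betw_class_rank[of n col "col x"]] by simp
      then obtain y where y: "y \<in> ?C" "class_rank n col y = i" by blast
      then have yn: "y \<in> {1..n}" "col y = col x" by (auto simp: colour_class_def)
      have "y < x"
      proof (rule ccontr)
        assume "\<not> y < x"
        then consider "x = y" | "x < y" by linarith
        then show False
        proof cases
          case 2
          then show False using class_rank_less[OF x(1) 2 yn(2)[symmetric]] x(2) y(2) by simp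
        qed (use x(2) y(2) in simp)
      qed
      then show ?thesis using y yn x by (intro exI[of _ y]) (simp add: R_def rank_row_def)
    qed
    define \<psi> where "\<psi> x = (SOME y. y \<in> R e i \<and> y < x \<and> col y = col x)" for x
    have \<psi>: "\<psi> x \<in> R e i \<and> \<psi> x < x \<and> col (\<psi> x) = col x" if "x \<in> R e (Suc i)" for x
      unfolding \<psi>_def by (rule someI_ex[OF pre[OF that]])
    have "sorted_list_of_set (R e i) ! (j - 1) < sorted_list_of_set (R e (Suc i)) ! (j - 1)"
    proof (rule sorted_list_nth_less_nth[OF finR finR])
      show "inj_on \<psi> (R e (Suc i))"
      proof (rule inj_onI)
        fix x x' assume xx: "x \<in> R e (Suc i)" "x' \<in> R e (Suc i)" "\<psi> x = \<psi> x'"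
        have "col x = col x'" using \<psi>[OF xx(1)] \<psi>[OF xx(2)] xx(3) by simp
        then show "x = x'" using xx(1,2) by (intro class_rank_inj[of x n x' col]) (simp_all add: R_def rank_row_def)
      qed
      show "\<psi> ` R e (Suc i) \<subseteq> R e i" using \<psi> by blast
      show "\<psi> x < x" if "x \<in> R e (Suc i)" for x using \<psi>[OF that] by blast
      show "j - 1 < card (R e (Suc i))" using idx(1)[OF b(2)] by simp
    qed
    then show ?thesis using Tb[OF b(1)] Tb[OF b(2)] by simp
  qed
  have sub: "(e, i', j) \<in> boxes \<Lambda>" if "(e, i, j) \<in> boxes \<Lambda>" "1 \<le> i'" "i' \<le> i" for e i i' j
  proof -
    have "row_length k m n e (i - 1) \<le> row_length k m n e (i' - 1)"
      by (rule row_length_antimono) (use that in simp)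
    then show ?thesis using that unfolding \<Lambda> mem_boxes by auto
  qed
  have std: "T \<in> standard_tableaux n \<Lambda>"
    unfolding standard_tableaux_def
  proof (intro CollectI conjI allI impI; (elim conjE)?)
    show "T \<in> extensional (boxes \<Lambda>)" by (simp add: T_def)
    show "bij_betw T (boxes \<Lambda>) {1..n}" by (rule bij)
    fix e i j j' assume b: "(e, i, j) \<in> boxes \<Lambda>" "(e, i, j') \<in> boxes \<Lambda>" "j < j'"
    have "sorted_list_of_set (R e (i - 1)) ! (j - 1) < sorted_list_of_set (R e (i - 1)) ! (j' - 1)"
      by (rule sorted_wrt_nth_less[OF strict_sorted_list_of_set]) (use idx(1)[OF b(2)] idx(4)[OF b(1)] b(3) in auto)
    then show "T (e, i, j) < T (e, i, j')" using Tb b by simp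
  next
    fix e i i' j assume b: "(e, i, j) \<in> boxes \<Lambda>" "(e, i', j) \<in> boxes \<Lambda>" "i < i'"
    have i: "1 \<le> i" using idx(3)[OF b(1)] .
    have "(e, i', j) \<in> boxes \<Lambda> \<longrightarrow> T (e, i, j) < T (e, i', j)"
      using Suc_leI[OF b(3)]
    proof (induction i' rule: dec_induct)
      case base
      show ?case using down[of e "i - 1" j] b(1) i by simp
    next
      case (step p)
      show ?case
      proof
        assume up: "(e, Suc p, j) \<in> boxes \<Lambda>"
        have p: "(e, p, j) \<in> boxes \<Lambda>" using sub[OF up, of p] step(1) by simp
        have "T (e, p, j) < T (e, Suc p, j)" using down[of e "p - 1" j] p up step(1) by simp
        then show "T (e, i, j) < T (e, Suc p, j)" using step p by simp
      qed
    qed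
    then show "T (e, i, j) < T (e, i', j)" using b by blast
  qed
  have "(tableau_colouring ?c \<Lambda> T x < ?c \<longleftrightarrow> col x < ?c) \<and>
    class_rank n (tableau_colouring ?c \<Lambda> T) x = class_rank n col x" if x: "x \<in> {1..n}" for x
  proof -
    obtain b where b: "b \<in> boxes \<Lambda>" "x = T b" using bij x unfolding bij_betw_def by (metis imageE)
    obtain e i j where bb: "b = (e, i, j)" by (rule prod_cases3)
    have xR: "x \<in> R e (i - 1)" using TR[of e i j] b bb by simp
    have "class_rank n (tableau_colouring ?c \<Lambda> T) x = i - 1"
      using tableau_colouring_rank[OF k \<Lambda> std, of e i j] b bb by (simp add: class_rank_def)
    moreover have "tableau_colouring ?c \<Lambda> T x < ?c \<longleftrightarrow> e = 1"
      using tableau_colouring_box[OF bij b(1), of ?c] column_colour_less(2)[OF k, of e i j n] b bb \<Lambda> by simp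
    ultimately show ?thesis using xR by (simp add: R_def rank_row_def)
  qed
  then show ?thesis using std by blast
qed

section \<open>Straightening\<close>

lemma block_order_less:
  assumes W: "lex_weight n vs M W"
    and mono: "\<And>p q. p < q \<Longrightarrow> q < n \<Longrightarrow> (vs p \<in> A \<longleftrightarrow> vs q \<in> A) \<Longrightarrow> vs p < vs q"
    and ij: "i \<in> {1..n}" "j \<in> {1..n}" "i \<in> A \<longleftrightarrow> j \<in> A"
  shows "W j < W i \<longleftrightarrow> j < i"
proof -
  have vs: "vs ` {..<n} = {1..n}" using W by (simp add: lex_weight_def bij_betw_def)
  have "i \<in> vs ` {..<n}" "j \<in> vs ` {..<n}" unfolding vs by (rule ij)+
  then obtain p q where pq: "p < n" "i = vs p" "q < n" "j = vs q" by auto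
  have "W j < W i \<longleftrightarrow> q < p" unfolding pq(2,4) by (rule lex_weight_less_iff[OF W pq(3,1)])
  also have "\<dots> \<longleftrightarrow> j < i"
    using mono[of q p] mono[of p q] ij(3) pq by (cases p q rule: linorder_cases) auto
  finally show ?thesis .
qed

lemma colour_lead_eqI:
  assumes W: "inj_on W {1..n}" and b: "keys b \<subseteq> {1..n}"
    and eq: "\<And>i. i \<in> {1..n} \<Longrightarrow> lookup b i =
      (if col i < c then 1 else 0) + l * card {j \<in> {1..n}. col j = col i \<and> W j < W i}"
    and l: "0 < l"
  shows "colour_lead W l c n col = b"
proof (rule poly_mapping_eqI)
  fix i
  show "lookup (colour_lead W l c n col) i = lookup b i"
  proof (cases "i \<in> {1..n}")
    case True
    then show ?thesis using eq lookup_colour_lead[OF W] by simp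
  next
    case False
    have "colour_lead W l c n col \<in> keys (colour_poly l c n col)"
      using leads_colour_poly[OF W l] by (simp add: leads_def)
    then have "keys (colour_lead W l c n col) \<subseteq> {1..n}"
      using colour_poly_carrier unfolding carrier_poly_ring by blast
    then have "i \<notin> keys (colour_lead W l c n col)" "i \<notin> keys b" using False b by blast+
    then show ?thesis by (simp add: in_keys_iff)
  qed
qed

text \<open>Division inside the space \<open>F\<close> of elements of the ideal of degree \<open>D\<close>, the degree of the given
polynomial, which are divisible by the variables of \<open>A\<close> with cofactor a polynomial in the \<open>l\<close>-th powers.
The colouring below a leading exponent has at most the imbalance of the given one, which is minimal;
hence it is balanced with the same low indices, all inequalities for the exponents are equalities,
and the exponent is that of a Garnir polynomial.\<close>

theorem balanced_colour_poly_in_garnir_ideal: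
  assumes l: "0 < l" and k: "0 < k - 1" "m \<le> k - 1"
    and J: "ideal J (poly_ring n)" and gens: "garnir_set k l m n \<subseteq> J"
    and val0: "\<And>i. i \<in> {1..n} \<Longrightarrow> col0 i < k - 1" and bal0: "balanced (k - 1) (k - 1 - m) n col0"
  shows "colour_poly l (k - 1 - m) n col0 \<in> J"
proof -
  let ?c = "k - 1 - m" and ?\<Lambda> = "(lambda0 k m n, lambda1 k m n)"
  define A where "A = {i \<in> {1..n}. col0 i < ?c}"
  define E where "E = card (colour_pairs n col0)"
  define D where "D = card A + l * E"
  define \<rho> where "\<rho> i = (if i \<in> A then 1 else 0::nat)" for i
  have A: "A \<subseteq> {1..n}" by (auto simp: A_def)
  have k0: "0 < k" using k(1) by simp
  obtain vs where vs: "bij_betw vs {..<n} {1..n}" "\<And>p. p < n \<Longrightarrow> vs p \<in> A \<longleftrightarrow> p < card A"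
    "\<And>p q. p < q \<Longrightarrow> q < n \<Longrightarrow> (vs p \<in> A \<longleftrightarrow> vs q \<in> A) \<Longrightarrow> vs p < vs q"
    using exists_block_order[OF A] by metis
  obtain W where W: "lex_weight n vs (D + 2) W"
    using exists_lex_weight[OF vs(1), of "D + 2"] by auto
  have Winj: "inj_on W {1..n}" using lex_weight_inj_on[OF W] .
  have Wless: "W j < W i \<longleftrightarrow> j < i" if "i \<in> {1..n}" "j \<in> {1..n}" "i \<in> A \<longleftrightarrow> j \<in> A" for i j
    by (rule block_order_less[OF W vs(3) that])
  define F where "F = {f \<in> I_ideal k l m n. \<forall>b\<in>keys f.
    total_degree b = D \<and> (\<forall>i\<in>{1..n}. \<exists>d. lookup b i = \<rho> i + l * d)}"
  show ?thesis
  proof (rule lead_reduction[where F = F and J = J and W = W])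
    have "\<exists>d. lookup b i = \<rho> i + l * d" if "b \<in> keys (colour_poly l ?c n col0)" "i \<in> {1..n}" for b i
      using keys_colour_poly_exponents[OF that(1), of i] that(2) by (simp add: \<rho>_def A_def)
    moreover have "total_degree b = D" if "b \<in> keys (colour_poly l ?c n col0)" for b
      using keys_colour_poly_degree[OF that] by (simp add: D_def A_def E_def)
    ultimately show "colour_poly l ?c n col0 \<in> F"
      using colour_poly_in_I[OF l k(2) k0 val0] by (simp add: F_def)
    show "0 \<in> J" by (rule poly_ideal_closed(2)[OF J])
    show "p + q \<in> J" if "p \<in> J" "q \<in> J" for p q by (rule poly_ideal_closed(3)[OF J that])
    fix f a assume fF: "f \<in> F" and a: "a \<in> keys f"
      and mx: "\<And>b. b \<in> keys f \<Longrightarrow> wt W b \<le> wt W a"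
    have fI: "f \<in> I_ideal k l m n" and deg: "\<And>b. b \<in> keys f \<Longrightarrow> total_degree b = D"
      and res: "\<And>b i. b \<in> keys f \<Longrightarrow> i \<in> {1..n} \<Longrightarrow> \<exists>d. lookup b i = \<rho> i + l * d"
      using fF by (auto simp: F_def)
    have deg': "total_degree b < D + 2" if "b \<in> keys f" for b using deg[OF that] by simp
    have \<rho>0: "\<rho> i = 0" if "i \<in> {1..n}" "i \<notin> A" for i using that by (simp add: \<rho>_def)
    have acarr: "keys a \<subseteq> {1..n}" by (rule I_carrier_keys[OF fI a])
    define g where "g i = (lookup a i - \<rho> i) div l" for i
    have la: "lookup a i = \<rho> i + l * g i" if "i \<in> {1..n}" for i
      using res[OF a that] l by (auto simp: g_def)
    obtain col where val: "\<And>i. i \<in> {1..n} \<Longrightarrow> col i < k - 1"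
      and col: "\<And>i. i \<in> {1..n} \<Longrightarrow> card {j \<in> {1..n}. col j = col i \<and> W j < W i} + (if i \<notin> A \<and> col i < ?c then 1 else 0) \<le> g i"
      using colouring_below_lex_lead[OF fI l k0 k(2) A vs(2) W deg' res \<rho>0 a mx] unfolding g_def by blast
    have sum\<rho>: "(\<Sum>i\<in>{1..n}. \<rho> i) = card A"
    proof -
      have "(\<Sum>i\<in>{1..n}. \<rho> i) = card {i \<in> {1..n}. i \<in> A}"
        unfolding \<rho>_def by (simp add: sum.inter_filter[symmetric])
      also have "{i \<in> {1..n}. i \<in> A} = A" using A by blast
      finally show ?thesis .
    qed
    have "D = (\<Sum>i\<in>{1..n}. lookup a i * 1)"
      unfolding deg[OF a, symmetric] by (rule wt_superset) (use acarr in auto)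
    also have "\<dots> = (\<Sum>i\<in>{1..n}. \<rho> i + l * g i)" by (rule sum.cong) (simp_all add: la)
    also have "\<dots> = card A + l * (\<Sum>i\<in>{1..n}. g i)"
      by (simp only: sum.distrib sum\<rho> sum_distrib_left[symmetric])
    finally have sumg: "(\<Sum>i\<in>{1..n}. g i) = E" using l by (simp add: D_def)
    define B where "B = {i \<in> {1..n}. col i < ?c}"
    have finA: "finite A" using A finite_subset by blast
    have finB: "finite B" by (simp add: B_def)
    have "(\<Sum>i\<in>{1..n}. card {j \<in> {1..n}. col j = col i \<and> W j < W i} + (if i \<notin> A \<and> col i < ?c then 1 else 0)) \<le> E"
      unfolding sumg[symmetric] by (rule sum_mono) (rule col)
    moreover have "(\<Sum>i\<in>{1..n}. if i \<notin> A \<and> col i < ?c then 1 else 0) = card (B - A)"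
    proof -
      have "(\<Sum>i\<in>{1..n}. if i \<notin> A \<and> col i < ?c then 1 else 0) = card {i \<in> {1..n}. i \<notin> A \<and> col i < ?c}"
        by (simp add: sum.inter_filter[symmetric])
      also have "{i \<in> {1..n}. i \<notin> A \<and> col i < ?c} = B - A" by (auto simp: B_def)
      finally show ?thesis .
    qed
    ultimately have pairs: "card (colour_pairs n col) + card (B - A) \<le> E"
      by (simp only: sum.distrib sum_rank[OF Winj])
    have cB: "card B \<le> card A + card (B - A)"
      using card_mono[of "A \<union> (B - A)" B] card_Un_le[of A "B - A"] finA finB by auto
    have im: "imbalance (k - 1) ?c n col = 2 * card (colour_pairs n col) + n + card B"
      unfolding B_def by (rule imbalance_eq[OF val])
    have im0: "imbalance (k - 1) ?c n col0 = 2 * E + n + card A"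
      unfolding A_def E_def by (rule imbalance_eq[OF val0])
    obtain col' where col': "\<forall>i\<in>{1..n}. col' i < k - 1" "balanced (k - 1) ?c n col'"
      "imbalance (k - 1) ?c n col' \<le> imbalance (k - 1) ?c n col"
      "\<not> balanced (k - 1) ?c n col \<longrightarrow> imbalance (k - 1) ?c n col' < imbalance (k - 1) ?c n col"
      using exists_balanced_le[of n col "k - 1" ?c, OF val] by blast
    have im': "imbalance (k - 1) ?c n col' = imbalance (k - 1) ?c n col0"
      by (rule balanced_imbalance_eq[OF k _ val0 col'(2) bal0]) (use col'(1) in blast)
    \<comment> \<open>imbalance is at most that of \<open>col0\<close> minus \<open>card (B - A)\<close>, and at least that of \<open>col0\<close>\<close>
    have BA: "card (B - A) = 0" and cBA: "card B = card A" and cp: "card (colour_pairs n col) = E"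
      and bal: "balanced (k - 1) ?c n col"
      using pairs cB im im0 im' col'(3,4) by linarith+
    have "B \<subseteq> A" using BA finB by auto
    then have BeqA: "B = A" using cBA finA by (simp add: card_subset_eq)
    have rank: "card {j \<in> {1..n}. col j = col i \<and> W j < W i} = g i" if "i \<in> {1..n}" for i
    proof (rule sum_mono_inv[of "\<lambda>i. card {j \<in> {1..n}. col j = col i \<and> W j < W i}" "{1..n}" g])
      show "(\<Sum>i\<in>{1..n}. card {j \<in> {1..n}. col j = col i \<and> W j < W i}) = (\<Sum>i\<in>{1..n}. g i)"
        by (simp only: sum_rank[OF Winj] cp sumg)
      show "card {j \<in> {1..n}. col j = col i \<and> W j < W i} \<le> g i" if "i \<in> {1..n}" for i
        using col[OF that] by linarith
    qed (use that in simp_all)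
    have natural: "card {j \<in> {1..n}. col j = col i \<and> W j < W i} = class_rank n col i"
      if side: "\<And>i. i \<in> {1..n} \<Longrightarrow> col i < ?c \<longleftrightarrow> i \<in> A" and i: "i \<in> {1..n}" for col i
    proof -
      have "W j < W i \<longleftrightarrow> j < i" if "j \<in> {1..n}" "col j = col i" for j
        using Wless[OF i that(1)] side[OF i] side[OF that(1)] that(2) by simp
      then have "{j \<in> {1..n}. col j = col i \<and> W j < W i} = {j \<in> {1..n}. col j = col i \<and> j < i}" by blast
      then show ?thesis by (simp add: class_rank_def)
    qed
    have side: "col i < ?c \<longleftrightarrow> i \<in> A" if "i \<in> {1..n}" for i using BeqA that by (auto simp: B_def)
    obtain T where T: "T \<in> standard_tableaux n ?\<Lambda>"
      and Tcol: "\<And>x. x \<in> {1..n} \<Longrightarrow> tableau_colouring ?c ?\<Lambda> T x < ?c \<longleftrightarrow> col x < ?c"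
        "\<And>x. x \<in> {1..n} \<Longrightarrow> class_rank n (tableau_colouring ?c ?\<Lambda> T) x = class_rank n col x"
      using exists_standard_tableau[OF k val bal refl] by blast
    let ?t = "tableau_colouring ?c ?\<Lambda> T"
    have tside: "?t i < ?c \<longleftrightarrow> i \<in> A" if "i \<in> {1..n}" for i using Tcol(1)[OF that] side[OF that] by simp
    let ?g = "colour_poly l ?c n ?t"
    have gJ: "?g \<in> J"
      using garnir_poly_eq_colour_poly[OF k refl T, of l] gens T by (auto simp: garnir_set_def Let_def)
    have tval: "?t i < k - 1" if "i \<in> {1..n}" for i
      using tableau_colouring_valid[OF k refl _ that] T by (simp add: standard_tableaux_def)
    have gI: "?g \<in> I_ideal k l m n" by (rule colour_poly_in_I[OF l k(2) k0 tval])
    have lead: "colour_lead W l ?c n ?t = a"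
    proof (rule colour_lead_eqI[OF Winj acarr _ l])
      fix i assume i: "i \<in> {1..n}"
      have "card {j \<in> {1..n}. ?t j = ?t i \<and> W j < W i} = g i"
        using natural[OF tside i] natural[OF side i] Tcol(2)[OF i] rank[OF i] by simp
      then show "lookup a i = (if ?t i < ?c then 1 else 0) + l * card {j \<in> {1..n}. ?t j = ?t i \<and> W j < W i}"
        using la[OF i] tside[OF i] by (simp add: \<rho>_def)
    qed
    have lead_g: "leads W ?g a" using leads_colour_poly[OF Winj l, of ?c ?t] unfolding lead .
    have lead_f: "leads W f a" by (rule leads_if_max[OF W I_carrier_keys[OF fI] deg' a mx])
    obtain h where h: "h \<in> J" "f - h \<in> I_ideal k l m n" and hk: "\<And>b. b \<in> keys (f - h) \<Longrightarrow>
        wt W b < wt W a \<and> (b \<in> keys f \<or> (\<exists>u\<in>keys ?g. b = 0 + u))"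
      using division_step[OF J I_ideal_ideal fI gI gJ lead_f lead_g, of 0] by auto
    have "total_degree b = D \<and> (\<forall>i\<in>{1..n}. \<exists>d. lookup b i = \<rho> i + l * d)"
      if "b \<in> keys (f - h)" for b
    proof (cases "b \<in> keys f")
      case True
      then show ?thesis using deg res by blast
    next
      case False
      then have b: "b \<in> keys ?g" using hk[OF that] by simp
      have "a \<in> keys ?g" using lead_g by (simp add: leads_def)
      then have "total_degree b = total_degree a"
        using keys_colour_poly_degree[OF b] keys_colour_poly_degree by simp
      moreover have "\<exists>d. lookup b i = \<rho> i + l * d" if "i \<in> {1..n}" for i
        using keys_colour_poly_exponents[OF b, of i] that tside[OF that] by (simp add: \<rho>_def)
      ultimately show ?thesis using deg[OF a] by simp
    qed
    then have "f - h \<in> F" using h(2) by (simp add: F_def)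
    then show "\<exists>h\<in>J. f - h \<in> F \<and> (\<forall>b\<in>keys (f - h). wt W b < wt W a)"
      using h(1) hk by blast
  qed
qed

section \<open>Generation and minimality\<close>

lemma garnir_set_subset_I:
  assumes l: "0 < l" and k: "0 < k - 1" "m \<le> k - 1"
  shows "garnir_set k l m n \<subseteq> I_ideal k l m n"
proof
  fix f assume "f \<in> garnir_set k l m n"
  then obtain T where T: "T \<in> standard_tableaux n (lambda0 k m n, lambda1 k m n)"
    "f = garnir_poly l (lambda0 k m n, lambda1 k m n) T" by (auto simp: garnir_set_def Let_def)
  show "f \<in> I_ideal k l m n"
    unfolding T(2) garnir_poly_eq_colour_poly[OF k refl T(1)]
    by (rule colour_poly_in_I[OF l k(2)])
       (use k tableau_colouring_valid[OF k refl] T(1) in \<open>auto simp: standard_tableaux_def\<close>)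
qed

theorem garnir_set_generates:
  assumes l: "0 < l" and k: "0 < k - 1" "m \<le> k - 1"
  shows "generates (poly_ring n) (I_ideal k l m n) (garnir_set k l m n)"
proof -
  interpret R: cring "poly_ring n" by (rule cring_poly_ring)
  let ?G = "garnir_set k l m n" and ?I = "I_ideal k l m n"
  have GI: "?G \<subseteq> ?I" by (rule garnir_set_subset_I[OF l k])
  then have Gc: "?G \<subseteq> carrier (poly_ring n)" using poly_ideal_closed(1)[OF I_ideal_ideal] by blast
  let ?J = "genideal (poly_ring n) ?G"
  have J: "ideal ?J (poly_ring n)" by (rule R.genideal_ideal[OF Gc])
  have GJ: "?G \<subseteq> ?J" by (rule R.genideal_self[OF Gc])
  have "?J \<subseteq> ?I" by (rule R.genideal_minimal[OF I_ideal_ideal GI])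
  moreover have "?I \<subseteq> ?J"
  proof (rule I_subset_colour_ideal[OF l _ k(2) J])
    fix col :: "nat \<Rightarrow> nat" assume val: "\<And>i. i \<in> {1..n} \<Longrightarrow> col i < k - 1"
    show "colour_poly l (k - 1 - m) n col \<in> ?J"
      by (rule colour_ideal_subset_balanced[OF l J balanced_colour_poly_in_garnir_ideal[OF l k J GJ] val])
  qed (use k in simp)
  ultimately show ?thesis using Gc by (simp add: generates_def)
qed

text \<open>A row of a standard tableau is the increasing enumeration of its set of entries.\<close>

lemma standard_tableau_eqI:
  assumes \<Lambda>: "\<Lambda> = (lambda0 k m n, lambda1 k m n)"
    and T: "T \<in> standard_tableaux n \<Lambda>" "T' \<in> standard_tableaux n \<Lambda>"
    and rows: "\<And>e i j e' i' j'. (e, i, j) \<in> boxes \<Lambda> \<Longrightarrow> (e', i', j') \<in> boxes \<Lambda> \<Longrightarrow>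
      T (e, i, j) = T' (e', i', j') \<Longrightarrow> e = e' \<and> i = i'"
  shows "T = T'"
proof (rule extensionalityI[of _ "boxes \<Lambda>"])
  show "T \<in> extensional (boxes \<Lambda>)" "T' \<in> extensional (boxes \<Lambda>)" using T by (auto simp: standard_tableaux_def)
  fix b assume b: "b \<in> boxes \<Lambda>"
  obtain e i j where bb: "b = (e, i, j)" by (rule prod_cases3)
  let ?L = "row_length k m n e (i - 1)"
  have e: "e = 0 \<or> e = 1" "1 \<le> i" "1 \<le> j" "j \<le> ?L" using b bb unfolding \<Lambda> by (auto simp: mem_boxes)
  have box: "(e, i, j') \<in> boxes \<Lambda> \<longleftrightarrow> 1 \<le> j' \<and> j' \<le> ?L" for j' using e unfolding \<Lambda> by (auto simp: mem_boxes)
  have im: "T ` boxes \<Lambda> = {1..n}" "T' ` boxes \<Lambda> = {1..n}" using T by (auto simp: standard_tableaux_def bij_betw_def)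
  have inc: "T (e, i, j) < T (e, i, j')" "T' (e, i, j) < T' (e, i, j')" if "1 \<le> j" "j < j'" "j' \<le> ?L" for j j'
    using T that box[of j] box[of j'] unfolding standard_tableaux_def by auto
  have srt: "sorted_wrt (<) (map (\<lambda>j. S (e, i, j)) [1..<Suc ?L])"
    if "\<And>j j'. 1 \<le> j \<Longrightarrow> j < j' \<Longrightarrow> j' \<le> ?L \<Longrightarrow> S (e, i, j) < S (e, i, j')" for S :: "nat \<times> nat \<times> nat \<Rightarrow> nat"
    unfolding sorted_wrt_map by (rule sorted_wrt_mono_rel[OF _ sorted_wrt_upt]) (use that in auto)
  have "(\<lambda>j. T (e, i, j)) ` {1..?L} = (\<lambda>j. T' (e, i, j)) ` {1..?L}"
  proof (intro Set.set_eqI iffI)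
    fix x assume "x \<in> (\<lambda>j. T (e, i, j)) ` {1..?L}"
    then obtain j where j: "(e, i, j) \<in> boxes \<Lambda>" "x = T (e, i, j)" using box by auto
    then have "x \<in> T' ` boxes \<Lambda>" using im by blast
    then obtain e' i' j' where j': "(e', i', j') \<in> boxes \<Lambda>" "x = T' (e', i', j')" by auto
    then have "e = e' \<and> i = i'" using rows[OF j(1) j'(1)] j(2) by simp
    then show "x \<in> (\<lambda>j. T' (e, i, j)) ` {1..?L}" using j' box by auto
  next
    fix x assume "x \<in> (\<lambda>j. T' (e, i, j)) ` {1..?L}"
    then obtain j where j: "(e, i, j) \<in> boxes \<Lambda>" "x = T' (e, i, j)" using box by auto
    then have "x \<in> T ` boxes \<Lambda>" using im by blast
    then obtain e' i' j' where j': "(e', i', j') \<in> boxes \<Lambda>" "x = T (e', i', j')" by auto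
    then have "e' = e \<and> i' = i" using rows[OF j'(1) j(1)] j(2) by simp
    then show "x \<in> (\<lambda>j. T (e, i, j)) ` {1..?L}" using j' box by auto
  qed
  then have set: "set (map (\<lambda>j. T (e, i, j)) [1..<Suc ?L]) = set (map (\<lambda>j. T' (e, i, j)) [1..<Suc ?L])"
    by (simp only: set_map set_upt atLeastLessThanSuc_atLeastAtMost)
  have "map (\<lambda>j. T (e, i, j)) [1..<Suc ?L] = map (\<lambda>j. T' (e, i, j)) [1..<Suc ?L]"
  proof (rule strict_sorted_equal[OF _ _ set])
    show "sorted_wrt (<) (map (\<lambda>j. T (e, i, j)) [1..<Suc ?L])" by (rule srt) (rule inc(1))
    show "sorted_wrt (<) (map (\<lambda>j. T' (e, i, j)) [1..<Suc ?L])" by (rule srt) (rule inc(2))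
  qed
  then show "T b = T' b" using e bb by (simp del: upt_Suc)
qed

lemma keys_garnir_degree:
  assumes "a \<in> keys (garnir_poly l \<Lambda> T)"
  shows "total_degree a = card ({1} \<times> diagram (snd \<Lambda>) :: (nat \<times> nat \<times> nat) set) + l * card (column_pairs \<Lambda>)"
proof -
  have 1: "total_degree a = (\<Sum>b\<in>({1} \<times> diagram (snd \<Lambda>) :: (nat \<times> nat \<times> nat) set). 1)"
    if "a \<in> keys (\<Prod>b\<in>{1} \<times> diagram (snd \<Lambda>). Var (T b))" for a
    by (rule keys_prod_grade[OF _ that]) (auto simp: Var_def)
  have 2: "total_degree a = (\<Sum>z\<in>column_pairs \<Lambda>. l)"
    if "a \<in> keys (\<Prod>(b, b')\<in>column_pairs \<Lambda>. Var (T b) ^ l - Var (T b') ^ l)" for a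
  proof (rule keys_prod_grade[OF _ that])
    fix z a assume "a \<in> keys (case z of (b, b') \<Rightarrow> Var (T b) ^ l - Var (T b') ^ l)"
    then show "total_degree a = l"
      using keys_Var_power_diff[of "T (fst z)" l "T (snd z)"] by (auto simp: case_prod_unfold)
  qed
  show ?thesis
    using keys_mult_grade[OF 1 2 assms[unfolded garnir_poly_def]] by simp
qed

lemma wt_one_eq_0: "total_degree a = 0 \<Longrightarrow> a = 0"
  by (rule poly_mapping_eqI) (use lookup_le_degree[of a] in \<open>metis le_zero_eq lookup_zero\<close>)

text \<open>Modulo terms of degree above \<open>D\<close>, multiplying a form of degree \<open>D\<close> by \<open>r\<close> is scaling it by the constant
term of \<open>r\<close>. So the polynomials which agree with a linear combination of \<open>H\<close> up to degree \<open>D\<close> form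
an ideal.\<close>

lemma homogeneous_in_genideal:
  assumes H: "finite H" "H \<subseteq> carrier (poly_ring n)"
    and deg: "\<And>h a. h \<in> H \<Longrightarrow> a \<in> keys h \<Longrightarrow> total_degree a = D"
    and p: "p \<in> genideal (poly_ring n) H" and degp: "\<And>a. a \<in> keys p \<Longrightarrow> total_degree a = D"
  shows "\<exists>c. p = (\<Sum>h\<in>H. single 0 (c h) * h)"
proof -
  interpret R: cring "poly_ring n" by (rule cring_poly_ring)
  define S where "S c = (\<Sum>h\<in>H. single 0 (c h) * h)" for c :: "cpoly \<Rightarrow> complex"
  have lookS: "lookup (S c) a = (\<Sum>h\<in>H. c h * lookup h a)" for c a
    by (simp add: S_def lookup_sum lookup_const_mult)
  have degS: "total_degree a = D" if "a \<in> keys (S c)" for a c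
  proof -
    have "(\<Sum>h\<in>H. c h * lookup h a) \<noteq> 0" using that by (simp add: in_keys_iff lookS)
    then obtain h where "h \<in> H" "c h * lookup h a \<noteq> 0" by (rule sum.not_neutral_contains_not_neutral)
    then show ?thesis using deg[of h a] by (simp add: in_keys_iff)
  qed
  define Z where "Z = {f \<in> carrier (poly_ring n). \<exists>c. \<forall>a\<in>keys (f - S c). D < total_degree a}"
  have "ideal Z (poly_ring n)"
  proof (rule poly_idealI)
    show "Z \<subseteq> carrier (poly_ring n)" by (auto simp: Z_def)
    have "S (\<lambda>_. 0) = 0" by (simp add: S_def)
    then show "0 \<in> Z" unfolding Z_def by (auto simp: poly_carrier_closed intro!: exI[of _ "\<lambda>_. 0"])
    fix f f' assume "f \<in> Z" "f' \<in> Z"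
    then obtain c c' where f: "f \<in> carrier (poly_ring n)" "f' \<in> carrier (poly_ring n)"
      "\<forall>a\<in>keys (f - S c). D < total_degree a" "\<forall>a\<in>keys (f' - S c'). D < total_degree a"
      by (auto simp: Z_def)
    have "S (\<lambda>h. c h + c' h) = S c + S c'"
      by (simp add: S_def single_add distrib_right sum.distrib)
    then have eq: "(f + f') - S (\<lambda>h. c h + c' h) = (f - S c) + (f' - S c')" by (simp add: algebra_simps)
    have "D < total_degree a" if "a \<in> keys ((f + f') - S (\<lambda>h. c h + c' h))" for a
      using that f(3,4) Poly_Mapping.keys_add[of "f - S c" "f' - S c'"] unfolding eq by blast
    then show "f + f' \<in> Z" using f(1,2) by (auto simp: Z_def poly_carrier_closed)
  next
    fix f r assume "f \<in> Z" and r: "r \<in> carrier (poly_ring n)"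
    then obtain c where f: "f \<in> carrier (poly_ring n)" "\<forall>a\<in>keys (f - S c). D < total_degree a"
      by (auto simp: Z_def)
    define r0 where "r0 = lookup r 0"
    let ?r = "r - single 0 r0"
    have "S (\<lambda>h. r0 * c h) = single 0 r0 * S c"
      unfolding S_def sum_distrib_left by (rule sum.cong) (simp_all add: mult_single mult.assoc[symmetric])
    then have eq: "r * f - S (\<lambda>h. r0 * c h) = r * (f - S c) + ?r * S c" by (simp add: algebra_simps)
    have "D < total_degree a" if a: "a \<in> keys (r * f - S (\<lambda>h. r0 * c h))" for a
    proof -
      have "a \<in> keys (r * (f - S c)) \<or> a \<in> keys (?r * S c)"
        using a Poly_Mapping.keys_add[of "r * (f - S c)" "?r * S c"] unfolding eq by blast
      then show ?thesis
      proof
        assume "a \<in> keys (r * (f - S c))"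
        then obtain u v where "a = u + v" "v \<in> keys (f - S c)"
          using Poly_Mapping.keys_mult[of r "f - S c"] by blast
        then show ?thesis using f(2) by (auto simp: wt_add intro: less_le_trans)
      next
        assume "a \<in> keys (?r * S c)"
        then obtain u v where uv: "a = u + v" "u \<in> keys ?r" "v \<in> keys (S c)"
          using Poly_Mapping.keys_mult[of ?r "S c"] by blast
        have "u \<noteq> 0" using uv(2) by (auto simp: in_keys_iff lookup_minus r0_def)
        then have "0 < total_degree u" using wt_one_eq_0[of u] by blast
        then show ?thesis using degS[OF uv(3)] by (simp add: uv(1) wt_add)
      qed
    qed
    then show "r * f \<in> Z" using f(1) r by (auto simp: Z_def poly_carrier_closed)
  qed
  moreover have "H \<subseteq> Z"
  proof
    fix h assume h: "h \<in> H"
    have "S (\<lambda>g. if g = h then 1 else 0) = (\<Sum>g\<in>H. if g = h then h else 0)"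
      unfolding S_def by (rule sum.cong) simp_all
    then have "S (\<lambda>g. if g = h then 1 else 0) = h" using H(1) h by simp
    then show "h \<in> Z" using h H(2) unfolding Z_def
      by (intro CollectI conjI exI[of _ "\<lambda>g. if g = h then 1 else 0"]) auto
  qed
  ultimately have "p \<in> Z" using R.genideal_minimal p by blast
  then obtain c where c: "\<forall>a\<in>keys (p - S c). D < total_degree a" by (auto simp: Z_def)
  have "keys (p - S c) = {}"
  proof (rule ccontr)
    assume "keys (p - S c) \<noteq> {}"
    then obtain a where a: "a \<in> keys (p - S c)" by blast
    then have "a \<in> keys p \<or> a \<in> keys (S c)" using keys_diff[of p "S c"] by blast
    then have "total_degree a = D" using degp degS by blast
    then show False using c a by force
  qed
  then have "p = S c" by simp
  then show ?thesis unfolding S_def by blast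
qed

text \<open>In a linear relation the heaviest leading exponent with nonzero coefficient occurs only once.\<close>

lemma not_in_span_of_distinct_leads:
  fixes G :: "cpoly set"
  assumes G: "finite G" and lead: "\<And>h. h \<in> G \<Longrightarrow> leads W h (e h)" and inj: "inj_on e G"
    and H: "H \<subseteq> G" and g: "g \<in> G" "g \<notin> H"
  shows "g \<noteq> (\<Sum>h\<in>H. single 0 (c h) * h)"
proof
  assume eq: "g = (\<Sum>h\<in>H. single 0 (c h) * h)"
  define d where "d h = (if h = g then - 1 else c h)" for h
  let ?K = "{h \<in> insert g H. d h \<noteq> 0}"
  have finH: "finite H" using G H finite_subset by blast
  have zero: "(\<Sum>h\<in>insert g H. d h * lookup h a) = 0" for a
  proof -
    have "lookup g a = (\<Sum>h\<in>H. c h * lookup h a)"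
      by (subst eq) (simp add: lookup_sum lookup_const_mult)
    also have "\<dots> = (\<Sum>h\<in>H. d h * lookup h a)"
      by (rule sum.cong) (use g(2) in \<open>auto simp: d_def\<close>)
    finally show ?thesis using finH g(2) by (simp add: d_def)
  qed
  have KG: "?K \<subseteq> G" using H g by auto
  have finK: "finite ?K" using finH by simp
  have "g \<in> ?K" by (simp add: d_def)
  then have ne: "(\<lambda>h. wt W (e h)) ` ?K \<noteq> {}" by blast
  obtain h where h: "h \<in> ?K" "wt W (e h) = Max ((\<lambda>h. wt W (e h)) ` ?K)"
    using Max_in[OF _ ne] finK by fastforce
  have other: "d h' * lookup h' (e h) = 0" if h': "h' \<in> insert g H" "h' \<noteq> h" for h'
  proof (cases "d h' = 0")
    case False
    then have K: "h' \<in> ?K" using h'(1) by simp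
    have "wt W (e h') \<le> wt W (e h)" unfolding h(2) by (rule Max_ge) (use finK K in auto)
    moreover have "e h \<noteq> e h'" using inj_onD[OF inj, of h h'] h(1) K KG h'(2) by blast
    ultimately have "e h \<notin> keys h'"
      using lead[of h'] K KG unfolding leads_def by (meson leD subsetD)
    then show ?thesis by (simp add: in_keys_iff)
  qed simp
  have "(\<Sum>h'\<in>insert g H. d h' * lookup h' (e h)) = d h * lookup h (e h)"
  proof -
    have "(\<Sum>h'\<in>insert g H. d h' * lookup h' (e h)) = (\<Sum>h'\<in>{h}. d h' * lookup h' (e h))"
      by (rule sum.mono_neutral_right) (use finH h(1) other in auto)
    then show ?thesis by simp
  qed
  moreover have "d h \<noteq> 0" using h(1) by simp
  moreover have "lookup h (e h) \<noteq> 0"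
    using lead[of h] h(1) KG by (auto simp: leads_def in_keys_iff)
  ultimately show False using zero by simp
qed

text \<open>With the natural order of the variables, the exponent of an entry records its row and component.\<close>

lemma garnir_lead:
  assumes l: "0 < l" and k: "0 < k - 1" "m \<le> k - 1"
    and \<Lambda>: "\<Lambda> = (lambda0 k m n, lambda1 k m n)" and T: "T \<in> standard_tableaux n \<Lambda>"
  shows "\<exists>a. leads (\<lambda>i. i) (garnir_poly l \<Lambda> T) a \<and>
    (\<forall>e i j. (e, i, j) \<in> boxes \<Lambda> \<longrightarrow>
      lookup a (T (e, i, j)) = (if e = 1 then 1 else 0) + l * (i - 1))"
proof (intro exI conjI allI impI)
  let ?c = "k - 1 - m"
  let ?col = "tableau_colouring ?c \<Lambda> T"
  have bij: "bij_betw T (boxes \<Lambda>) {1..n}" using T by (simp add: standard_tableaux_def)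
  show "leads (\<lambda>i. i) (garnir_poly l \<Lambda> T) (colour_lead (\<lambda>i. i) l ?c n ?col)"
    unfolding garnir_poly_eq_colour_poly[OF k \<Lambda> T] by (rule leads_colour_poly) (use l in simp_all)
  fix e i j assume b: "(e, i, j) \<in> boxes \<Lambda>"
  have x: "T (e, i, j) \<in> {1..n}" using bij b by (rule bij_betw_apply)
  have "?col (T (e, i, j)) < ?c \<longleftrightarrow> e = 1"
    using tableau_colouring_box[OF bij b, of ?c] column_colour_less(2)[OF k, of e i j n] b \<Lambda> by simp
  then show "lookup (colour_lead (\<lambda>i. i) l ?c n ?col) (T (e, i, j)) = (if e = 1 then 1 else 0) + l * (i - 1)"
    using lookup_colour_lead[of "\<lambda>i. i" n "T (e, i, j)" l ?c ?col] x tableau_colouring_rank[OF k \<Lambda> T b] by simp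
qed

lemma finite_standard_tableaux: "finite (standard_tableaux n \<Lambda>)"
proof (rule finite_subset)
  show "standard_tableaux n \<Lambda> \<subseteq> boxes \<Lambda> \<rightarrow>\<^sub>E {1..n}"
    by (auto simp: standard_tableaux_def bij_betw_def PiE_def)
  show "finite (boxes \<Lambda> \<rightarrow>\<^sub>E {1..n})"
    by (intro finite_PiE) (simp_all add: boxes_def finite_diagram)
qed

theorem garnir_set_minimal:
  assumes l: "0 < l" and k: "0 < k - 1" "m \<le> k - 1" and lm: "1 < l \<or> m = k - 1"
  shows "minimal_generating_set (poly_ring n) (I_ideal k l m n) (garnir_set k l m n)"
  unfolding minimal_generating_set_def
proof (intro conjI allI impI notI)
  let ?\<Lambda> = "(lambda0 k m n, lambda1 k m n)"
  let ?G = "garnir_set k l m n"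
  show gen: "generates (poly_ring n) (I_ideal k l m n) ?G" by (rule garnir_set_generates[OF l k])
  fix H assume H: "H \<subset> ?G" and genH: "generates (poly_ring n) (I_ideal k l m n) H"
  have G: "?G = garnir_poly l ?\<Lambda> ` standard_tableaux n ?\<Lambda>" by (simp add: garnir_set_def Let_def)
  have finG: "finite ?G" unfolding G by (intro finite_imageI finite_standard_tableaux)
  obtain L where L: "\<And>T. T \<in> standard_tableaux n ?\<Lambda> \<Longrightarrow> leads (\<lambda>i. i) (garnir_poly l ?\<Lambda> T) (L T)"
    "\<And>T e i j. T \<in> standard_tableaux n ?\<Lambda> \<Longrightarrow> (e, i, j) \<in> boxes ?\<Lambda> \<Longrightarrow>
      lookup (L T) (T (e, i, j)) = (if e = 1 then 1 else 0) + l * (i - 1)"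
  proof -
    have "\<forall>T\<in>standard_tableaux n ?\<Lambda>. \<exists>a. leads (\<lambda>i. i) (garnir_poly l ?\<Lambda> T) a \<and>
      (\<forall>e i j. (e, i, j) \<in> boxes ?\<Lambda> \<longrightarrow>
        lookup a (T (e, i, j)) = (if e = 1 then 1 else 0) + l * (i - 1))"
      using garnir_lead[OF l k refl] by (rule ballI)
    from bchoice[OF this] show ?thesis using that by blast
  qed
  have Linj: "T = T'" if T: "T \<in> standard_tableaux n ?\<Lambda>" "T' \<in> standard_tableaux n ?\<Lambda>" and eq: "L T = L T'" for T T'
  proof (rule standard_tableau_eqI[OF refl T])
    fix e i j e' i' j' assume b: "(e, i, j) \<in> boxes ?\<Lambda>" "(e', i', j') \<in> boxes ?\<Lambda>" "T (e, i, j) = T' (e', i', j')"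
    have eq: "(if e = 1 then 1 else 0) + l * (i - 1) = (if e' = 1 then 1 else 0) + l * (i' - 1)"
      using L(2)[OF T(1) b(1)] L(2)[OF T(2) b(2)] b(3) eq by simp
    have e: "e = 0 \<or> e = 1" "e' = 0 \<or> e' = 1" "1 \<le> i" "1 \<le> i'" using b by (auto simp: mem_boxes)
    have ee: "e = e'"
    proof (cases "1 < l")
      case True
      have "(if e = 1 then 1 else 0) mod l = (if e' = 1 then 1 else 0) mod l"
        using arg_cong[OF eq, of "\<lambda>x. x mod l"] by (simp only: mod_mult_self2)
      then have "e = 1 \<longleftrightarrow> e' = 1" using True by (cases "e = 1"; cases "e' = 1") simp_all
      then show ?thesis using e(1,2) by presburger
    next
      case False
      then have "row_length k m n 1 i = 0" for i using lm row_length_le(2)[OF k, of n i] by simp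
      then have "e \<noteq> 1" "e' \<noteq> 1" using b by (auto simp: mem_boxes)
      then show ?thesis using e by simp
    qed
    then have "i - 1 = i' - 1" using eq l by simp
    then show "e = e' \<and> i = i'" using ee e by simp
  qed
  define P where "P = inv_into (standard_tableaux n ?\<Lambda>) (garnir_poly l ?\<Lambda>)"
  have P: "P h \<in> standard_tableaux n ?\<Lambda> \<and> h = garnir_poly l ?\<Lambda> (P h)" if "h \<in> ?G" for h
    using inv_into_into f_inv_into_f that unfolding G P_def by metis
  obtain g where g: "g \<in> ?G" "g \<notin> H" using H by blast
  have Hc: "H \<subseteq> carrier (poly_ring n)" "finite H" using genH H finG finite_subset by (auto simp: generates_def)
  have "g \<in> genideal (poly_ring n) H"
    using g(1) garnir_set_subset_I[OF l k] genH by (auto simp: generates_def)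
  then have "\<exists>c. g = (\<Sum>h\<in>H. single 0 (c h) * h)"
    using H g(1) unfolding G
    by (intro homogeneous_in_genideal[OF Hc(2,1), where D = "card ({1} \<times> diagram (snd ?\<Lambda>) :: (nat \<times> nat \<times> nat) set) + l * card (column_pairs ?\<Lambda>)"])
       (auto dest!: keys_garnir_degree)
  then obtain c where "g = (\<Sum>h\<in>H. single 0 (c h) * h)" by blast
  moreover have "g \<noteq> (\<Sum>h\<in>H. single 0 (c h) * h)"
  proof (rule not_in_span_of_distinct_leads[OF finG _ _ _ g])
    show "leads (\<lambda>i. i) h (L (P h))" if "h \<in> ?G" for h using L(1) P[OF that] by metis
    show "inj_on (\<lambda>h. L (P h)) ?G"
    proof (rule inj_onI)
      fix h h' assume h: "h \<in> ?G" "h' \<in> ?G" "L (P h) = L (P h')"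
      have "P h = P h'" using Linj P[OF h(1)] P[OF h(2)] h(3) by blast
      then show "h = h'" using P[OF h(1)] P[OF h(2)] by metis
    qed
    show "H \<subseteq> ?G" using H by blast
  qed
  ultimately show False by contradiction
qed

theorem theorem1p1:
  fixes k l m n :: nat
  assumes "1 \<le> l" and "1 \<le> n" and "2 \<le> k" and "k \<le> n" and "m \<le> k - 1"
  shows "generates (poly_ring n) (I_ideal k l m n) (garnir_set k l m n) \<and>
    (1 < l \<or> m = k - 1 \<longrightarrow>
      minimal_generating_set (poly_ring n) (I_ideal k l m n) (garnir_set k l m n))"
  using garnir_set_generates[of l k m n] garnir_set_minimal[of l k m n] assms by simp

end
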